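(* Let $m,n\in\mathbb{N}$, $p=(t(p),x(p))\in\mathbb{R}^m\times\mathbb{R}^n$, let $\Omega\subset\mathbb{R}^n$ be non-empty, open and bounded with smooth boundary, and let $\mathfrak{U}=G\times\Omega$ with $G=(-T,T)^m$. Put $R_+:=\sup_{\mathfrak{U}\cap\mathfrak{D}_p}r_p$ and let $T>R_+$. Let $\mathcal{X}\in C^\infty(\bar{\mathfrak{U}};\mathbb{R}^{m+n})$ vanish identically on $\mathfrak{U}\cap\partial\mathfrak{D}_p$, and let $V,F\in C^\infty(\bar{\mathfrak{U}})$, $H\in C^\infty(\bar G)$. Let $\sigma>0$, let $\varepsilon=\delta^2R_+^{-1}$ with $0<\delta\ll1$, and let $W_p^\varepsilon:=\mathcal{O}_\sigma(\Gamma_p^\varepsilon)\cap(\mathfrak{U}\cap\mathfrak{D}_p)$, where $$\Gamma_p^\varepsilon:=\partial\mathfrak{U}\cap\mathfrak{D}_p\cap\{(1-\varepsilon r_p)\mathcal{N}f_p+\varepsilon f_p\mathcal{N}r_p>0\}.$$ Let $z_1,z_2$ be two solutions of $$\square z+\nabla_{\mathcal{X}}z+V(t,x)z=F(t,x)\ \text{ in }\mathfrak{U},\qquad z(t,x)=H(t)\ \text{ for }(t,x)\in\partial\mathfrak{U}.$$ Then: (1) If $(z_1,\nabla_t z_1)=(z_2,\nabla_t z_2)$ on $W_p^\varepsilon$, then $z_1=z_2$ on $\mathfrak{U}\cap\mathfrak{D}_p$. (2) If $(z_1,\nabla_x z_1)=(z_2,\nabla_x z_2)$ on $W_p^\varepsilon$,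 then $z_1=z_2$ on $\mathfrak{U}\cap\mathfrak{D}_p$.
   Context: Coordinates on $\mathbb{R}^{m+n}=\mathbb{R}^m\times\mathbb{R}^n$ are $(t,x)$; $\nabla_t z=(\partial_{t_1}z,\dots,\partial_{t_m}z)$, $\nabla_x z=(\partial_{x_1}z,\dots,\partial_{x_n}z)$, $\square=-\sum_{i=1}^m\partial_{t_i}^2+\sum_{j=1}^n\partial_{x_j}^2$, and $\nabla_{\mathcal{X}}z=\mathcal{X}^\alpha\partial_\alpha z$. Only the spatial part of the boundary is used: $\partial\mathfrak{U}:=G\times\partial\Omega$. $\mathcal{N}$ is the outward unit normal on $\partial\mathfrak{U}$, i.e. $\mathcal{N}=\sum_j\nu^{x_j}\partial_{x_j}$ with $\nu^x$ the outward unit normal of $\Omega$. $r_p:=|x-x(p)|$, $f_p:=\frac14\left(|x-x(p)|^2-|t-t(p)|^2\right)$, $\mathfrak{D}_p:=\{f_p>0\}$, so $\partial\mathfrak{D}_p=\{f_p=0\}$. For $y\in\mathbb{R}^n$, $\mathcal{O}_\sigma(y):=\{y_1\in\mathbb{R}^n:\|y_1-y\|<\sigma\}$, and $\mathcal{O}_\sigma(\Gamma_p^\varepsilon):=\bigcup_{(t,y)\in\Gamma_p^\varepsilon}\{t\}\times\mathcal{O}_\sigma(y)\subset\mathbb{R}^{m+n}$. A solution is a function $z\in C^2(\mathfrak{U})\cap C^1(\bar{\mathfrak{U}})$ satisfying the equation in $\mathfrak{U}$ and the boundary condition on $\partial\mathfrak{U}$. $0<\delta\ll1$ means that $\delta$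 is positive and smaller than a sufficiently small constant depending only on $m,n$. Standing assumption on $T$: $T$ is large enough that the temporal part of the boundary of $\mathfrak{U}$ is not encountered, i.e. the boundary of $\mathfrak{U}\cap\mathfrak{D}_p$ is made up only of (the closures of) $\mathfrak{U}\cap\partial\mathfrak{D}_p$ and $\partial\mathfrak{U}\cap\mathfrak{D}_p$; equivalently the closure of $\mathfrak{U}\cap\mathfrak{D}_p$ does not meet $\partial G\times\bar\Omega$. *)

theory Defs
  imports "HOL-Analysis.Analysis"
begin

section \<open>Functions of class \<open>C\<^sup>k\<close>\<close>

definition partial_deriv ::
    "'a::euclidean_space \<Rightarrow> ('a \<Rightarrow> 'b::real_normed_vector) \<Rightarrow> 'a \<Rightarrow> 'b" where
  "partial_deriv b f = (\<lambda>q. frechet_derivative f (at q) b)"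

definition iter_partial ::
    "'a::euclidean_space list \<Rightarrow> ('a \<Rightarrow> 'b::real_normed_vector) \<Rightarrow> 'a \<Rightarrow> 'b" where
  "iter_partial bs f = foldr partial_deriv bs f"

definition Ck_on :: "nat \<Rightarrow> 'a::euclidean_space set \<Rightarrow> ('a \<Rightarrow> 'b::real_normed_vector) \<Rightarrow> bool" where
  "Ck_on k S f \<longleftrightarrow>
     (\<forall>bs. set bs \<subseteq> Basis \<and> length bs < k \<longrightarrow> (\<forall>q\<in>S. iter_partial bs f differentiable (at q))) \<and>
     (\<forall>bs. set bs \<subseteq> Basis \<and> length bs \<le> k \<longrightarrow> continuous_on S (iter_partial bs f))"

text \<open>
  The class \<open>C\<^sup>k\<close> on the closure of an open set \<open>S\<close>: all partial derivatives in \<open>S\<close> of order at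
  most \<open>k\<close> extend continuously to the closure. The values of \<open>f\<close> itself on the boundary are
  required to be the continuous extension; derivatives of \<open>f\<close> are only ever taken at points of \<open>S\<close>.
\<close>

definition Ck_closure ::
    "nat \<Rightarrow> 'a::euclidean_space set \<Rightarrow> ('a \<Rightarrow> 'b::real_normed_vector) \<Rightarrow> bool" where
  "Ck_closure k S f \<longleftrightarrow> Ck_on k S f \<and> continuous_on (closure S) f \<and>
     (\<forall>bs. set bs \<subseteq> Basis \<and> length bs \<le> k \<longrightarrow>
        (\<exists>g. continuous_on (closure S) g \<and> (\<forall>q\<in>S. g q = iter_partial bs f q)))"

definition smooth_on :: "'a::euclidean_space set \<Rightarrow> ('a \<Rightarrow> 'b::real_normed_vector) \<Rightarrow> bool" where
  "smooth_on S f \<longleftrightarrow> (\<forall>k. Ck_on k S f)"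

definition smooth_closure :: "'a::euclidean_space set \<Rightarrow> ('a \<Rightarrow> 'b::real_normed_vector) \<Rightarrow> bool" where
  "smooth_closure S f \<longleftrightarrow> (\<forall>k. Ck_closure k S f)"

section \<open>Smooth boundaries and the outward unit normal\<close>

definition gradient :: "('a::euclidean_space \<Rightarrow> real) \<Rightarrow> 'a \<Rightarrow> 'a" where
  "gradient f y = (\<Sum>b\<in>Basis. partial_deriv b f y *\<^sub>R b)"

definition local_defining_function ::
    "'a::euclidean_space set \<Rightarrow> 'a \<Rightarrow> real \<Rightarrow> ('a \<Rightarrow> real) \<Rightarrow> bool" where
  "local_defining_function \<Omega> y r \<phi> \<longleftrightarrow>
     r > 0 \<and> smooth_on (ball y r) \<phi> \<and> (\<forall>w\<in>ball y r. gradient \<phi> w \<noteq> 0) \<and> \<phi> y = 0 \<and>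
     \<Omega> \<inter> ball y r = {w \<in> ball y r. \<phi> w < 0}"

definition has_smooth_boundary :: "'a::euclidean_space set \<Rightarrow> bool" where
  "has_smooth_boundary \<Omega> \<longleftrightarrow> (\<forall>y\<in>frontier \<Omega>. \<exists>r \<phi>. local_defining_function \<Omega> y r \<phi>)"

text \<open>
  Recall that \<open>sgn v\<close> is \<open>v\<close> divided by its norm. The normal does not depend on the defining
  function, see \<open>outward_normal_eq\<close> below.
\<close>

definition outward_normal :: "'a::euclidean_space set \<Rightarrow> 'a \<Rightarrow> 'a" where
  "outward_normal \<Omega> y =
     (THE \<nu>. \<exists>r \<phi>. local_defining_function \<Omega> y r \<phi> \<and> \<nu> = sgn (gradient \<phi> y))"

lemma local_defining_function_has_derivative:
  assumes "local_defining_function \<Omega> y r \<phi>"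
  shows "(\<phi> has_derivative (\<lambda>v. gradient \<phi> y \<bullet> v)) (at y)"
proof -
  have "Ck_on 1 (ball y r) \<phi>" and r: "r > 0"
    using assms by (auto simp: local_defining_function_def smooth_on_def)
  then have "iter_partial [] \<phi> differentiable (at y)"
    unfolding Ck_on_def
    by (metis centre_in_ball empty_subsetI list.set(1) list.size(3) zero_less_one)
  then have d: "(\<phi> has_derivative frechet_derivative \<phi> (at y)) (at y)"
    by (simp add: iter_partial_def frechet_derivative_works)
  then interpret bounded_linear "frechet_derivative \<phi> (at y)"
    by (rule has_derivative_bounded_linear)
  have "frechet_derivative \<phi> (at y) v = gradient \<phi> y \<bullet> v" for v
  proof -
    have "frechet_derivative \<phi> (at y) v = frechet_derivative \<phi> (at y) (\<Sum>b\<in>Basis. (v \<bullet> b) *\<^sub>R b)"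
      by (simp add: euclidean_representation)
    also have "\<dots> = (\<Sum>b\<in>Basis. (v \<bullet> b) * frechet_derivative \<phi> (at y) b)"
      by (simp add: sum scaleR)
    also have "\<dots> = gradient \<phi> y \<bullet> v"
      by (simp add: gradient_def partial_deriv_def inner_sum_left inner_commute[of v] mult.commute)
    finally show ?thesis .
  qed
  then have "frechet_derivative \<phi> (at y) = (\<lambda>v. gradient \<phi> y \<bullet> v)" by blast
  with d show ?thesis by simp
qed

lemma local_defining_function_direction:
  assumes 1: "local_defining_function \<Omega> y r \<phi>" and 2: "local_defining_function \<Omega> y r' \<psi>"
    and v: "gradient \<phi> y \<bullet> v < 0"
  shows "gradient \<psi> y \<bullet> v \<le> 0"
proof (rule ccontr)
  assume "\<not> ?thesis"
  then have v': "gradient \<psi> y \<bullet> v > 0" by simp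
  have D: "DERIV (\<lambda>s. g (y + s *\<^sub>R v)) 0 :> gradient g y \<bullet> v"
    if "local_defining_function \<Omega> y \<rho> g" for \<rho> g
  proof -
    have a: "((\<lambda>s. y + s *\<^sub>R v) has_derivative (\<lambda>s. s *\<^sub>R v)) (at 0)"
      by (auto intro!: derivative_eq_intros)
    have "(g has_derivative (\<lambda>v. gradient g y \<bullet> v)) (at (y + 0 *\<^sub>R v))"
      using local_defining_function_has_derivative[OF that] by simp
    from has_derivative_compose[OF a this]
    have "((\<lambda>s. g (y + s *\<^sub>R v)) has_derivative (\<lambda>s. gradient g y \<bullet> (s *\<^sub>R v))) (at 0)" .
    moreover have "(\<lambda>s. gradient g y \<bullet> (s *\<^sub>R v)) = (*) (gradient g y \<bullet> v)"
      by (rule ext) simp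
    ultimately show ?thesis unfolding has_field_derivative_def by metis
  qed
  obtain d1 where d1: "d1 > 0" "\<And>h. 0 < h \<Longrightarrow> h < d1 \<Longrightarrow> \<phi> (y + h *\<^sub>R v) < 0"
    using DERIV_neg_dec_right[OF D[OF 1] v] 1
    unfolding local_defining_function_def by auto
  obtain d2 where d2: "d2 > 0" "\<And>h. 0 < h \<Longrightarrow> h < d2 \<Longrightarrow> \<psi> (y + h *\<^sub>R v) > 0"
    using DERIV_pos_inc_right[OF D[OF 2] v'] 2
    unfolding local_defining_function_def by auto
  define d3 where "d3 = min r r' / (norm v + 1)"
  have d3: "d3 > 0"
    using 1 2 by (simp add: d3_def local_defining_function_def add_nonneg_pos)
  define h where "h = min d1 (min d2 d3) / 2"
  have h: "0 < h" "h < d1" "h < d2" "h < d3"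
    using d1(1) d2(1) d3 by (auto simp: h_def)
  have "h * norm v \<le> h * (norm v + 1)" using h by simp
  also have "\<dots> < d3 * (norm v + 1)"
    using h by (intro mult_strict_right_mono) (auto simp: add_nonneg_pos)
  also have "\<dots> = min r r'"
    by (simp add: d3_def add_nonneg_eq_0_iff)
  finally have "y + h *\<^sub>R v \<in> ball y r" "y + h *\<^sub>R v \<in> ball y r'"
    using h by (auto simp: dist_norm)
  moreover have "\<phi> (y + h *\<^sub>R v) < 0" "\<psi> (y + h *\<^sub>R v) > 0"
    using d1(2) d2(2) h by auto
  ultimately have "y + h *\<^sub>R v \<in> \<Omega>" "y + h *\<^sub>R v \<notin> \<Omega>"
    using IntI[of "y + h *\<^sub>R v" \<Omega> "ball y r'"] 1 2
    unfolding local_defining_function_def by (blast, auto simp del: mem_ball)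
  then show False by blast
qed

lemma outward_normal_eq:
  assumes "local_defining_function \<Omega> y r \<phi>"
  shows "outward_normal \<Omega> y = sgn (gradient \<phi> y)"
  unfolding outward_normal_def
proof (rule the_equality)
  fix \<nu> assume "\<exists>r \<phi>. local_defining_function \<Omega> y r \<phi> \<and> \<nu> = sgn (gradient \<phi> y)"
  then obtain r' \<psi> where 2: "local_defining_function \<Omega> y r' \<psi>" and \<nu>: "\<nu> = sgn (gradient \<psi> y)"
    by blast
  let ?a = "gradient \<phi> y" and ?b = "gradient \<psi> y"
  have nz: "?a \<noteq> 0" "?b \<noteq> 0"
    using assms 2 by (auto simp: local_defining_function_def)
  let ?v = "sgn ?b - sgn ?a"
  have unit: "sgn ?a \<bullet> sgn ?a = 1" "sgn ?b \<bullet> sgn ?b = 1"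
    using nz by (simp_all add: dot_square_norm norm_sgn)
  have sc: "?a \<bullet> w = norm ?a * (sgn ?a \<bullet> w)" "?b \<bullet> w = norm ?b * (sgn ?b \<bullet> w)" for w
    using nz by (simp_all add: sgn_div_norm)
  have "sgn ?b = sgn ?a"
  proof (rule ccontr)
    assume "sgn ?b \<noteq> sgn ?a"
    then have "?v \<bullet> ?v > 0" by simp
    then have lt: "sgn ?a \<bullet> sgn ?b < 1"
      using unit by (simp add: inner_diff_left inner_diff_right inner_commute)
    have "?a \<bullet> ?v < 0"
      using lt nz unit unfolding sc by (simp add: inner_diff_right mult_pos_neg)
    from local_defining_function_direction[OF assms 2 this]
    have "sgn ?b \<bullet> ?v \<le> 0"
      using nz unfolding sc by (simp add: mult_le_0_iff)
    with lt unit show False by (simp add: inner_diff_right inner_commute)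
  qed
  with \<nu> show "\<nu> = sgn ?a" by simp
qed (use assms in blast)

section \<open>Differential operators on \<open>\<real>\<^sup>m \<times> \<real>\<^sup>n\<close>\<close>

definition d_t :: "'m::finite \<Rightarrow> ((real^'m) \<times> (real^'n) \<Rightarrow> real) \<Rightarrow> (real^'m) \<times> (real^'n) \<Rightarrow> real" where
  "d_t i z = partial_deriv (axis i 1, 0) z"

definition d_x :: "'n::finite \<Rightarrow> ((real^'m) \<times> (real^'n) \<Rightarrow> real) \<Rightarrow> (real^'m) \<times> (real^'n) \<Rightarrow> real" where
  "d_x j z = partial_deriv (0, axis j 1) z"

definition grad_t :: "((real^'m) \<times> (real^'n) \<Rightarrow> real) \<Rightarrow> (real^'m) \<times> (real^'n) \<Rightarrow> real^'m" where
  "grad_t z q = (\<chi> i. d_t i z q)"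

definition grad_x :: "((real^'m) \<times> (real^'n) \<Rightarrow> real) \<Rightarrow> (real^'m) \<times> (real^'n) \<Rightarrow> real^'n" where
  "grad_x z q = (\<chi> j. d_x j z q)"

definition wave_op :: "((real^'m) \<times> (real^'n) \<Rightarrow> real) \<Rightarrow> (real^'m) \<times> (real^'n) \<Rightarrow> real" where
  "wave_op z q = - (\<Sum>i\<in>UNIV. d_t i (d_t i z) q) + (\<Sum>j\<in>UNIV. d_x j (d_x j z) q)"

definition nabla_vec ::
    "((real^'m) \<times> (real^'n) \<Rightarrow> (real^'m) \<times> (real^'n)) \<Rightarrow> ((real^'m) \<times> (real^'n) \<Rightarrow> real) \<Rightarrow>
     (real^'m) \<times> (real^'n) \<Rightarrow> real" where
  "nabla_vec X z q =
     (\<Sum>i\<in>UNIV. (fst (X q) $ i) * d_t i z q) + (\<Sum>j\<in>UNIV. (snd (X q) $ j) * d_x j z q)"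

section \<open>The cylinder, the exterior of the null cone, and the observation region\<close>

definition time_box :: "real \<Rightarrow> (real^'m) set" where
  "time_box T = {t. \<forall>i. - T < t $ i \<and> t $ i < T}"

definition cylinder :: "real \<Rightarrow> (real^'n) set \<Rightarrow> ((real^'m) \<times> (real^'n)) set" where
  "cylinder T \<Omega> = time_box T \<times> \<Omega>"

definition lateral_boundary :: "real \<Rightarrow> (real^'n) set \<Rightarrow> ((real^'m) \<times> (real^'n)) set" where
  "lateral_boundary T \<Omega> = time_box T \<times> frontier \<Omega>"

definition normal_deriv ::
    "(real^'n) set \<Rightarrow> ((real^'m) \<times> (real^'n) \<Rightarrow> real) \<Rightarrow> (real^'m) \<times> (real^'n) \<Rightarrow> real" where
  "normal_deriv \<Omega> g q = (\<Sum>j\<in>UNIV. (outward_normal \<Omega> (snd q) $ j) * d_x j g q)"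

definition r_fun :: "(real^'m) \<times> (real^'n) \<Rightarrow> (real^'m) \<times> (real^'n) \<Rightarrow> real" where
  "r_fun p q = norm (snd q - snd p)"

definition f_fun :: "(real^'m) \<times> (real^'n) \<Rightarrow> (real^'m) \<times> (real^'n) \<Rightarrow> real" where
  "f_fun p q = (1/4) * ((norm (snd q - snd p))\<^sup>2 - (norm (fst q - fst p))\<^sup>2)"

definition cone_exterior :: "(real^'m) \<times> (real^'n) \<Rightarrow> ((real^'m) \<times> (real^'n)) set" where
  "cone_exterior p = {q. f_fun p q > 0}"

text \<open>
  Meaningful only if the cylinder meets the exterior of the cone, since \<open>Sup {}\<close> is unspecified on
  the reals.
\<close>

definition R_plus :: "(real^'m) \<times> (real^'n) \<Rightarrow> real \<Rightarrow> (real^'n) set \<Rightarrow> real" where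
  "R_plus p T \<Omega> = (SUP q \<in> cylinder T \<Omega> \<inter> cone_exterior p. r_fun p q)"

definition Gamma_obs ::
    "(real^'m) \<times> (real^'n) \<Rightarrow> real \<Rightarrow> (real^'n) set \<Rightarrow> real \<Rightarrow> ((real^'m) \<times> (real^'n)) set" where
  "Gamma_obs p T \<Omega> \<epsilon> = {q \<in> lateral_boundary T \<Omega> \<inter> cone_exterior p.
     (1 - \<epsilon> * r_fun p q) * normal_deriv \<Omega> (f_fun p) q
       + \<epsilon> * f_fun p q * normal_deriv \<Omega> (r_fun p) q > 0}"

definition spatial_nbhd ::
    "real \<Rightarrow> ((real^'m) \<times> (real^'n)) set \<Rightarrow> ((real^'m) \<times> (real^'n)) set" where
  "spatial_nbhd \<sigma> A = (\<Union>(t, y)\<in>A. {t} \<times> ball y \<sigma>)"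

definition W_obs ::
    "(real^'m) \<times> (real^'n) \<Rightarrow> real \<Rightarrow> (real^'n) set \<Rightarrow> real \<Rightarrow> real \<Rightarrow>
     ((real^'m) \<times> (real^'n)) set" where
  "W_obs p T \<Omega> \<sigma> \<epsilon> =
     spatial_nbhd \<sigma> (Gamma_obs p T \<Omega> \<epsilon>) \<inter> (cylinder T \<Omega> \<inter> cone_exterior p)"

definition is_solution ::
    "real \<Rightarrow> (real^'n) set \<Rightarrow> ((real^'m) \<times> (real^'n) \<Rightarrow> (real^'m) \<times> (real^'n)) \<Rightarrow>
     ((real^'m) \<times> (real^'n) \<Rightarrow> real) \<Rightarrow> ((real^'m) \<times> (real^'n) \<Rightarrow> real) \<Rightarrow> (real^'m \<Rightarrow> real) \<Rightarrow>
     ((real^'m) \<times> (real^'n) \<Rightarrow> real) \<Rightarrow> bool" where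
  "is_solution T \<Omega> X V F H z \<longleftrightarrow>
     Ck_on 2 (cylinder T \<Omega>) z \<and> Ck_closure 1 (cylinder T \<Omega>) z \<and>
     (\<forall>q\<in>cylinder T \<Omega>. wave_op z q + nabla_vec X z q + V q * z q = F q) \<and>
     (\<forall>(t, x)\<in>lateral_boundary T \<Omega>. z (t, x) = H t)"

end

theory Submission
  imports Defs
begin

text \<open>
  Put \<open>z = z\<^sub>1 - z\<^sub>2\<close>. On the observation region \<open>z = 0\<close>, and \<open>z\<close> vanishes on the lateral
  boundary. With \<open>\<epsilon>\<close> as in the statement, \<open>F = f / (1 - \<epsilon> r)\<close> has strictly pseudoconvex level
  sets in the exterior of the cone, and \<open>\<Gamma>\<close> is exactly the part of the boundary on which the
  normal derivative of \<open>F\<close> is positive. A Carleman estimate with weight \<open>exp (a F)\<close> on the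
  superlevel set \<open>F > c\<close> therefore has a boundary term with a favourable sign wherever the normal
  derivative of \<open>z\<close> does not vanish, and letting \<open>a\<close> tend to infinity gives \<open>z = 0\<close> on every set
  \<open>F > c\<close> with \<open>c > 0\<close>. These sets stay away from the cone, so no condition at the cone enters.

  The boundary is never flattened: in the divergence theorem the current is multiplied by a cutoff
  function of a defining function of the domain, whose gradient is parallel to the normal.
\<close>

section \<open>Divergence theorem for compactly supported fields\<close>

text \<open>Why \<open>f\<close> has to be corrected: its Hessian is half the metric, so the
  quadratic form of the Carleman identity can be made zero but not positive, and the level sets of
  \<open>f\<close> are only borderline pseudoconvex. Dividing by \<open>1 - \<epsilon> r\<close>
  adds a positive multiple of the Hessian of \<open>r\<close>, which is positive on directions
  tangent to the spheres \<open>r = const\<close>; a small shift \<open>\<kappa>\<close> of the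
  multiplier spreads this positivity to the time directions. The gain is uniform only away from the
  cone, where the weight tends to 0. Hence a compact set on which the weight is at least
  \<open>c > 0\<close> is fixed first, all constants come from compactness there, and only then does
  the parameter \<open>a\<close> grow. At the boundary the obstacle is regularity: solutions are C1
  up to the boundary, so the second derivatives of \<open>z\<close> may be unbounded there. The
  divergence identity is therefore used in the interior only, and the boundary enters through the
  continuous extension of the gradient, which is parallel to the normal. The resulting flux has
  merely a weak sign, which need not persist inwards; a small transversal field makes it strict, and
  a strict sign persists by continuity.\<close>

lemma mvt_segment:
  fixes f :: "'a::real_normed_vector \<Rightarrow> real"
  assumes cont: "\<And>s. 0 \<le> s \<Longrightarrow> s \<le> 1 \<Longrightarrow> continuous (at (q + s *\<^sub>R v) within ((\<lambda>s. q + s *\<^sub>R v) ` {0..1})) f"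
    and der: "\<And>s. 0 < s \<Longrightarrow> s < 1 \<Longrightarrow> (f has_derivative f' (q + s *\<^sub>R v)) (at (q + s *\<^sub>R v))"
  obtains s where "0 < s" "s < 1" "f (q + v) - f q = f' (q + s *\<^sub>R v) v"
proof -
  have c: "continuous_on ((\<lambda>s. q + s *\<^sub>R v) ` {0..1}) f"
    using cont by (auto simp: continuous_on_eq_continuous_within)
  have "continuous_on {0..1} (f \<circ> (\<lambda>s. q + s *\<^sub>R v))"
    by (intro continuous_on_compose c continuous_intros)
  moreover have "((f \<circ> (\<lambda>s. q + s *\<^sub>R v)) has_derivative (f' (q + s *\<^sub>R v) \<circ> (\<lambda>h. h *\<^sub>R v))) (at s)"
    if "0 < s" "s < 1" for s
    by (rule diff_chain_at) (use that in \<open>auto intro!: derivative_eq_intros der\<close>)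
  ultimately obtain s where "0 < s" "s < 1"
    "(f \<circ> (\<lambda>s. q + s *\<^sub>R v)) 1 - (f \<circ> (\<lambda>s. q + s *\<^sub>R v)) 0 = (f' (q + s *\<^sub>R v) \<circ> (\<lambda>h. h *\<^sub>R v)) (1 - 0)"
    using mvt[of 0 1 "f \<circ> (\<lambda>s. q + s *\<^sub>R v)" "\<lambda>s. f' (q + s *\<^sub>R v) \<circ> (\<lambda>h. h *\<^sub>R v)"] by auto
  then show ?thesis by (auto intro!: that)
qed

lemma mvt_segment_differentiable:
  fixes f :: "'a::real_normed_vector \<Rightarrow> real"
  assumes der: "\<And>s. 0 \<le> s \<Longrightarrow> s \<le> 1 \<Longrightarrow> (f has_derivative f' (q + s *\<^sub>R v)) (at (q + s *\<^sub>R v))"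
  obtains s where "0 < s" "s < 1" "f (q + v) - f q = f' (q + s *\<^sub>R v) v"
proof (rule mvt_segment[where q=q and v=v and f=f and f'=f'])
  show "continuous (at (q + s *\<^sub>R v) within (\<lambda>s. q + s *\<^sub>R v) ` {0..1}) f" if "0 \<le> s" "s \<le> 1" for s
    using has_derivative_continuous[OF der[OF that]] by (rule continuous_at_imp_continuous_within)
qed (use der in auto)

text \<open>The mean value theorem along \<open>u\<close>, applied to the increment of
  \<open>w\<close> in direction \<open>v\<close>, leaves a difference of two values of
  \<open>W\<close>. Expanding both about \<open>q\<close> cancels the part along \<open>u\<close>
  and leaves \<open>H v \<bullet> u\<close>, so differentiability of \<open>W\<close> at the single
  point \<open>q\<close> suffices.\<close>

lemma second_difference:
  fixes w :: "'a::real_inner \<Rightarrow> real"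
  assumes U: "open U" "q \<in> U"
    and dw: "\<And>x. x \<in> U \<Longrightarrow> (w has_derivative (\<lambda>v. W x \<bullet> v)) (at x)"
    and dW: "(W has_derivative H) (at q)" and e: "e > 0"
  shows "\<exists>d>0. \<forall>s. 0 < s \<and> s < d \<longrightarrow>
     \<bar>w (q + s *\<^sub>R u + s *\<^sub>R v) - w (q + s *\<^sub>R u) - w (q + s *\<^sub>R v) + w q - s\<^sup>2 * (H v \<bullet> u)\<bar> \<le> e * s\<^sup>2"
proof -
  interpret H: bounded_linear H using dW by (rule has_derivative_bounded_linear)
  define L where "L = 2 * (norm u + norm v) * (norm u + 1)"
  have L0: "L \<ge> 0" by (simp add: L_def)
  define e' where "e' = e / (L + 1)"
  have e': "e' > 0" using L0 e by (simp add: e'_def)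
  obtain d1 where d1: "d1 > 0" "\<And>y. norm (y - q) < d1 \<Longrightarrow> norm (W y - W q - H (y - q)) \<le> e' * norm (y - q)"
    using dW e' unfolding has_derivative_at_alt by blast
  obtain d2 where d2: "d2 > 0" "ball q d2 \<subseteq> U" using U by (meson openE)
  define d where "d = min d1 d2 / (norm u + norm v + 1)"
  have d: "d > 0" using d1 d2 by (simp add: d_def add_nonneg_pos)
  show ?thesis
  proof (intro exI[of _ d] conjI d allI impI)
    fix s :: real assume s: "0 < s \<and> s < d"
    have small: "norm (a *\<^sub>R s *\<^sub>R u + b *\<^sub>R s *\<^sub>R v) \<le> s * (norm u + norm v)"
      "s * (norm u + norm v) < min d1 d2" if "0 \<le> a" "a \<le> 1" "0 \<le> b" "b \<le> 1" for a b
    proof -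
      have "norm (a *\<^sub>R s *\<^sub>R u + b *\<^sub>R s *\<^sub>R v) \<le> norm (a *\<^sub>R s *\<^sub>R u) + norm (b *\<^sub>R s *\<^sub>R v)"
        by (rule norm_triangle_ineq)
      also have "\<dots> \<le> s * norm u + s * norm v"
        using that s by (intro add_mono) (auto simp: mult_left_le_one_le)
      finally show "norm (a *\<^sub>R s *\<^sub>R u + b *\<^sub>R s *\<^sub>R v) \<le> s * (norm u + norm v)" by (simp add: algebra_simps)
      have "s * (norm u + norm v) \<le> s * (norm u + norm v + 1)" using s by simp
      also have "\<dots> < d * (norm u + norm v + 1)"
        using s by (intro mult_strict_right_mono) (auto simp: add_nonneg_pos)
      also have "\<dots> = min d1 d2" unfolding d_def
        by (metis add_nonneg_pos nonzero_divide_eq_eq add_nonneg_nonneg norm_ge_zero order_less_irrefl zero_less_one)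
      finally show "s * (norm u + norm v) < min d1 d2" .
    qed
    have inU: "q + (a *\<^sub>R s *\<^sub>R u + b *\<^sub>R s *\<^sub>R v) \<in> U" if "0 \<le> a" "a \<le> 1" "0 \<le> b" "b \<le> 1" for a b
    proof -
      have "norm (a *\<^sub>R s *\<^sub>R u + b *\<^sub>R s *\<^sub>R v) < d2"
        using small[OF that] by linarith
      then have "q + (a *\<^sub>R s *\<^sub>R u + b *\<^sub>R s *\<^sub>R v) \<in> ball q d2"
        unfolding mem_ball dist_commute[of q] by (simp add: dist_norm)
      then show ?thesis using d2 by blast
    qed
    have app: "norm (W (q + (a *\<^sub>R s *\<^sub>R u + b *\<^sub>R s *\<^sub>R v)) - W q - H (a *\<^sub>R s *\<^sub>R u + b *\<^sub>R s *\<^sub>R v))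
        \<le> e' * (s * (norm u + norm v))" if "0 \<le> a" "a \<le> 1" "0 \<le> b" "b \<le> 1" for a b
    proof -
      have "norm (W (q + (a *\<^sub>R s *\<^sub>R u + b *\<^sub>R s *\<^sub>R v)) - W q - H (a *\<^sub>R s *\<^sub>R u + b *\<^sub>R s *\<^sub>R v))
        \<le> e' * norm (a *\<^sub>R s *\<^sub>R u + b *\<^sub>R s *\<^sub>R v)"
        using d1(2)[of "q + (a *\<^sub>R s *\<^sub>R u + b *\<^sub>R s *\<^sub>R v)"] small[OF that] by auto
      also have "\<dots> \<le> e' * (s * (norm u + norm v))"
        using small(1)[OF that] e' by (intro mult_left_mono) auto
      finally show ?thesis .
    qed
    define g where "g = (\<lambda>x. w (x + s *\<^sub>R v) - w x)"
    obtain a where a: "0 < a" "a < 1" and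
      g: "g (q + s *\<^sub>R u) - g q = W (q + a *\<^sub>R s *\<^sub>R u + s *\<^sub>R v) \<bullet> (s *\<^sub>R u) - W (q + a *\<^sub>R s *\<^sub>R u) \<bullet> (s *\<^sub>R u)"
    proof (rule mvt_segment_differentiable[where q=q and v="s *\<^sub>R u" and f=g
          and f'="\<lambda>x h. W (x + s *\<^sub>R v) \<bullet> h - W x \<bullet> h"])
      fix r :: real assume r: "0 \<le> r" "r \<le> 1"
      have 1: "(w has_derivative (\<lambda>h. W (q + r *\<^sub>R s *\<^sub>R u + s *\<^sub>R v) \<bullet> h)) (at (q + r *\<^sub>R s *\<^sub>R u + s *\<^sub>R v))"
        using inU[of r 1] r by (intro dw) (auto simp: add.assoc)
      have 2: "(w has_derivative (\<lambda>h. W (q + r *\<^sub>R s *\<^sub>R u) \<bullet> h)) (at (q + r *\<^sub>R s *\<^sub>R u))"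
        using inU[of r 0] r by (intro dw) auto
      have 3: "((\<lambda>x. x + s *\<^sub>R v) has_derivative (\<lambda>h. h)) (at (q + r *\<^sub>R s *\<^sub>R u))"
        by (auto intro!: derivative_eq_intros)
      show "(g has_derivative (\<lambda>h. W (q + r *\<^sub>R s *\<^sub>R u + s *\<^sub>R v) \<bullet> h - W (q + r *\<^sub>R s *\<^sub>R u) \<bullet> h)) (at (q + r *\<^sub>R s *\<^sub>R u))"
        unfolding g_def by (intro has_derivative_diff has_derivative_compose[OF 3 1] 2)
    qed auto
    define E1 where "E1 = W (q + a *\<^sub>R s *\<^sub>R u + s *\<^sub>R v) - W q - H (a *\<^sub>R s *\<^sub>R u + s *\<^sub>R v)"
    define E2 where "E2 = W (q + a *\<^sub>R s *\<^sub>R u) - W q - H (a *\<^sub>R s *\<^sub>R u)"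
    have E: "norm E1 \<le> e' * (s * (norm u + norm v))" "norm E2 \<le> e' * (s * (norm u + norm v))"
      using app[of a 1] app[of a 0] a by (auto simp: E1_def E2_def add.assoc)
    have "w (q + s *\<^sub>R u + s *\<^sub>R v) - w (q + s *\<^sub>R u) - w (q + s *\<^sub>R v) + w q - s\<^sup>2 * (H v \<bullet> u)
      = s * ((E1 - E2) \<bullet> u)"
      using g unfolding g_def E1_def E2_def
      by (simp add: H.add H.scaleR inner_diff_left inner_add_left algebra_simps power2_eq_square)
    then have "\<bar>w (q + s *\<^sub>R u + s *\<^sub>R v) - w (q + s *\<^sub>R u) - w (q + s *\<^sub>R v) + w q - s\<^sup>2 * (H v \<bullet> u)\<bar>
      = s * \<bar>(E1 - E2) \<bullet> u\<bar>" using s by (simp add: abs_mult)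
    also have "\<dots> \<le> s * (norm (E1 - E2) * norm u)"
      using s by (intro mult_left_mono Cauchy_Schwarz_ineq2) auto
    also have "\<dots> \<le> s * ((e' * (s * (norm u + norm v)) + e' * (s * (norm u + norm v))) * (norm u + 1))"
      using s E norm_triangle_ineq4[of E1 E2] e' by (intro mult_left_mono mult_mono) auto
    also have "\<dots> = (e' * L) * s\<^sup>2"
      by (simp add: L_def algebra_simps power2_eq_square)
    also have "\<dots> \<le> e * s\<^sup>2"
      using L0 e by (intro mult_right_mono) (auto simp: e'_def divide_simps)
    finally show "\<bar>w (q + s *\<^sub>R u + s *\<^sub>R v) - w (q + s *\<^sub>R u) - w (q + s *\<^sub>R v) + w q - s\<^sup>2 * (H v \<bullet> u)\<bar> \<le> e * s\<^sup>2" .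
  qed
qed

text \<open>The second difference of \<open>second_difference\<close> is symmetric in
  \<open>u\<close> and \<open>v\<close>, while its two expansions read off
  \<open>H v \<bullet> u\<close> and \<open>H u \<bullet> v\<close>.\<close>

lemma hessian_symmetric:
  fixes w :: "'a::real_inner \<Rightarrow> real"
  assumes U: "open U" "q \<in> U"
    and dw: "\<And>x. x \<in> U \<Longrightarrow> (w has_derivative (\<lambda>v. W x \<bullet> v)) (at x)"
    and dW: "(W has_derivative H) (at q)"
  shows "H u \<bullet> v = H v \<bullet> u"
proof -
  have "\<bar>H u \<bullet> v - H v \<bullet> u\<bar> \<le> 0 + e" if e: "e > 0" for e
  proof -
    obtain d1 where d1: "d1 > 0" "\<forall>s. 0 < s \<and> s < d1 \<longrightarrow>
     \<bar>w (q + s *\<^sub>R u + s *\<^sub>R v) - w (q + s *\<^sub>R u) - w (q + s *\<^sub>R v) + w q - s\<^sup>2 * (H v \<bullet> u)\<bar> \<le> e / 2 * s\<^sup>2"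
      using second_difference[OF U dw dW, of "e/2"] e by (meson half_gt_zero)
    obtain d2 where d2: "d2 > 0" "\<forall>s. 0 < s \<and> s < d2 \<longrightarrow>
     \<bar>w (q + s *\<^sub>R v + s *\<^sub>R u) - w (q + s *\<^sub>R v) - w (q + s *\<^sub>R u) + w q - s\<^sup>2 * (H u \<bullet> v)\<bar> \<le> e / 2 * s\<^sup>2"
      using second_difference[OF U dw dW, of "e/2"] e by (meson half_gt_zero)
    define s where "s = min d1 d2 / 2"
    have s: "0 < s" "s < d1" "s < d2" using d1 d2 by (auto simp: s_def)
    have sw: "q + s *\<^sub>R v + s *\<^sub>R u = q + s *\<^sub>R u + s *\<^sub>R v" by simp
    have "\<bar>s\<^sup>2 * (H u \<bullet> v) - s\<^sup>2 * (H v \<bullet> u)\<bar> \<le> e / 2 * s\<^sup>2 + e / 2 * s\<^sup>2"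
      using d1(2)[rule_format, of s] d2(2)[rule_format, of s] s unfolding sw by linarith
    also have "s\<^sup>2 * (H u \<bullet> v) - s\<^sup>2 * (H v \<bullet> u) = s\<^sup>2 * (H u \<bullet> v - H v \<bullet> u)"
      by (simp add: algebra_simps)
    finally have "s\<^sup>2 * \<bar>H u \<bullet> v - H v \<bullet> u\<bar> \<le> s\<^sup>2 * e"
      by (simp add: abs_mult mult.commute)
    then show ?thesis using s by simp
  qed
  then have "\<bar>H u \<bullet> v - H v \<bullet> u\<bar> \<le> 0" by (rule field_le_epsilon)
  then show ?thesis by simp
qed

text \<open>Difference quotients along \<open>b\<close> integrate to zero by translation invariance
  of Lebesgue measure, and dominated convergence passes to the derivative; no iterated integrals are
  involved.\<close>

lemma integral_directional_derivative_eq_0: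
  fixes u :: "'a::euclidean_space \<Rightarrow> real"
  assumes der: "\<And>q. (u has_derivative u' q) (at q)"
    and cont: "continuous_on UNIV (\<lambda>q. u' q b)"
    and supp: "\<And>q. norm q > R \<Longrightarrow> u q = 0"
  shows "integrable lborel (\<lambda>q. u' q b)" "(LINT q|lborel. u' q b) = 0"
proof -
  have u'0: "u' q b = 0" if "norm q > R" for q
  proof -
    have "eventually (\<lambda>x. x \<in> {x. R < norm x}) (nhds q)"
      using that by (intro eventually_nhds_in_open open_Collect_less continuous_intros) auto
    then have "eventually (\<lambda>x. u x = (\<lambda>_. 0) x) (nhds q)"
      by eventually_elim (simp add: supp)
    then have "(u has_derivative (\<lambda>_. 0)) (at q)"
      using has_derivative_const[of 0 "at q"] that
      by (intro has_derivative_transform_eventually[of "\<lambda>_. 0" "\<lambda>_. 0" q UNIV u])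
         (auto simp: supp eventually_at_filter elim: eventually_mono)
    then show ?thesis using has_derivative_unique[OF der] by metis
  qed
  \<comment> \<open>Enlarged by \<open>norm b\<close> so that it contains the supports of all
    difference quotients: the increments \<open>s k\<close> are at most 1.\<close>
  define K :: "'a set" where "K = cball 0 (\<bar>R\<bar> + norm b)"
  have K: "compact K" by (simp add: K_def)
  obtain M where M: "\<And>q. \<bar>u' q b\<bar> \<le> M" and M0: "M \<ge> 0"
  proof -
    have "compact ((\<lambda>q. u' q b) ` K)"
      using K cont by (meson compact_continuous_image continuous_on_subset subset_UNIV)
    then obtain M where "\<And>q. q \<in> K \<Longrightarrow> \<bar>u' q b\<bar> \<le> M"
      by (auto dest!: compact_imp_bounded simp: bounded_iff) blast
    moreover have "u' q b = 0" if "q \<notin> K" for q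
    proof -
      have "\<bar>R\<bar> + norm b < norm q" using that by (simp add: K_def)
      then show ?thesis using norm_ge_zero[of b] by (intro u'0) linarith
    qed
    ultimately have "\<bar>u' q b\<bar> \<le> max M 0" for q
      by (cases "q \<in> K") (auto simp: le_max_iff_disj)
    then show ?thesis using that by (metis max.cobounded2)
  qed
  define s where "s k = 1 / (real k + 1)" for k
  have s: "0 < s k" "s k \<le> 1" for k by (auto simp: s_def divide_simps)
  have s0: "s \<longlonglongrightarrow> 0" unfolding s_def
    using LIMSEQ_inverse_real_of_nat by (simp add: inverse_eq_divide add.commute)
  define D where "D k q = (u (q + s k *\<^sub>R b) - u q) / s k" for k q
  have contu: "continuous_on UNIV u"
    using der by (meson continuous_at_imp_continuous_on has_derivative_continuous)
  have uint: "integrable lborel u"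
  proof -
    have "u = (\<lambda>x. indicator K x *\<^sub>R u x)"
    proof (rule ext)
      fix q
      have "norm q > R" if "q \<notin> K"
        using that norm_ge_zero[of b] abs_ge_self[of R] by (simp add: K_def del: norm_ge_zero)
      then show "u q = indicator K q *\<^sub>R u q" by (cases "q \<in> K") (auto simp: supp)
    qed
    then show ?thesis
      using borel_integrable_compact[OF K continuous_on_subset[OF contu subset_UNIV]] by metis
  qed
  have meas: "u \<in> borel_measurable borel"
    by (rule borel_measurable_continuous_onI[OF contu])
  have shift: "integrable lborel (\<lambda>q. u (q + c))" "(LINT q|lborel. u (q + c)) = (LINT q|lborel. u q)" for c
  proof -
    have "integrable (distr lborel borel ((+) c)) u"
      using uint by (simp add: lborel_distr_plus)
    then show "integrable lborel (\<lambda>q. u (q + c))"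
      using meas by (subst (asm) integrable_distr_eq) (auto simp: add.commute)
    have "(LINT q|distr lborel borel ((+) c). u q) = (LINT q|lborel. u (c + q))"
      using meas by (subst integral_distr) auto
    then show "(LINT q|lborel. u (q + c)) = (LINT q|lborel. u q)"
      by (simp add: lborel_distr_plus add.commute)
  qed
  have Dint: "integrable lborel (D k)" "(LINT q|lborel. D k q) = 0" for k
    unfolding D_def using shift[of "s k *\<^sub>R b"] uint by (auto simp: Bochner_Integration.integral_diff)
  have lim: "(\<lambda>k. D k q) \<longlonglongrightarrow> u' q b" for q
  proof -
    interpret bounded_linear "u' q" using der by (rule has_derivative_bounded_linear)
    have 1: "((\<lambda>r. q + r *\<^sub>R b) has_derivative (\<lambda>r. r *\<^sub>R b)) (at 0)"
      by (auto intro!: derivative_eq_intros)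
    have "((\<lambda>r. u (q + r *\<^sub>R b)) has_derivative (\<lambda>r. u' q (r *\<^sub>R b))) (at 0)"
      using has_derivative_compose[OF 1, of u "u' q"] der[of q] by simp
    then have "DERIV (\<lambda>r. u (q + r *\<^sub>R b)) 0 :> u' q b"
      unfolding has_field_derivative_def by (simp add: scaleR mult.commute[of _ "u' q b"])
    then have "((\<lambda>h. (u (q + h *\<^sub>R b) - u q) / h) \<longlongrightarrow> u' q b) (at 0)"
      by (simp add: DERIV_def)
    moreover have "filterlim s (at 0) sequentially"
      unfolding filterlim_at using s0 s by (auto simp: less_imp_neq[symmetric])
    ultimately show ?thesis unfolding D_def by (rule filterlim_compose)
  qed
  have bnd: "norm (D k q) \<le> M * indicator K q" for k q
  proof (cases "q \<in> K")
    case True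
    obtain r where "u (q + s k *\<^sub>R b) - u q = u' (q + r *\<^sub>R s k *\<^sub>R b) (s k *\<^sub>R b)"
      by (rule mvt_segment_differentiable[where q=q and v="s k *\<^sub>R b" and f=u and f'=u', OF der]) blast
    also have "\<dots> = s k * u' (q + r *\<^sub>R s k *\<^sub>R b) b"
      using bounded_linear.linear[OF has_derivative_bounded_linear[OF der]] by (simp add: linear_cmul)
    finally have "D k q = u' (q + r *\<^sub>R s k *\<^sub>R b) b"
      using s[of k] by (simp add: D_def)
    then show ?thesis using True M by simp
  next
    case False
    then have q: "norm q > \<bar>R\<bar> + norm b" by (simp add: K_def)
    have "norm q \<le> norm (q + s k *\<^sub>R b) + norm (s k *\<^sub>R b)"
      using norm_triangle_ineq4[of "q + s k *\<^sub>R b" "s k *\<^sub>R b"] by simp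
    also have "norm (s k *\<^sub>R b) \<le> norm b"
      using s[of k] by (simp add: mult_left_le_one_le)
    finally have "norm (q + s k *\<^sub>R b) > R" using q by linarith
    moreover have "norm q > R" using q norm_ge_zero[of b] by linarith
    ultimately show ?thesis using False by (simp add: D_def supp)
  qed
  have Kint: "integrable lborel (\<lambda>q. M * indicator K q)"
    using K emeasure_bounded_finite[OF compact_imp_bounded[OF K]]
    by (intro integrable_mult_right integrable_real_indicator) (auto simp: K_def)
  have mlim: "(\<lambda>q. u' q b) \<in> borel_measurable lborel"
    using borel_measurable_continuous_onI[OF cont] by simp
  have mD: "D k \<in> borel_measurable lborel" for k using Dint(1) by (rule borel_measurable_integrable)
  show "integrable lborel (\<lambda>q. u' q b)"
    by (rule integrable_dominated_convergence[where s=D, OF mlim mD Kint]) (use lim bnd in auto)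
  have "(\<lambda>k. LINT q|lborel. D k q) \<longlonglongrightarrow> (LINT q|lborel. u' q b)"
    by (rule integral_dominated_convergence[where s=D, OF mlim mD Kint]) (use lim bnd in auto)
  then show "(LINT q|lborel. u' q b) = 0"
    using Dint(2) by (simp add: LIMSEQ_const_iff)
qed

text \<open>The derivative is an explicit argument so that its trace can be computed. Continuity
  direction by direction amounts to C1, since the domain has finite dimension; compare
  \<open>C1_deriv_joint\<close>.\<close>

definition C1_deriv ::
    "'a::euclidean_space set \<Rightarrow> ('a \<Rightarrow> 'b::real_normed_vector) \<Rightarrow> ('a \<Rightarrow> 'a \<Rightarrow> 'b) \<Rightarrow> bool" where
  "C1_deriv S f f' \<longleftrightarrow>
     (\<forall>q\<in>S. (f has_derivative f' q) (at q)) \<and> (\<forall>v. continuous_on S (\<lambda>q. f' q v))"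

section \<open>Calculus of C1 maps with explicit derivatives\<close>

lemma C1_derivI:
  assumes "\<And>q. q \<in> S \<Longrightarrow> (f has_derivative f' q) (at q)" "\<And>v. continuous_on S (\<lambda>q. f' q v)"
  shows "C1_deriv S f f'"
  using assms by (simp add: C1_deriv_def)

lemma C1_derivD:
  assumes "C1_deriv S f f'"
  shows "q \<in> S \<Longrightarrow> (f has_derivative f' q) (at q)" "continuous_on S (\<lambda>q. f' q v)"
    "continuous_on S f" "q \<in> S \<Longrightarrow> bounded_linear (f' q)"
proof -
  show 1: "q \<in> S \<Longrightarrow> (f has_derivative f' q) (at q)" for q
    using assms by (auto simp: C1_deriv_def)
  show "continuous_on S (\<lambda>q. f' q v)"
    using assms by (auto simp: C1_deriv_def)
  show "continuous_on S f"
    by (intro continuous_at_imp_continuous_on ballI has_derivative_continuous[OF 1])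
  show "q \<in> S \<Longrightarrow> bounded_linear (f' q)" by (rule has_derivative_bounded_linear[OF 1])
qed

lemma C1_deriv_subset: "C1_deriv S f f' \<Longrightarrow> R \<subseteq> S \<Longrightarrow> C1_deriv R f f'"
  unfolding C1_deriv_def by (meson continuous_on_subset subsetD)

lemma C1_deriv_cong:
  assumes "C1_deriv S f f'" "\<And>q v. q \<in> S \<Longrightarrow> f' q v = g' q v"
  shows "C1_deriv S f g'"
proof (rule C1_derivI)
  fix q assume "q \<in> S"
  then have "f' q = g' q" using assms(2) by blast
  then show "(f has_derivative g' q) (at q)" using C1_derivD(1)[OF assms(1) \<open>q \<in> S\<close>] by simp
next
  fix v show "continuous_on S (\<lambda>q. g' q v)"
    using C1_derivD(2)[OF assms(1), of v] assms(2) by (simp cong: continuous_on_cong)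
qed

lemma C1_deriv_const: "C1_deriv S (\<lambda>q. c) (\<lambda>q v. 0)"
  by (auto intro!: C1_derivI continuous_intros)

lemma C1_deriv_linear:
  assumes "bounded_linear L" shows "C1_deriv S L (\<lambda>q v. L v)"
  by (intro C1_derivI continuous_intros bounded_linear.has_derivative[OF assms] has_derivative_ident)

lemma C1_deriv_add:
  assumes "C1_deriv S f f'" "C1_deriv S g g'"
  shows "C1_deriv S (\<lambda>q. f q + g q) (\<lambda>q v. f' q v + g' q v)"
  by (intro C1_derivI has_derivative_add continuous_on_add C1_derivD(1,2)[OF assms(1)] C1_derivD(1,2)[OF assms(2)])

lemma C1_deriv_diff:
  assumes "C1_deriv S f f'" "C1_deriv S g g'"
  shows "C1_deriv S (\<lambda>q. f q - g q) (\<lambda>q v. f' q v - g' q v)"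
  by (intro C1_derivI has_derivative_diff continuous_on_diff C1_derivD(1,2)[OF assms(1)] C1_derivD(1,2)[OF assms(2)])

lemma C1_deriv_compose_linear:
  assumes "C1_deriv S f f'" "bounded_linear L"
  shows "C1_deriv S (\<lambda>q. L (f q)) (\<lambda>q v. L (f' q v))"
  by (intro C1_derivI bounded_linear.has_derivative[OF assms(2)] bounded_linear.continuous_on[OF assms(2)]
      C1_derivD(1,2)[OF assms(1)])

lemma C1_deriv_bilinear:
  assumes "bounded_bilinear B" "C1_deriv S f f'" "C1_deriv S g g'"
  shows "C1_deriv S (\<lambda>q. B (f q) (g q)) (\<lambda>q v. B (f q) (g' q v) + B (f' q v) (g q))"
  by (intro C1_derivI bounded_bilinear.FDERIV[OF assms(1)] continuous_on_add
      bounded_bilinear.continuous_on[OF assms(1)]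
      C1_derivD(1-3)[OF assms(2)] C1_derivD(1-3)[OF assms(3)])

lemmas C1_deriv_scaleR = C1_deriv_bilinear[OF bounded_bilinear_scaleR]
  and C1_deriv_mult = C1_deriv_bilinear[OF bounded_bilinear_mult[where 'a=real]]
  and C1_deriv_inner = C1_deriv_bilinear[OF bounded_bilinear_inner]

lemma C1_deriv_compose_real:
  fixes f :: "'a::euclidean_space \<Rightarrow> real" and g g' :: "real \<Rightarrow> real"
  assumes "C1_deriv S f f'" "\<And>x. x \<in> T \<Longrightarrow> DERIV g x :> g' x" "continuous_on T g'" "f ` S \<subseteq> T"
  shows "C1_deriv S (\<lambda>q. g (f q)) (\<lambda>q v. g' (f q) * f' q v)"
proof (rule C1_derivI)
  fix q assume q: "q \<in> S"
  have "DERIV g (f q) :> g' (f q)" using assms q by blast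
  then have "(g has_derivative (\<lambda>h. g' (f q) * h)) (at (f q))"
    by (simp add: has_field_derivative_def)
  from has_derivative_compose[OF C1_derivD(1)[OF assms(1) q] this]
  show "((\<lambda>q. g (f q)) has_derivative (\<lambda>v. g' (f q) * f' q v)) (at q)" .
next
  show "continuous_on S (\<lambda>q. g' (f q) * f' q v)" for v
    using assms C1_derivD(2,3)[OF assms(1)]
    by (intro continuous_on_mult continuous_on_compose2[OF assms(3)]) auto
qed

lemma C1_deriv_compose:
  assumes g: "C1_deriv T g g'" and l: "bounded_linear l" and "l ` S \<subseteq> T"
  shows "C1_deriv S (\<lambda>q. g (l q)) (\<lambda>q v. g' (l q) (l v))"
proof (rule C1_derivI)
  fix q assume "q \<in> S"
  then show "((\<lambda>q. g (l q)) has_derivative (\<lambda>v. g' (l q) (l v))) (at q)"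
    using assms by (intro has_derivative_compose[OF bounded_linear_imp_has_derivative[OF l]] C1_derivD(1)[OF g]) auto
next
  show "continuous_on S (\<lambda>q. g' (l q) (l v))" for v
    using assms by (intro continuous_on_compose2[OF C1_derivD(2)[OF g]] linear_continuous_on) auto
qed

lemma C1_deriv_gradient:
  assumes "\<And>q. q \<in> S \<Longrightarrow> (f has_derivative (\<lambda>v. D q \<bullet> v)) (at q)" "continuous_on S D"
  shows "C1_deriv S f (\<lambda>q v. D q \<bullet> v)"
  by (intro C1_derivI assms continuous_intros)

lemma C1_deriv_sum:
  assumes "\<And>i. i \<in> I \<Longrightarrow> C1_deriv S (f i) (f' i)"
  shows "C1_deriv S (\<lambda>q. \<Sum>i\<in>I. f i q) (\<lambda>q v. \<Sum>i\<in>I. f' i q v)"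
  by (intro C1_derivI has_derivative_sum continuous_on_sum C1_derivD(1,2)[OF assms])

text \<open>On the overlap, which is open, \<open>f\<close> vanishes and so does its derivative; the
  two local formulas therefore agree. This makes a function that is cut off near an edge C1 on the
  whole space.\<close>

lemma C1_deriv_extend_zero:
  assumes S: "open S" and R: "open R" and f: "C1_deriv S f f'"
    and zero: "\<And>q. q \<in> S \<Longrightarrow> q \<in> R \<Longrightarrow> f q = 0"
  shows "C1_deriv (S \<union> R) (\<lambda>q. if q \<in> S then f q else 0) (\<lambda>q. if q \<in> S then f' q else (\<lambda>v. 0))"
proof (rule C1_derivI)
  let ?f = "\<lambda>q. if q \<in> S then f q else 0"
  have f'0: "f' q = (\<lambda>v. 0)" if "q \<in> S" "q \<in> R" for q
  proof -
    have "(f has_derivative (\<lambda>_. 0)) (at q)"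
      by (rule has_derivative_transform_within_open[OF has_derivative_const[of 0] open_Int[OF S R]])
         (use that zero in auto)
    then show ?thesis using C1_derivD(1)[OF f that(1)] has_derivative_unique by blast
  qed
  have 1: "(?f has_derivative f' q) (at q)" if "q \<in> S" for q
    by (rule has_derivative_transform_within_open[OF C1_derivD(1)[OF f that] S that]) auto
  have 2: "(?f has_derivative (\<lambda>v. 0)) (at q)" if "q \<in> R" for q
    by (rule has_derivative_transform_within_open[OF has_derivative_const[of 0] R that])
       (use zero in auto)
  show "(?f has_derivative (if q \<in> S then f' q else (\<lambda>v. 0))) (at q)" if "q \<in> S \<union> R" for q
    using 1 2 that by auto
  fix v
  have "continuous_on S (\<lambda>q. (if q \<in> S then f' q else (\<lambda>v. 0)) v)"
    using C1_derivD(2)[OF f, of v] by (simp cong: continuous_on_cong)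
  moreover have "continuous_on R (\<lambda>q. (if q \<in> S then f' q else (\<lambda>v. 0)) v)"
    by (rule continuous_on_eq[OF continuous_on_const[of _ 0]]) (use f'0 in auto)
  ultimately show "continuous_on (S \<union> R) (\<lambda>q. (if q \<in> S then f' q else (\<lambda>v. 0)) v)"
    using S R by (rule continuous_on_open_Un[rotated 2])
qed

text \<open>Applied to the derivative of a vector field at a point, this is the divergence
  there.\<close>

definition op_trace :: "('a::euclidean_space \<Rightarrow> 'a) \<Rightarrow> real" where
  "op_trace L = (\<Sum>b\<in>Basis. L b \<bullet> b)"

lemma op_trace_add: "op_trace (\<lambda>v. L v + M v) = op_trace L + op_trace M"
  and op_trace_diff: "op_trace (\<lambda>v. L v - M v) = op_trace L - op_trace M"
  and op_trace_scaleR: "op_trace (\<lambda>v. c *\<^sub>R L v) = c * op_trace L"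
  and op_trace_0: "op_trace (\<lambda>v. 0) = 0"
  by (auto simp: op_trace_def inner_add_left inner_diff_left sum.distrib sum_subtractf sum_distrib_left)

lemma op_trace_rank_one:
  assumes "linear l" shows "op_trace (\<lambda>v. l v *\<^sub>R u) = l u"
proof -
  have "l u = l (\<Sum>b\<in>Basis. (u \<bullet> b) *\<^sub>R b)" by (simp add: euclidean_representation)
  also have "\<dots> = (\<Sum>b\<in>Basis. (u \<bullet> b) * l b)"
    using assms by (simp add: linear_sum linear_cmul)
  finally show ?thesis by (simp add: op_trace_def mult.commute)
qed

text \<open>Extension by zero gives a C1 field on the whole space, whose divergence integrates to
  zero. A pointwise lower bound for the divergence thus becomes a relation between two volumes, and
  no integral of the solution ever has to be formed.\<close>

theorem divergence_compact_support_le: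
  fixes Y :: "'a::euclidean_space \<Rightarrow> 'a"
  assumes U: "open U" "bounded U" and K: "compact K" "K \<subseteq> U"
    and Y: "C1_deriv U Y Y'" and zero: "\<And>q. q \<in> U \<Longrightarrow> q \<notin> K \<Longrightarrow> Y q = 0"
    and B: "B \<in> sets lborel" "B \<subseteq> U"
    and le: "\<And>q. q \<in> U \<Longrightarrow> \<alpha> * indicator B q - \<beta> \<le> op_trace (Y' q)"
  shows "\<alpha> * measure lborel B \<le> \<beta> * measure lborel U"
proof -
  define Z where "Z q = (if q \<in> U then Y q else 0)" for q
  define Z' where "Z' q = (if q \<in> U then Y' q else (\<lambda>v. 0))" for q
  have Z: "C1_deriv UNIV Z Z'"
  proof -
    have "U \<union> - K = UNIV" using K by auto
    then show ?thesis
      using C1_deriv_extend_zero[OF U(1) _ Y, of "- K"] K zero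
      by (simp add: Z_def[abs_def] Z'_def[abs_def] compact_imp_closed open_Compl)
  qed
  obtain R where R: "\<And>q. q \<in> U \<Longrightarrow> norm q \<le> R" using U(2) by (auto simp: bounded_iff)
  have parts: "integrable lborel (\<lambda>q. Z' q b \<bullet> b)" "(LINT q|lborel. Z' q b \<bullet> b) = 0" for b
  proof -
    have C: "C1_deriv UNIV (\<lambda>q. Z q \<bullet> b) (\<lambda>q v. Z' q v \<bullet> b)"
      by (rule C1_deriv_compose_linear[OF Z bounded_linear_inner_left])
    have s: "Z q \<bullet> b = 0" if "norm q > R" for q
    proof -
      have "q \<notin> U" using R[of q] that by auto
      then show ?thesis by (simp add: Z_def)
    qed
    show "integrable lborel (\<lambda>q. Z' q b \<bullet> b)" "(LINT q|lborel. Z' q b \<bullet> b) = 0"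
      using integral_directional_derivative_eq_0[where u="\<lambda>q. Z q \<bullet> b"
          and u'="\<lambda>q v. Z' q v \<bullet> b", OF C1_derivD(1)[OF C] C1_derivD(2)[OF C] s] by auto
  qed
  have U_fin: "emeasure lborel U < \<infinity>" by (rule emeasure_bounded_finite[OF U(2)])
  have B_fin: "emeasure lborel B < \<infinity>"
    using bounded_subset[OF U(2) B(2)] by (rule emeasure_bounded_finite)
  have intB: "integrable lborel (indicator B :: 'a \<Rightarrow> real)" and intU: "integrable lborel (indicator U :: 'a \<Rightarrow> real)"
    using B U_fin B_fin U by (auto intro!: integrable_real_indicator)
  have "(LINT q|lborel. \<alpha> * indicator B q - \<beta> * indicator U q) \<le> (LINT q|lborel. op_trace (Z' q))"
  proof (rule integral_mono)
    show "integrable lborel (\<lambda>q. \<alpha> * indicator B q - \<beta> * indicator U q)"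
      using intB intU by (intro Bochner_Integration.integrable_diff integrable_mult_right)
    show "integrable lborel (\<lambda>q. op_trace (Z' q))"
      unfolding op_trace_def using parts by auto
    show "\<alpha> * indicator B q - \<beta> * indicator U q \<le> op_trace (Z' q)" for q
      using le[of q] B(2) by (cases "q \<in> U") (auto simp: Z'_def op_trace_0 indicator_def)
  qed
  also have "(LINT q|lborel. op_trace (Z' q)) = 0"
    unfolding op_trace_def using parts by (subst Bochner_Integration.integral_sum) auto
  also have "(LINT q|lborel. \<alpha> * indicator B q - \<beta> * indicator U q)
      = \<alpha> * measure lborel B - \<beta> * measure lborel U"
    using intB intU by (subst Bochner_Integration.integral_diff) auto
  finally show ?thesis by simp
qed

section \<open>Boundary traces\<close>

text \<open>The parameters at which the segment lies outside the open set form a closed set, so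
  there is a smallest one; all earlier points are in \<open>S\<close>, which puts the exit point
  into the closure.\<close>

lemma first_exit:
  fixes x d :: "'a::euclidean_space"
  assumes S: "open S" "x \<in> S" "x + d \<notin> S"
  obtains r where "0 < r" "r \<le> 1" "x + r *\<^sub>R d \<in> closure S" "x + r *\<^sub>R d \<notin> S"
    "\<And>s. 0 \<le> s \<Longrightarrow> s < r \<Longrightarrow> x + s *\<^sub>R d \<in> S"
proof -
  define C where "C = {r \<in> {0..1}. x + r *\<^sub>R d \<notin> S}"
  have "closed C"
  proof -
    have "closed ((\<lambda>r. x + r *\<^sub>R d) -` (- S))"
      using S(1) by (intro closed_vimage continuous_intros) auto
    then have "closed ({0..1} \<inter> ((\<lambda>r. x + r *\<^sub>R d) -` (- S)))" by (intro closed_Int closed_real_atLeastAtMost)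
    moreover have "C = {0..1} \<inter> ((\<lambda>r. x + r *\<^sub>R d) -` (- S))" by (auto simp: C_def)
    ultimately show ?thesis by simp
  qed
  moreover have C1: "1 \<in> C" using S by (simp add: C_def)
  ultimately obtain r where r: "r \<in> C" "\<And>s. s \<in> C \<Longrightarrow> dist 0 r \<le> dist 0 s"
    by (metis distance_attains_inf empty_iff)
  have r01: "0 \<le> r" "r \<le> 1" "x + r *\<^sub>R d \<notin> S" using r(1) by (auto simp: C_def)
  have "r \<noteq> 0" using r01(3) S(2) by auto
  have below: "x + s *\<^sub>R d \<in> S" if "0 \<le> s" "s < r" for s
  proof (rule ccontr)
    assume "x + s *\<^sub>R d \<notin> S"
    then have "s \<in> C" using that r01 by (auto simp: C_def)
    from r(2)[OF this] that show False by (simp add: dist_norm)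
  qed
  have "x + r *\<^sub>R d \<in> closure S"
  proof (rule closed_sequentially[OF closed_closure])
    show "x + (r * (1 - 1 / (real k + 1))) *\<^sub>R d \<in> closure S" for k
    proof -
      have "r * (1 - 1 / (real k + 1)) < r * 1" "0 \<le> r * (1 - 1 / (real k + 1))"
        using \<open>r \<noteq> 0\<close> r01 by (intro mult_strict_left_mono mult_nonneg_nonneg; simp add: divide_simps)+
      then show ?thesis using below closure_subset by fastforce
    qed
    have "(\<lambda>k. x + (r * (1 - 1 / (real k + 1))) *\<^sub>R d) \<longlonglongrightarrow> x + (r * (1 - 0)) *\<^sub>R d"
      using LIMSEQ_inverse_real_of_nat
      by (intro tendsto_intros) (simp add: inverse_eq_divide add.commute)
    then show "(\<lambda>k. x + (r * (1 - 1 / (real k + 1))) *\<^sub>R d) \<longlonglongrightarrow> x + r *\<^sub>R d" by simp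
  qed
  then show ?thesis using that[of r] r01 \<open>r \<noteq> 0\<close> below by auto
qed

text \<open>
  The chord from \<open>y - \<eta>sn\<close> to \<open>y + s\<xi> - \<eta>sn\<close> stays in \<open>S\<close> for small \<open>s\<close>, and from both of its ends
  one reaches the boundary, where \<open>z = 0\<close>, within a distance of order \<open>\<eta>s\<close>.
\<close>

lemma tangential_derivative_zero:
  fixes y :: "'a::euclidean_space"
  assumes S: "open S" and r: "r > 0" and n: "n \<noteq> 0"
    and \<psi>: "(\<psi> has_derivative (\<lambda>v. n \<bullet> v)) (at y)" "\<psi> y = 0"
    and S\<psi>: "S \<inter> ball y r = {x \<in> ball y r. \<psi> x < 0}"
    and z: "continuous_on (closure S) z" "\<And>x. x \<in> closure S \<Longrightarrow> x \<in> ball y r \<Longrightarrow> x \<notin> S \<Longrightarrow> z x = 0"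
    and dz: "\<And>x. x \<in> S \<Longrightarrow> (z has_derivative (\<lambda>v. G x \<bullet> v)) (at x)"
    and G: "continuous_on (closure S) G" and y: "y \<in> closure S" and \<xi>: "n \<bullet> \<xi> = 0"
  shows "G y \<bullet> \<xi> = 0"
proof -
  \<comment> \<open>\<open>norm \<xi>\<close> is the price of replacing \<open>G\<close> by
    \<open>G y\<close> along the chord; each end of the chord contributes
    \<open>2 * norm n * (norm (G y) + 1)\<close>.\<close>
  define C where "C = norm \<xi> + 4 * norm n * (norm (G y) + 1)"
  have key: "\<bar>G y \<bullet> \<xi>\<bar> \<le> \<eta> * C" if \<eta>: "0 < \<eta>" "\<eta> \<le> 1" for \<eta>
  proof -
    define L where "L = norm \<xi> + norm n"
    have L: "L > 0" using n by (simp add: L_def add_nonneg_pos)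
    \<comment> \<open>Makes the Taylor error at distance \<open>s * L\<close> equal to half of
      \<open>s * \<eta> * (norm n)\<^sup>2\<close>, the size of the linear term at height
      \<open>\<eta>\<close>, so that the sign of \<open>\<psi>\<close> is decided.\<close>
    define e where "e = \<eta> * (norm n)\<^sup>2 / (2 * L)"
    have e: "e > 0" using \<eta> n L by (simp add: e_def)
    obtain d1 where d1: "d1 > 0" "\<And>x. norm (x - y) < d1 \<Longrightarrow> \<bar>\<psi> x - n \<bullet> (x - y)\<bar> \<le> e * norm (x - y)"
      using \<psi> e unfolding has_derivative_at_alt by force
    obtain d2 where d2: "d2 > 0" "\<And>x. x \<in> closure S \<Longrightarrow> dist x y < d2 \<Longrightarrow> dist (G x) (G y) < \<eta>"
      using G y \<eta> unfolding continuous_on_iff by blast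
    define s where "s = min r (min d1 d2) / (2 * L)"
    have s: "s > 0" using r d1 d2 L by (simp add: s_def)
    have sL: "s * L < r" "s * L < d1" "s * L < d2"
      using L r d1 d2 by (auto simp: s_def)
    have nv: "norm (s *\<^sub>R (a *\<^sub>R \<xi> + b *\<^sub>R n)) \<le> s * L" if "\<bar>a\<bar> \<le> 1" "\<bar>b\<bar> \<le> 1" for a b
    proof -
      have "norm (a *\<^sub>R \<xi> + b *\<^sub>R n) \<le> norm (a *\<^sub>R \<xi>) + norm (b *\<^sub>R n)" by (rule norm_triangle_ineq)
      also have "\<dots> \<le> L" using that by (auto simp: L_def intro!: add_mono mult_left_le_one_le)
      finally show ?thesis using s by simp
    qed
    have near: "y + s *\<^sub>R (a *\<^sub>R \<xi> + b *\<^sub>R n) \<in> ball y r"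
      "dist (y + s *\<^sub>R (a *\<^sub>R \<xi> + b *\<^sub>R n)) y < d2"
      "\<bar>\<psi> (y + s *\<^sub>R (a *\<^sub>R \<xi> + b *\<^sub>R n)) - s * b * (norm n)\<^sup>2\<bar> \<le> s * \<eta> * (norm n)\<^sup>2 / 2"
      if "\<bar>a\<bar> \<le> 1" "\<bar>b\<bar> \<le> 1" for a b
    proof -
      show "y + s *\<^sub>R (a *\<^sub>R \<xi> + b *\<^sub>R n) \<in> ball y r" "dist (y + s *\<^sub>R (a *\<^sub>R \<xi> + b *\<^sub>R n)) y < d2"
        using nv[OF that] sL by (auto simp: dist_norm simp del: scaleR_add_right norm_scaleR)
      have "\<bar>\<psi> (y + s *\<^sub>R (a *\<^sub>R \<xi> + b *\<^sub>R n)) - n \<bullet> (s *\<^sub>R (a *\<^sub>R \<xi> + b *\<^sub>R n))\<bar> \<le> e * norm (s *\<^sub>R (a *\<^sub>R \<xi> + b *\<^sub>R n))"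
        using d1(2)[of "y + s *\<^sub>R (a *\<^sub>R \<xi> + b *\<^sub>R n)"] nv[OF that] sL by (auto simp del: scaleR_add_right norm_scaleR)
      also have "\<dots> \<le> e * (s * L)" using e nv[OF that] by (intro mult_left_mono) auto
      also have "\<dots> = s * \<eta> * (norm n)\<^sup>2 / 2" using L by (simp add: e_def)
      also have "n \<bullet> (s *\<^sub>R (a *\<^sub>R \<xi> + b *\<^sub>R n)) = s * b * (norm n)\<^sup>2"
        by (simp add: inner_add_right \<xi> power2_norm_eq_inner)
      finally show "\<bar>\<psi> (y + s *\<^sub>R (a *\<^sub>R \<xi> + b *\<^sub>R n)) - s * b * (norm n)\<^sup>2\<bar> \<le> s * \<eta> * (norm n)\<^sup>2 / 2" .
    qed
    have pos: "s * \<eta> * (norm n)\<^sup>2 > 0" using s \<eta> n by simp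
    have inS: "y + s *\<^sub>R (a *\<^sub>R \<xi> + (- \<eta>) *\<^sub>R n) \<in> S" if "\<bar>a\<bar> \<le> 1" for a
    proof -
      have "\<psi> (y + s *\<^sub>R (a *\<^sub>R \<xi> + (- \<eta>) *\<^sub>R n)) < 0"
        using near(3)[of a "- \<eta>"] that \<eta> pos
        by (simp only: abs_le_iff abs_minus_cancel abs_of_pos) (simp add: mult.assoc mult.left_commute del: scaleR_add_right, linarith?)
      then show ?thesis using near(1)[of a "- \<eta>"] that \<eta> S\<psi> by auto
    qed
    have notS: "y + s *\<^sub>R (a *\<^sub>R \<xi> + \<eta> *\<^sub>R n) \<notin> S" if "\<bar>a\<bar> \<le> 1" for a
    proof -
      have "\<psi> (y + s *\<^sub>R (a *\<^sub>R \<xi> + \<eta> *\<^sub>R n)) > 0"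
        using near(3)[of a "\<eta>"] that \<eta> pos
        by (simp only: abs_le_iff abs_of_pos) (simp add: mult.assoc mult.left_commute del: scaleR_add_right, linarith?)
      moreover have "y + s *\<^sub>R (a *\<^sub>R \<xi> + \<eta> *\<^sub>R n) \<in> ball y r"
        by (rule near(1)) (use that \<eta> in auto)
      ultimately show ?thesis using S\<psi> by (metis (no_types, lifting) IntI less_asym mem_Collect_eq)
    qed
    have Gnear: "norm (G x - G y) \<le> \<eta>" if "x \<in> closure S" "dist x y < d2" for x
      using d2(2)[OF that] by (simp add: dist_norm)
    have end_small: "\<bar>z (y + s *\<^sub>R (a *\<^sub>R \<xi> + (- \<eta>) *\<^sub>R n))\<bar> \<le> (norm (G y) + 1) * (2 * s * \<eta> * norm n)"
      if a: "\<bar>a\<bar> \<le> 1" for a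
    proof -
      define x where "x = y + s *\<^sub>R (a *\<^sub>R \<xi> + (- \<eta>) *\<^sub>R n)"
      define d where "d = (2 * s * \<eta>) *\<^sub>R n"
      have xk: "x + k *\<^sub>R d = y + s *\<^sub>R (a *\<^sub>R \<xi> + (\<eta> * (2 * k - 1)) *\<^sub>R n)" for k
        by (simp add: x_def d_def algebra_simps)
      have bk: "\<bar>\<eta> * (2 * k - 1)\<bar> \<le> 1" if "0 \<le> k" "k \<le> 1" for k
        using that \<eta> by (auto simp: abs_mult intro!: mult_le_one)
      have "x + d \<notin> S" using notS[OF a] xk[of 1] by simp
      then obtain k where k: "0 < k" "k \<le> 1" "x + k *\<^sub>R d \<in> closure S" "x + k *\<^sub>R d \<notin> S"
        "\<And>s. 0 \<le> s \<Longrightarrow> s < k \<Longrightarrow> x + s *\<^sub>R d \<in> S"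
        using first_exit[OF S, of x d] inS[OF a] x_def by metis
      have z0: "z (x + k *\<^sub>R d) = 0"
        using k near(1)[OF a bk[of k]] by (intro z(2)) (auto simp: xk)
      have clos: "x + s *\<^sub>R d \<in> closure S" if "0 \<le> s" "s \<le> k" for s
        using k(3) k(5)[of s] that closure_subset[of S] by (cases "s = k") auto
      \<comment> \<open>The far end of this segment may lie on the boundary, where \<open>z\<close>
        is only continuous; hence the form of the mean value theorem that takes derivatives in the
        open segment.\<close>
      obtain l where l: "0 < l" "l < 1" "z (x + k *\<^sub>R d) - z x = G (x + l *\<^sub>R (k *\<^sub>R d)) \<bullet> (k *\<^sub>R d)"
      proof (rule mvt_segment[where q=x and v="k *\<^sub>R d" and f=z and f'="\<lambda>x v. G x \<bullet> v"])
        have sub: "(\<lambda>s. x + s *\<^sub>R k *\<^sub>R d) ` {0..1} \<subseteq> closure S"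
          using clos k by (auto intro!: clos mult_le_one simp: mult_left_le_one_le)
        show "continuous (at (x + s *\<^sub>R k *\<^sub>R d) within (\<lambda>s. x + s *\<^sub>R k *\<^sub>R d) ` {0..1}) z"
          if "0 \<le> s" "s \<le> 1" for s
          using continuous_on_subset[OF z(1) sub] that by (auto simp: continuous_on_eq_continuous_within)
        show "(z has_derivative (\<lambda>v. G (x + s *\<^sub>R k *\<^sub>R d) \<bullet> v)) (at (x + s *\<^sub>R k *\<^sub>R d))"
          if "0 < s" "s < 1" for s
          using k that by (intro dz) (auto intro!: k(5))
      qed blast
      define x' where "x' = x + l *\<^sub>R (k *\<^sub>R d)"
      have lk: "0 \<le> l * k" "l * k \<le> k" "l * k \<le> 1" using l k by (auto simp: mult_left_le_one_le mult_le_one)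
      have "norm (G x' - G y) \<le> \<eta>"
        using clos[of "l * k"] near(2)[OF a bk[of "l * k"]] lk by (intro Gnear) (auto simp: x'_def xk)
      then have Gx': "norm (G x') \<le> norm (G y) + 1"
        using norm_triangle_sub[of "G x'" "G y"] \<eta> by linarith
      have "\<bar>z x\<bar> = \<bar>G x' \<bullet> (k *\<^sub>R d)\<bar>" using l z0 by (simp add: x'_def)
      also have "\<dots> \<le> norm (G x') * norm (k *\<^sub>R d)" by (rule Cauchy_Schwarz_ineq2)
      also have "\<dots> \<le> (norm (G y) + 1) * norm d"
        using Gx' k by (intro mult_mono) (auto simp: mult_left_le_one_le)
      also have "norm d = 2 * s * \<eta> * norm n" using s \<eta> by (simp add: d_def)
      finally show ?thesis by (simp add: x_def)
    qed
    define A where "A = y + s *\<^sub>R (0 *\<^sub>R \<xi> + (- \<eta>) *\<^sub>R n)"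
    have Aa: "A + a *\<^sub>R (s *\<^sub>R \<xi>) = y + s *\<^sub>R (a *\<^sub>R \<xi> + (- \<eta>) *\<^sub>R n)" for a
      by (simp add: A_def algebra_simps)
    obtain l where l: "0 < l" "l < 1" "z (A + s *\<^sub>R \<xi>) - z A = G (A + l *\<^sub>R (s *\<^sub>R \<xi>)) \<bullet> (s *\<^sub>R \<xi>)"
      by (rule mvt_segment_differentiable[where q=A and v="s *\<^sub>R \<xi>" and f=z and f'="\<lambda>x v. G x \<bullet> v"])
         (auto intro!: dz inS simp del: scaleR_add_right scaleR_minus_left scaleR_scaleR simp: Aa)
    have "norm (G (A + l *\<^sub>R (s *\<^sub>R \<xi>)) - G y) \<le> \<eta>"
      using near(2)[of l "- \<eta>"] inS[of l] closure_subset[of S] l \<eta>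
      unfolding Aa by (intro Gnear) auto
    then have "\<bar>(G (A + l *\<^sub>R (s *\<^sub>R \<xi>)) - G y) \<bullet> \<xi>\<bar> \<le> \<eta> * norm \<xi>"
      by (meson Cauchy_Schwarz_ineq2 mult_right_mono norm_ge_zero order_trans)
    then have "s * \<bar>(G (A + l *\<^sub>R (s *\<^sub>R \<xi>)) - G y) \<bullet> \<xi>\<bar> \<le> s * (\<eta> * norm \<xi>)" using s by simp
    moreover have "z (A + s *\<^sub>R \<xi>) - z A - s * (G y \<bullet> \<xi>) = s * ((G (A + l *\<^sub>R (s *\<^sub>R \<xi>)) - G y) \<bullet> \<xi>)"
      unfolding l(3) by (simp add: inner_diff_left algebra_simps)
    ultimately have "\<bar>z (A + s *\<^sub>R \<xi>) - z A - s * (G y \<bullet> \<xi>)\<bar> \<le> s * (\<eta> * norm \<xi>)"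
      using s by (simp add: abs_mult)
    moreover have "\<bar>z A\<bar> \<le> (norm (G y) + 1) * (2 * s * \<eta> * norm n)" "\<bar>z (A + s *\<^sub>R \<xi>)\<bar> \<le> (norm (G y) + 1) * (2 * s * \<eta> * norm n)"
      using end_small[of 0, folded Aa] end_small[of 1, folded Aa] by simp_all
    ultimately have "\<bar>s * (G y \<bullet> \<xi>)\<bar> \<le> s * (\<eta> * norm \<xi>) + 2 * ((norm (G y) + 1) * (2 * s * \<eta> * norm n))"
      by linarith
    also have "\<dots> = s * (\<eta> * C)" by (simp add: C_def algebra_simps)
    finally show ?thesis using s by (simp add: abs_mult)
  qed
  have C: "C \<ge> 0" by (simp add: C_def)
  have "\<bar>G y \<bullet> \<xi>\<bar> \<le> 0 + e" if "e > 0" for e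
  proof -
    define \<eta> where "\<eta> = min 1 (e / (C + 1))"
    have "\<eta> * C \<le> e / (C + 1) * (C + 1)" using C that by (intro mult_mono) (auto simp: \<eta>_def)
    also have "\<dots> = e" using C by simp
    finally show ?thesis using key[of \<eta>] C that by (force simp: \<eta>_def)
  qed
  then have "\<bar>G y \<bullet> \<xi>\<bar> \<le> 0" by (rule field_le_epsilon)
  then show ?thesis by simp
qed

lemma gradient_parallel_normal:
  fixes g n :: "'a::real_inner"
  assumes n: "n \<noteq> 0" and "\<And>\<xi>. n \<bullet> \<xi> = 0 \<Longrightarrow> g \<bullet> \<xi> = 0"
  shows "g = (g \<bullet> n / (n \<bullet> n)) *\<^sub>R n"
proof -
  define \<xi> where "\<xi> = g - (g \<bullet> n / (n \<bullet> n)) *\<^sub>R n"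
  have 1: "n \<bullet> \<xi> = 0" using n by (simp add: \<xi>_def inner_diff_right inner_commute)
  then have "\<xi> \<bullet> \<xi> = 0" using assms(2)[OF 1] by (simp add: \<xi>_def inner_diff_left)
  then show ?thesis by (simp add: \<xi>_def)
qed

section \<open>The Carleman estimate\<close>

lemma young:
  fixes x y c :: real assumes "c > 0"
  shows "- (x * y) \<le> c * x\<^sup>2 / 4 + y\<^sup>2 / c"
proof -
  have "0 \<le> (c * x / 2 + y)\<^sup>2 / c" using assms by simp
  also have "\<dots> = c * x\<^sup>2 / 4 + y\<^sup>2 / c + x * y"
    using assms by (simp add: power2_eq_square field_simps)
  finally show ?thesis by simp
qed

text \<open>
  Here \<open>w\<close> and \<open>W\<close> are the value and the gradient length of the conjugated function, \<open>N\<close> is the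
  multiplier and \<open>E\<close> the conjugated source term.
\<close>

lemma carleman_absorb:
  fixes C c0 c1 M :: real
  assumes c: "c0 > 0" "c1 > 0" and C: "C \<ge> 1" and M: "M \<ge> 0"
  obtains a0 where "a0 \<ge> 1"
    "\<And>a w W N E y y' l d Q. \<lbrakk>a \<ge> a0; \<bar>y\<bar> \<le> C; \<bar>y'\<bar> \<le> C; \<bar>l\<bar> \<le> C * W; W \<ge> 0; N = 2 * d + y' * w;
       \<bar>E\<bar> \<le> C * (W + a * \<bar>w\<bar>); Q \<ge> c0 * W\<^sup>2 - M * d\<^sup>2\<rbrakk>
     \<Longrightarrow> N * E + a * N\<^sup>2 + a * y * w * N + Q + w * l + c1 * a\<^sup>2 * w\<^sup>2 \<ge> (c1 / 2) * a\<^sup>2 * w\<^sup>2"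
proof -
  \<comment> \<open>\<open>B\<close> collects the coefficients of \<open>a * w\<^sup>2\<close> lost
    below: \<open>2 * C\<^sup>2\<close> from \<open>N * E\<close>, \<open>C\<^sup>2\<close> from
    \<open>a * y * w * N\<close>, \<open>M * C\<^sup>2\<close> from \<open>Q\<close> and
    \<open>C\<^sup>2 / c0\<close> from \<open>w * l\<close>. The term \<open>a * N\<^sup>2\<close>
    is spent as 1/4 + 1/4 + 1/2, and \<open>a0\<close> makes \<open>a\<close> at least
    \<open>M\<close>, \<open>4 * C\<^sup>2 / c0\<close> and \<open>2 * B / c1\<close>.\<close>
  define B where "B = 3 * C\<^sup>2 + M * C\<^sup>2 + C\<^sup>2 / c0"
  define a0 where "a0 = 1 + M + 4 * C\<^sup>2 / c0 + 2 * B / c1"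
  have B0: "B \<ge> 0" using c M by (simp add: B_def)
  have parts: "M \<ge> 0" "4 * C\<^sup>2 / c0 \<ge> 0" "2 * B / c1 \<ge> 0" using c M B0 by auto
  have main: "N * E + a * N\<^sup>2 + a * y * w * N + Q + w * l + c1 * a\<^sup>2 * w\<^sup>2 \<ge> (c1 / 2) * a\<^sup>2 * w\<^sup>2"
    if a: "a \<ge> a0" and y: "\<bar>y\<bar> \<le> C" "\<bar>y'\<bar> \<le> C" and l: "\<bar>l\<bar> \<le> C * W" "W \<ge> 0" and N: "N = 2 * d + y' * w"
      and E: "\<bar>E\<bar> \<le> C * (W + a * \<bar>w\<bar>)" and Q: "Q \<ge> c0 * W\<^sup>2 - M * d\<^sup>2"
    for a w W N E y y' l d Q
  proof -
    have a1: "a \<ge> 1" "a \<ge> M" "a \<ge> 4 * C\<^sup>2 / c0" "a \<ge> 2 * B / c1" "a > 0"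
      using a parts unfolding a0_def by linarith+
    have ysq: "y\<^sup>2 \<le> C\<^sup>2" "y'\<^sup>2 \<le> C\<^sup>2"
      using power_mono[OF y(1), of 2] power_mono[OF y(2), of 2] by simp_all
    have lsq: "l\<^sup>2 \<le> C\<^sup>2 * W\<^sup>2"
      using power_mono[OF l(1), of 2] by (simp add: power_mult_distrib)
    have Esq: "E\<^sup>2 \<le> 2 * C\<^sup>2 * (W\<^sup>2 + a\<^sup>2 * w\<^sup>2)"
    proof -
      have "E\<^sup>2 \<le> (C * (W + a * \<bar>w\<bar>))\<^sup>2" using power_mono[OF E, of 2] by simp
      also have "\<dots> = C\<^sup>2 * (W + a * \<bar>w\<bar>)\<^sup>2" by (simp add: power_mult_distrib)
      also have "C\<^sup>2 * (W + a * \<bar>w\<bar>)\<^sup>2 \<le> C\<^sup>2 * (2 * (W\<^sup>2 + a\<^sup>2 * w\<^sup>2))"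
      proof (rule mult_left_mono)
        show "(W + a * \<bar>w\<bar>)\<^sup>2 \<le> 2 * (W\<^sup>2 + a\<^sup>2 * w\<^sup>2)" using sum_squares_ge_zero[of "W - a * \<bar>w\<bar>" 0] by (simp add: power2_eq_square algebra_simps)
      qed simp
      finally show ?thesis by (simp add: algebra_simps)
    qed
    have 1: "N * E \<ge> - (a * N\<^sup>2 / 4) - 2 * C\<^sup>2 * W\<^sup>2 / a - 2 * C\<^sup>2 * (a * w\<^sup>2)"
    proof -
      have "E\<^sup>2 / a \<le> 2 * C\<^sup>2 * (W\<^sup>2 + a\<^sup>2 * w\<^sup>2) / a" using Esq a1 by (intro divide_right_mono) auto
      also have "\<dots> = 2 * C\<^sup>2 * W\<^sup>2 / a + 2 * C\<^sup>2 * (a * w\<^sup>2)"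
        using a1 by (simp add: field_simps power2_eq_square)
      finally show ?thesis using young[OF a1(5), of N E] by linarith
    qed
    have 2: "a * y * w * N \<ge> - (a * N\<^sup>2 / 4) - C\<^sup>2 * (a * w\<^sup>2)"
    proof -
      have "(a * y * w)\<^sup>2 / a = y\<^sup>2 * (a * w\<^sup>2)" using a1 by (simp add: field_simps power2_eq_square)
      also have "\<dots> \<le> C\<^sup>2 * (a * w\<^sup>2)" using ysq a1 by (intro mult_right_mono) auto
      finally show ?thesis using young[OF a1(5), of N "a * y * w"] by (simp add: mult.commute)
    qed
    have 3: "w * l \<ge> - (c0 * W\<^sup>2 / 4) - C\<^sup>2 / c0 * (a * w\<^sup>2)"
    proof -
      have cl: "c0 / C\<^sup>2 > 0" using c C by simp
      have "c0 / C\<^sup>2 * l\<^sup>2 / 4 \<le> c0 / C\<^sup>2 * (C\<^sup>2 * W\<^sup>2) / 4"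
        using lsq cl by (intro divide_right_mono mult_left_mono) auto
      also have "\<dots> = c0 * W\<^sup>2 / 4" using C by simp
      finally have A: "c0 / C\<^sup>2 * l\<^sup>2 / 4 \<le> c0 * W\<^sup>2 / 4" .
      have "w\<^sup>2 / (c0 / C\<^sup>2) = C\<^sup>2 / c0 * w\<^sup>2" by simp
      also have "\<dots> \<le> C\<^sup>2 / c0 * (a * w\<^sup>2)"
        using c a1 by (intro mult_left_mono) (auto simp: mult_le_cancel_right1)
      finally have "- (l * w) \<le> c0 * W\<^sup>2 / 4 + C\<^sup>2 / c0 * (a * w\<^sup>2)"
        using young[OF cl, of l w] A by linarith
      then show ?thesis by (simp only: mult.commute[of w l])
    qed
    have 4: "M * d\<^sup>2 \<le> a * N\<^sup>2 / 2 + M * C\<^sup>2 * (a * w\<^sup>2)"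
    proof -
      have "d\<^sup>2 = (N - y' * w)\<^sup>2 / 4" using N by (simp add: power2_eq_square)
      then have "d\<^sup>2 \<le> (N\<^sup>2 + y'\<^sup>2 * w\<^sup>2) / 2"
        using sum_squares_ge_zero[of "N + y' * w" 0] by (simp add: power2_eq_square field_simps)
      also have "\<dots> \<le> N\<^sup>2 / 2 + C\<^sup>2 * w\<^sup>2"
      proof -
        have "y'\<^sup>2 * w\<^sup>2 \<le> C\<^sup>2 * w\<^sup>2" using ysq by (intro mult_right_mono) auto
        moreover have "0 \<le> C\<^sup>2 * w\<^sup>2" by simp
        ultimately show ?thesis unfolding add_divide_distrib by linarith
      qed
      finally have "M * d\<^sup>2 \<le> M * (N\<^sup>2 / 2) + M * (C\<^sup>2 * w\<^sup>2)"
        unfolding distrib_left[symmetric] using M by (intro mult_left_mono) auto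
      also have "M * (N\<^sup>2 / 2) \<le> a * (N\<^sup>2 / 2)" using a1 by (intro mult_right_mono) auto
      also have "M * (C\<^sup>2 * w\<^sup>2) \<le> M * (C\<^sup>2 * (a * w\<^sup>2))"
        using M a1 by (intro mult_left_mono) (auto simp: mult_le_cancel_right1)
      finally show ?thesis by simp
    qed
    have 5: "2 * C\<^sup>2 * W\<^sup>2 / a \<le> c0 * W\<^sup>2 / 2"
    proof -
      have "4 * C\<^sup>2 \<le> c0 * a" using a1(3) c by (simp add: field_simps)
      then have "4 * C\<^sup>2 * W\<^sup>2 \<le> c0 * a * W\<^sup>2" by (rule mult_right_mono) simp
      then show ?thesis using a1 by (simp add: field_simps)
    qed
    have 6: "B * (a * w\<^sup>2) \<le> c1 / 2 * a\<^sup>2 * w\<^sup>2"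
    proof -
      have "B \<le> c1 / 2 * a" using a1(4) c by (simp add: field_simps)
      then have "B * (a * w\<^sup>2) \<le> (c1 / 2 * a) * (a * w\<^sup>2)" using a1 by (intro mult_right_mono) auto
      then show ?thesis by (simp add: power2_eq_square mult_ac)
    qed
    have "0 \<le> c0 * W\<^sup>2" using c by simp
    moreover have "B * (a * w\<^sup>2) = 3 * C\<^sup>2 * (a * w\<^sup>2) + M * C\<^sup>2 * (a * w\<^sup>2) + C\<^sup>2 / c0 * (a * w\<^sup>2)"
      by (simp add: B_def algebra_simps)
    moreover have "c1 * a\<^sup>2 * w\<^sup>2 = c1 / 2 * a\<^sup>2 * w\<^sup>2 + c1 / 2 * a\<^sup>2 * w\<^sup>2" by simp
    ultimately show ?thesis using 1 2 3 4 5 6 Q by linarith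
  qed
  have "a0 \<ge> 1" using parts by (simp add: a0_def)
  show ?thesis by (rule that, fact, rule main)
qed

text \<open>Where \<open>D\<close> vanishes \<open>P\<close> is positive, and elsewhere a large
  multiple of the square wins. The relatively open sets obtained for the multiples 0, 1, 2, ...
  increase, so one of them is all of the compact set. In \<open>form_bound\<close>, \<open>D\<close>
  measures the failure of a vector to be tangent to a level set of the weight.\<close>

lemma compact_form_bound:
  fixes P D :: "'b::metric_space \<Rightarrow> real"
  assumes K: "compact K" and P: "continuous_on K P" and D: "continuous_on K D"
    and pos: "\<And>x. x \<in> K \<Longrightarrow> D x = 0 \<Longrightarrow> P x > 0"
  obtains c M where "c > 0" "M \<ge> 0" "\<And>x. x \<in> K \<Longrightarrow> P x + M * (D x)\<^sup>2 \<ge> c"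
proof -
  define U where "U k = {x \<in> K. P x + real k * (D x)\<^sup>2 > 0}" for k
  have "\<exists>k. K \<subseteq> U k"
  proof -
    have op: "openin (top_of_set K) (U k)" for k
    proof -
      have "U k = K \<inter> (\<lambda>x. P x + real k * (D x)\<^sup>2) -` {0<..}" by (auto simp: U_def)
      then show ?thesis
        using P D by (auto intro!: continuous_openin_preimage_gen continuous_intros)
    qed
    have cov: "K \<subseteq> (\<Union>k. U k)"
    proof
      fix x assume x: "x \<in> K"
      show "x \<in> (\<Union>k. U k)"
      proof (cases "D x = 0")
        case True
        then have "x \<in> U 0" using pos[OF x] x by (simp add: U_def)
        then show ?thesis by blast
      next
        case False
        obtain k :: nat where "real k > - P x / (D x)\<^sup>2" using reals_Archimedean2 by blast
        then have "- P x < real k * (D x)\<^sup>2" using False by (subst (asm) pos_divide_less_eq) auto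
        then have "x \<in> U k" using x by (simp add: U_def)
        then show ?thesis by blast
      qed
    qed
    have "\<exists>T. \<forall>k. open (T k) \<and> U k = K \<inter> T k"
      using op unfolding openin_open by (intro choice) blast
    then obtain T where T: "\<And>k. open (T k)" "\<And>k. U k = K \<inter> T k" by blast
    then have "K \<subseteq> (\<Union>k\<in>UNIV. T k)" using cov by auto
    then obtain F where F: "F \<subseteq> UNIV" "finite F" "K \<subseteq> (\<Union>k\<in>F. T k)"
      by (rule compactE_image[OF K, of UNIV T, OF T(1)])
    obtain m where m: "\<And>k. k \<in> F \<Longrightarrow> k \<le> m" using F(2) by (meson finite_nat_set_iff_bounded_le)
    have "U k \<subseteq> U m" if "k \<le> m" for k
    proof
      fix x assume "x \<in> U k"
      moreover have "real k * (D x)\<^sup>2 \<le> real m * (D x)\<^sup>2" using that by (intro mult_right_mono) auto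
      ultimately show "x \<in> U m" by (auto simp: U_def)
    qed
    then have "K \<subseteq> U m" using F(3) m T(2) by blast
    then show ?thesis ..
  qed
  then obtain k where k: "K \<subseteq> U k" ..
  show ?thesis
  proof (cases "K = {}")
    case True then show ?thesis using that[of 1 0] by auto
  next
    case False
    have "continuous_on K (\<lambda>x. P x + real k * (D x)\<^sup>2)" using P D by (intro continuous_intros)
    then obtain x where "x \<in> K" "\<And>y. y \<in> K \<Longrightarrow> P x + real k * (D x)\<^sup>2 \<le> P y + real k * (D y)\<^sup>2"
      using continuous_attains_inf[OF K False] by blast
    then show ?thesis using that[of "P x + real k * (D x)\<^sup>2" "real k"] k by (auto simp: U_def)
  qed
qed

section \<open>Divergences of products, and bounds on compact sets\<close>

lemma C1_deriv_scaleR_trace: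
  assumes s: "C1_deriv S s s'" and V: "C1_deriv S V V'"
  shows "\<exists>P. C1_deriv S (\<lambda>q. s q *\<^sub>R V q) P \<and> (\<forall>q\<in>S. op_trace (P q) = s q * op_trace (V' q) + s' q (V q))"
proof (intro exI conjI ballI)
  show "C1_deriv S (\<lambda>q. s q *\<^sub>R V q) (\<lambda>q v. s q *\<^sub>R V' q v + s' q v *\<^sub>R V q)"
    by (rule C1_deriv_scaleR[OF s V])
  show "op_trace (\<lambda>v. s q *\<^sub>R V' q v + s' q v *\<^sub>R V q) = s q * op_trace (V' q) + s' q (V q)" if "q \<in> S" for q
    using bounded_linear.linear[OF C1_derivD(4)[OF s that]]
    by (simp add: op_trace_add op_trace_scaleR op_trace_rank_one)
qed

lemma C1_deriv_apply_sum:
  assumes "C1_deriv S f f'" "q \<in> S"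
  shows "f' q v = (\<Sum>b\<in>Basis. (v \<bullet> b) *\<^sub>R f' q b)"
proof -
  interpret bounded_linear "f' q" using assms by (rule C1_derivD(4))
  have "f' q v = f' q (\<Sum>b\<in>Basis. (v \<bullet> b) *\<^sub>R b)" by (simp add: euclidean_representation)
  then show ?thesis by (simp add: sum scaleR)
qed

lemma C1_deriv_joint:
  assumes "C1_deriv S f f'" and "continuous_on T l" "continuous_on T m" "l ` T \<subseteq> S"
  shows "continuous_on T (\<lambda>x. f' (l x) (m x))"
proof -
  have "continuous_on T (\<lambda>x. \<Sum>b\<in>Basis. (m x \<bullet> b) *\<^sub>R f' (l x) b)"
    using assms(2-4)
    by (intro continuous_on_sum continuous_on_scaleR continuous_on_inner continuous_on_const
        continuous_on_compose2[OF C1_derivD(2)[OF assms(1)] assms(2)]) auto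
  then show ?thesis
    by (rule continuous_on_eq) (use assms(4) C1_deriv_apply_sum[OF assms(1)] in \<open>auto simp: image_subset_iff\<close>)
qed

lemma C1_deriv_norm_bound:
  assumes "C1_deriv S f f'" "compact K" "K \<subseteq> S"
  obtains C where "C \<ge> 0" "\<And>q v. q \<in> K \<Longrightarrow> norm (f' q v) \<le> C * norm v"
proof -
  have "\<exists>B. \<forall>q\<in>K. norm (f' q b) \<le> B" for b
  proof -
    have "compact ((\<lambda>q. f' q b) ` K)"
      by (rule compact_continuous_image[OF continuous_on_subset[OF C1_derivD(2)[OF assms(1)] assms(3)] assms(2)])
    then show ?thesis by (auto dest!: compact_imp_bounded simp: bounded_iff)
  qed
  then obtain B where B: "\<And>b q. q \<in> K \<Longrightarrow> norm (f' q b) \<le> B b" by metis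
  have "norm (f' q v) \<le> (\<Sum>b\<in>Basis. \<bar>B b\<bar>) * norm v" if q: "q \<in> K" for q v
  proof -
    have "norm (f' q v) \<le> (\<Sum>b\<in>Basis. norm ((v \<bullet> b) *\<^sub>R f' q b))"
      using C1_deriv_apply_sum[OF assms(1), of q v] q assms(3) by (metis norm_sum subsetD)
    also have "\<dots> \<le> (\<Sum>b\<in>Basis. norm v * \<bar>B b\<bar>)"
      using B[OF q] Basis_le_norm by (intro sum_mono) (auto intro!: mult_mono intro: order_trans[OF _ abs_ge_self])
    finally show ?thesis by (simp add: sum_distrib_left mult.commute)
  qed
  then show ?thesis using that[of "\<Sum>b\<in>Basis. \<bar>B b\<bar>"] by (auto simp: sum_nonneg)
qed

lemma compact_bound:
  fixes f :: "'b::metric_space \<Rightarrow> 'c::real_normed_vector"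
  assumes "compact K" "continuous_on K f"
  obtains C where "C \<ge> 0" "\<And>q. q \<in> K \<Longrightarrow> norm (f q) \<le> C"
proof -
  have "bounded (f ` K)" using assms by (intro compact_imp_bounded compact_continuous_image)
  then obtain C where "\<And>q. q \<in> K \<Longrightarrow> norm (f q) \<le> C" by (auto simp: bounded_iff)
  then have "\<And>q. q \<in> K \<Longrightarrow> norm (f q) \<le> max C 0" by (auto simp: le_max_iff_disj)
  then show ?thesis using that[of "max C 0"] by auto
qed

text \<open>
  \<open>A\<close> is the inverse of a constant metric and raises indices; for the wave operator it is the
  reflection \<open>(t, x) \<mapsto> (- t, x)\<close>. \<open>F2\<close> is the Hessian of the weight \<open>F\<close>. In the definition of the
  current, \<open>w = exp (a F) z\<close> and \<open>W\<close> is the gradient of \<open>w\<close>; the underlying multiplier is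
  \<open>2 (DF \<bullet> A W) + g w\<close>.
\<close>

locale carleman_weight =
  fixes A :: "'a::euclidean_space \<Rightarrow> 'a" and R :: "'a set" and F :: "'a \<Rightarrow> real"
    and DF :: "'a \<Rightarrow> 'a" and F2 :: "'a \<Rightarrow> 'a \<Rightarrow> 'a" and g :: "'a \<Rightarrow> real" and g' :: "'a \<Rightarrow> 'a \<Rightarrow> real"
  assumes linA: "linear A" and AA: "\<And>v. A (A v) = v" and adj: "\<And>u v. A u \<bullet> v = u \<bullet> A v"
    and R: "open R"
    and dF: "\<And>q. q \<in> R \<Longrightarrow> (F has_derivative (\<lambda>v. DF q \<bullet> v)) (at q)"
    and DF: "C1_deriv R DF F2" and g: "C1_deriv R g g'"
begin

text \<open>Trace with respect to the metric: for \<open>A = time_reflection\<close> and a Hessian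
  \<open>L\<close> this is the ultrahyperbolic operator, see \<open>wave_op_trace\<close>.\<close>

definition box :: "('a \<Rightarrow> 'a) \<Rightarrow> real" where
  "box L = op_trace (\<lambda>v. A (L v))"

text \<open>The multiple of the metric that is subtracted from twice the Hessian in the Carleman
  form; the multiplier \<open>g\<close> is a free choice of this multiple.\<close>

definition shift :: "'a \<Rightarrow> real" where
  "shift q = box (F2 q) - g q"

definition current :: "real \<Rightarrow> real \<Rightarrow> 'a \<Rightarrow> 'a \<Rightarrow> 'a" where
  "current a w W q = (2 * (DF q \<bullet> A W)) *\<^sub>R A W - (W \<bullet> A W) *\<^sub>R A (DF q)
     + (g q * w) *\<^sub>R A W + (a\<^sup>2 * ((DF q \<bullet> A (DF q)) * (w * w))) *\<^sub>R A (DF q)"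

lemma blA: "bounded_linear A"
  by (simp add: linA linear_conv_bounded_linear[symmetric])

lemma normA: "norm (A v) = norm v"
  by (simp add: norm_eq_sqrt_inner adj AA)

lemma C1_F: "C1_deriv R F (\<lambda>q v. DF q \<bullet> v)"
  by (intro C1_deriv_gradient dF C1_derivD(3)[OF DF])

text \<open>The first two terms of \<open>current\<close> are twice the stress-energy tensor of
  \<open>w\<close> contracted with the gradient of the weight. In their divergence the Hessian of
  \<open>w\<close> survives only through its metric trace \<open>box\<close>, and the Hessian of the
  weight appears as a quadratic form in the gradient.\<close>

lemma divergence_current:
  assumes S: "open S" "S \<subseteq> R"
    and dw: "\<And>q. q \<in> S \<Longrightarrow> (w has_derivative (\<lambda>v. W q \<bullet> v)) (at q)"
    and W: "C1_deriv S W H"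
  obtains J' where "C1_deriv S (\<lambda>q. current a (w q) (W q) q) J'"
    "\<And>q. q \<in> S \<Longrightarrow> op_trace (J' q) =
       (2 * (DF q \<bullet> A (W q)) + g q * w q) * box (H q) + 2 * (F2 q (A (W q)) \<bullet> A (W q))
       - (box (F2 q) - g q) * (W q \<bullet> A (W q)) + w q * g' q (A (W q))
       + a\<^sup>2 * (2 * (F2 q (A (DF q)) \<bullet> A (DF q)) * (w q)\<^sup>2)
       + a\<^sup>2 * ((DF q \<bullet> A (DF q)) * w q * (2 * (DF q \<bullet> A (W q)) + w q * box (F2 q)))"
proof -
  note DFS = C1_deriv_subset[OF DF S(2)] and gS = C1_deriv_subset[OF g S(2)]
  have wS: "C1_deriv S w (\<lambda>q v. W q \<bullet> v)"
    by (intro C1_deriv_gradient dw C1_derivD(3)[OF W])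
  note AW = C1_deriv_compose_linear[OF W blA] and ADF = C1_deriv_compose_linear[OF DFS blA]
  obtain P1 where P1: "C1_deriv S (\<lambda>q. (2 * (DF q \<bullet> A (W q))) *\<^sub>R A (W q)) P1"
    "\<forall>q\<in>S. op_trace (P1 q) = 2 * (DF q \<bullet> A (W q)) * op_trace (\<lambda>v. A (H q v))
       + (2 * (DF q \<bullet> A (H q (A (W q))) + F2 q (A (W q)) \<bullet> A (W q)) + 0 * (DF q \<bullet> A (W q)))"
    using C1_deriv_scaleR_trace[OF C1_deriv_mult[OF C1_deriv_const[of S 2] C1_deriv_inner[OF DFS AW]] AW] by auto
  obtain P2 where P2: "C1_deriv S (\<lambda>q. (W q \<bullet> A (W q)) *\<^sub>R A (DF q)) P2"
    "\<forall>q\<in>S. op_trace (P2 q) = (W q \<bullet> A (W q)) * op_trace (\<lambda>v. A (F2 q v))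
       + (W q \<bullet> A (H q (A (DF q))) + H q (A (DF q)) \<bullet> A (W q))"
    using C1_deriv_scaleR_trace[OF C1_deriv_inner[OF W AW] ADF] by auto
  obtain P3 where P3: "C1_deriv S (\<lambda>q. (g q * w q) *\<^sub>R A (W q)) P3"
    "\<forall>q\<in>S. op_trace (P3 q) = g q * w q * op_trace (\<lambda>v. A (H q v))
       + (g q * (W q \<bullet> A (W q)) + g' q (A (W q)) * w q)"
    using C1_deriv_scaleR_trace[OF C1_deriv_mult[OF gS wS] AW] by auto
  obtain P4 where P4: "C1_deriv S (\<lambda>q. (a\<^sup>2 * ((DF q \<bullet> A (DF q)) * (w q * w q))) *\<^sub>R A (DF q)) P4"
    "\<forall>q\<in>S. op_trace (P4 q) = a\<^sup>2 * ((DF q \<bullet> A (DF q)) * (w q * w q)) * op_trace (\<lambda>v. A (F2 q v))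
       + (a\<^sup>2 * ((DF q \<bullet> A (DF q)) * (w q * (W q \<bullet> A (DF q)) + (W q \<bullet> A (DF q)) * w q)
         + (DF q \<bullet> A (F2 q (A (DF q))) + F2 q (A (DF q)) \<bullet> A (DF q)) * (w q * w q)) + 0 * ((DF q \<bullet> A (DF q)) * (w q * w q)))"
    using C1_deriv_scaleR_trace[OF C1_deriv_mult[OF C1_deriv_const[of S "a\<^sup>2"]
        C1_deriv_mult[OF C1_deriv_inner[OF DFS ADF] C1_deriv_mult[OF wS wS]]] ADF] by auto
  have C: "C1_deriv S (\<lambda>q. current a (w q) (W q) q) (\<lambda>q v. P1 q v - P2 q v + P3 q v + P4 q v)"
    unfolding current_def
    by (intro C1_deriv_add C1_deriv_diff P1(1) P2(1) P3(1) P4(1))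
  have sym: "H q u \<bullet> v = H q v \<bullet> u" if "q \<in> S" for q u v
    by (rule hessian_symmetric[OF S(1) that dw C1_derivD(1)[OF W that]])
  show ?thesis
  proof (rule that[OF C])
    fix q assume q: "q \<in> S"
    \<comment> \<open>The decisive cancellation: as \<open>H q\<close> is symmetric, the second
      derivatives of \<open>w\<close> produced by \<open>P1\<close> equal those produced by
      \<open>P2\<close>, except for the trace.\<close>
    have 1: "DF q \<bullet> A (H q (A (W q))) = H q (A (DF q)) \<bullet> A (W q)"
      by (metis adj sym[OF q] inner_commute)
    have 2: "W q \<bullet> A (H q (A (DF q))) = H q (A (DF q)) \<bullet> A (W q)"
      by (metis adj inner_commute)
    have 3: "DF q \<bullet> A (F2 q (A (DF q))) = F2 q (A (DF q)) \<bullet> A (DF q)"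
      by (metis adj inner_commute)
    have 4: "W q \<bullet> A (DF q) = DF q \<bullet> A (W q)"
      by (metis adj inner_commute)
    show "op_trace (\<lambda>v. P1 q v - P2 q v + P3 q v + P4 q v) =
       (2 * (DF q \<bullet> A (W q)) + g q * w q) * box (H q) + 2 * (F2 q (A (W q)) \<bullet> A (W q))
       - (box (F2 q) - g q) * (W q \<bullet> A (W q)) + w q * g' q (A (W q))
       + a\<^sup>2 * (2 * (F2 q (A (DF q)) \<bullet> A (DF q)) * (w q)\<^sup>2)
       + a\<^sup>2 * ((DF q \<bullet> A (DF q)) * w q * (2 * (DF q \<bullet> A (W q)) + w q * box (F2 q)))"
      using P1(2) P2(2) P3(2) P4(2) q
      by (simp add: op_trace_add op_trace_diff 1 2 3 4 box_def[symmetric] power2_eq_square algebra_simps)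
  qed
qed

text \<open>The product rule is rewritten through \<open>W\<close> instead of \<open>Dz\<close>.
  Substituting \<open>exp (a * F q) *\<^sub>R Dz q = W q - (a * w q) *\<^sub>R DF q\<close> turns
  the coefficient of \<open>DF q \<bullet> A (DF q)\<close> from plus into minus
  \<open>a\<^sup>2\<close>, which is the sign that the last term of \<open>current\<close>
  compensates.\<close>

lemma conjugate:
  fixes a :: real
  assumes S: "open S" "S \<subseteq> R"
    and dz: "\<And>q. q \<in> S \<Longrightarrow> (z has_derivative (\<lambda>v. Dz q \<bullet> v)) (at q)"
    and Dz: "C1_deriv S Dz Hz"
  defines "w \<equiv> \<lambda>q. exp (a * F q) * z q" and "W \<equiv> \<lambda>q. exp (a * F q) *\<^sub>R (Dz q + (a * z q) *\<^sub>R DF q)"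
  obtains H where "\<And>q. q \<in> S \<Longrightarrow> (w has_derivative (\<lambda>v. W q \<bullet> v)) (at q)" "C1_deriv S W H"
    "\<And>q. q \<in> S \<Longrightarrow> box (H q) = exp (a * F q) * box (Hz q) + 2 * a * (DF q \<bullet> A (W q))
       + (a * box (F2 q) - a\<^sup>2 * (DF q \<bullet> A (DF q))) * w q"
proof -
  note DFS = C1_deriv_subset[OF DF S(2)] and FS = C1_deriv_subset[OF C1_F S(2)]
  have zS: "C1_deriv S z (\<lambda>q v. Dz q \<bullet> v)"
    by (intro C1_deriv_gradient dz C1_derivD(3)[OF Dz])
  have aF: "C1_deriv S (\<lambda>q. a * F q) (\<lambda>q v. a * (DF q \<bullet> v) + 0 * F q)"
    by (rule C1_deriv_mult[OF C1_deriv_const FS])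
  have e: "C1_deriv S (\<lambda>q. exp (a * F q)) (\<lambda>q v. exp (a * F q) * (a * (DF q \<bullet> v) + 0 * F q))"
    by (rule C1_deriv_compose_real[where g=exp and g'=exp and T=UNIV, OF aF])
       (auto intro: continuous_intros)
  have az: "C1_deriv S (\<lambda>q. a * z q) (\<lambda>q v. a * (Dz q \<bullet> v) + 0 * z q)"
    by (rule C1_deriv_mult[OF C1_deriv_const zS])
  note inner = C1_deriv_add[OF Dz C1_deriv_scaleR[OF az DFS]]
  note WW = C1_deriv_scaleR[OF e inner]
  show ?thesis
  proof (rule that)
    fix q assume q: "q \<in> S"
    have "(w has_derivative (\<lambda>v. exp (a * F q) * (Dz q \<bullet> v) + exp (a * F q) * (a * (DF q \<bullet> v) + 0 * F q) * z q)) (at q)"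
      unfolding w_def using C1_derivD(1)[OF C1_deriv_mult[OF e zS] q] .
    then show "(w has_derivative (\<lambda>v. W q \<bullet> v)) (at q)"
      by (simp add: W_def inner_add_left algebra_simps)
  next
    show "C1_deriv S W (\<lambda>q v. exp (a * F q) *\<^sub>R (Hz q v + ((a * z q) *\<^sub>R F2 q v + (a * (Dz q \<bullet> v) + 0 * z q) *\<^sub>R DF q))
        + (exp (a * F q) * (a * (DF q \<bullet> v) + 0 * F q)) *\<^sub>R (Dz q + (a * z q) *\<^sub>R DF q))"
      unfolding W_def by (rule WW)
  next
    fix q assume q: "q \<in> S"
    have lin: "linear (\<lambda>v. c * (x \<bullet> v))" for c and x :: 'a
      by (intro linearI) (auto simp: inner_add_right algebra_simps)
    have r1: "op_trace (\<lambda>v. (c * (x \<bullet> v)) *\<^sub>R u) = c * (x \<bullet> u)" for c and x u :: 'a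
      by (rule op_trace_rank_one[OF lin])
    have 4: "Dz q \<bullet> A (DF q) = DF q \<bullet> A (Dz q)"
      by (metis adj inner_commute)
    have "box (\<lambda>v. exp (a * F q) *\<^sub>R (Hz q v + ((a * z q) *\<^sub>R F2 q v + (a * (Dz q \<bullet> v) + 0 * z q) *\<^sub>R DF q))
        + (exp (a * F q) * (a * (DF q \<bullet> v) + 0 * F q)) *\<^sub>R (Dz q + (a * z q) *\<^sub>R DF q))
      = op_trace (\<lambda>v. exp (a * F q) *\<^sub>R (A (Hz q v) + ((a * z q) *\<^sub>R A (F2 q v) + (a * (Dz q \<bullet> v)) *\<^sub>R A (DF q)))
        + ((exp (a * F q) * a) * (DF q \<bullet> v)) *\<^sub>R (A (Dz q) + (a * z q) *\<^sub>R A (DF q)))"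
      unfolding box_def by (simp add: linear_add[OF linA] linear_cmul[OF linA] mult.assoc)
    also have "\<dots> = exp (a * F q) * (box (Hz q) + (a * z q * box (F2 q) + a * (Dz q \<bullet> A (DF q))))
        + exp (a * F q) * a * (DF q \<bullet> (A (Dz q) + (a * z q) *\<^sub>R A (DF q)))"
      by (simp add: op_trace_add op_trace_scaleR r1 box_def)
    also have "\<dots> = exp (a * F q) * box (Hz q) + 2 * a * (DF q \<bullet> A (W q))
       + (a * box (F2 q) - a\<^sup>2 * (DF q \<bullet> A (DF q))) * w q"
      by (simp add: w_def W_def linear_add[OF linA] linear_cmul[OF linA] inner_add_right 4 power2_eq_square algebra_simps)
    finally show "box (\<lambda>v. exp (a * F q) *\<^sub>R (Hz q v + ((a * z q) *\<^sub>R F2 q v + (a * (Dz q \<bullet> v) + 0 * z q) *\<^sub>R DF q))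
        + (exp (a * F q) * (a * (DF q \<bullet> v) + 0 * F q)) *\<^sub>R (Dz q + (a * z q) *\<^sub>R DF q))
      = exp (a * F q) * box (Hz q) + 2 * a * (DF q \<bullet> A (W q))
       + (a * box (F2 q) - a\<^sup>2 * (DF q \<bullet> A (DF q))) * w q" .
  qed
qed

text \<open>Both sides are homogeneous of degree two in \<open>\<xi>\<close>, so the unit sphere
  over \<open>K\<close> is enough, and that set is compact.\<close>

lemma form_bound:
  assumes K: "compact K" "K \<subseteq> R"
    and form: "\<And>q \<xi>. q \<in> K \<Longrightarrow> \<xi> \<noteq> 0 \<Longrightarrow> DF q \<bullet> \<xi> = 0 \<Longrightarrow> 2 * (F2 q \<xi> \<bullet> \<xi>) - shift q * (\<xi> \<bullet> A \<xi>) > 0"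
  obtains c M where "c > 0" "M \<ge> 0"
    "\<And>q \<xi>. q \<in> K \<Longrightarrow> 2 * (F2 q \<xi> \<bullet> \<xi>) - shift q * (\<xi> \<bullet> A \<xi>) \<ge> c * (norm \<xi>)\<^sup>2 - M * (DF q \<bullet> \<xi>)\<^sup>2"
proof -
  let ?S = "K \<times> sphere (0::'a) 1"
  have cS: "continuous_on K shift"
    unfolding shift_def box_def op_trace_def
    using K(2) by (intro continuous_intros bounded_linear.continuous_on[OF blA])
      (auto intro!: continuous_on_subset[OF C1_derivD(2)[OF DF]] continuous_on_subset[OF C1_derivD(3)[OF g]])
  have f1: "compact ?S" using K(1) by (intro compact_Times) auto
  have f2: "continuous_on ?S (\<lambda>x. 2 * (F2 (fst x) (snd x) \<bullet> snd x) - shift (fst x) * (snd x \<bullet> A (snd x)))"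
    using K(2)
    by (intro continuous_intros C1_deriv_joint[OF DF] bounded_linear.continuous_on[OF blA]
       continuous_on_compose2[OF cS]) auto
  have f3: "continuous_on ?S (\<lambda>x. DF (fst x) \<bullet> snd x)"
    using K(2) by (intro continuous_intros continuous_on_compose2[OF C1_derivD(3)[OF DF]]) auto
  have f4: "2 * (F2 (fst x) (snd x) \<bullet> snd x) - shift (fst x) * (snd x \<bullet> A (snd x)) > 0"
    if "x \<in> ?S" "DF (fst x) \<bullet> snd x = 0" for x
    by (rule form) (use that in auto)
  obtain c M where cM: "c > 0" "M \<ge> 0"
    "\<And>x. x \<in> ?S \<Longrightarrow> c \<le> 2 * (F2 (fst x) (snd x) \<bullet> snd x) - shift (fst x) * (snd x \<bullet> A (snd x)) + M * (DF (fst x) \<bullet> snd x)\<^sup>2"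
  proof (rule compact_form_bound[OF f1 f2 f3])
    show "0 < 2 * (F2 (fst x) (snd x) \<bullet> snd x) - shift (fst x) * (snd x \<bullet> A (snd x))"
      if "x \<in> ?S" "DF (fst x) \<bullet> snd x = 0" for x using that by (rule f4)
  qed blast
  show ?thesis
  proof (rule that[OF cM(1,2)])
    fix q \<xi> assume q: "q \<in> K"
    interpret F2: bounded_linear "F2 q" using q K(2) by (intro C1_derivD(4)[OF DF]) auto
    show "2 * (F2 q \<xi> \<bullet> \<xi>) - shift q * (\<xi> \<bullet> A \<xi>) \<ge> c * (norm \<xi>)\<^sup>2 - M * (DF q \<bullet> \<xi>)\<^sup>2"
    proof (cases "\<xi> = 0")
      case True then show ?thesis by (simp add: F2.zero)
    next
      case False
      define u where "u = sgn \<xi>"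
      have \<xi>: "\<xi> = norm \<xi> *\<^sub>R u" by (simp add: u_def sgn_div_norm False)
      have "c \<le> 2 * (F2 q u \<bullet> u) - shift q * (u \<bullet> A u) + M * (DF q \<bullet> u)\<^sup>2"
        using cM(3)[of "(q, u)"] q False by (simp add: u_def norm_sgn)
      then have "(norm \<xi>)\<^sup>2 * c \<le> (norm \<xi>)\<^sup>2 * (2 * (F2 q u \<bullet> u) - shift q * (u \<bullet> A u) + M * (DF q \<bullet> u)\<^sup>2)"
        by (rule mult_left_mono) simp
      also have "\<dots> = 2 * (F2 q \<xi> \<bullet> \<xi>) - shift q * (\<xi> \<bullet> A \<xi>) + M * (DF q \<bullet> \<xi>)\<^sup>2"
      proof -
        have "F2 q (k *\<^sub>R u) \<bullet> (k *\<^sub>R u) = k\<^sup>2 * (F2 q u \<bullet> u)" "(k *\<^sub>R u) \<bullet> A (k *\<^sub>R u) = k\<^sup>2 * (u \<bullet> A u)"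
          "(DF q \<bullet> (k *\<^sub>R u))\<^sup>2 = k\<^sup>2 * (DF q \<bullet> u)\<^sup>2" for k
          by (simp_all add: F2.scaleR linear_cmul[OF linA] power2_eq_square)
        from this[of "norm \<xi>", folded \<xi>] show ?thesis by (simp add: algebra_simps)
      qed
      finally show ?thesis by (simp add: mult.commute)
    qed
  qed
qed

text \<open>In terms of \<open>N = 2 * d + g * w\<close>, the conjugated equation expresses
  \<open>box H\<close> as \<open>E + a * N + a * shift * w\<close> minus
  \<open>a\<^sup>2 * (DF \<bullet> A DF) * w\<close>. Multiplication by \<open>N\<close> produces
  the square \<open>a * N\<^sup>2\<close>; the last term of the current cancels the cross term with
  \<open>a\<^sup>2\<close> and leaves exactly the expression in \<open>zeroth\<close>. So
  \<open>form\<close> controls the gradient up to \<open>d\<close>, \<open>zeroth\<close> controls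
  \<open>w\<close>, and the square controls \<open>d\<close>.\<close>

theorem carleman_divergence:
  assumes K: "compact K" "K \<subseteq> R"
    and form: "\<And>q \<xi>. q \<in> K \<Longrightarrow> \<xi> \<noteq> 0 \<Longrightarrow> DF q \<bullet> \<xi> = 0 \<Longrightarrow> 2 * (F2 q \<xi> \<bullet> \<xi>) - shift q * (\<xi> \<bullet> A \<xi>) > 0"
    and zeroth: "\<And>q. q \<in> K \<Longrightarrow> 2 * (F2 q (A (DF q)) \<bullet> A (DF q)) + (DF q \<bullet> A (DF q)) * shift q > 0"
    and S: "open S" "S \<subseteq> R"
    and dz: "\<And>q. q \<in> S \<Longrightarrow> (z has_derivative (\<lambda>v. Dz q \<bullet> v)) (at q)"
    and Dz: "C1_deriv S Dz Hz"
    and eqn: "\<And>q. q \<in> S \<Longrightarrow> \<bar>box (Hz q)\<bar> \<le> B * (norm (Dz q) + \<bar>z q\<bar>)"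
  obtains a0 c where "a0 \<ge> 1" "c > 0"
    "\<And>a. a \<ge> a0 \<Longrightarrow>
      \<exists>J'. C1_deriv S (\<lambda>q. current a (exp (a * F q) * z q)
              (exp (a * F q) *\<^sub>R (Dz q + (a * z q) *\<^sub>R DF q)) q) J' \<and>
        (\<forall>q\<in>S \<inter> K. op_trace (J' q) \<ge> c * a\<^sup>2 * (exp (a * F q) * z q)\<^sup>2)"
proof -
  obtain c0 M where c0: "c0 > 0" "M \<ge> 0"
    "\<And>q \<xi>. q \<in> K \<Longrightarrow> 2 * (F2 q \<xi> \<bullet> \<xi>) - shift q * (\<xi> \<bullet> A \<xi>) \<ge> c0 * (norm \<xi>)\<^sup>2 - M * (DF q \<bullet> \<xi>)\<^sup>2"
  proof (rule form_bound[OF K])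
    show "2 * (F2 q \<xi> \<bullet> \<xi>) - shift q * (\<xi> \<bullet> A \<xi>) > 0"
      if "q \<in> K" "\<xi> \<noteq> 0" "DF q \<bullet> \<xi> = 0" for q \<xi> using that by (rule form)
  qed blast
  have cF2: "continuous_on K (\<lambda>q. F2 q v)" for v
    using C1_derivD(2)[OF DF] K(2) by (rule continuous_on_subset)
  have cDF: "continuous_on K DF" and cg: "continuous_on K g"
    using C1_derivD(3)[OF DF] C1_derivD(3)[OF g] K(2) by (auto intro: continuous_on_subset)
  have cS: "continuous_on K shift"
    unfolding shift_def box_def op_trace_def
    by (intro continuous_intros bounded_linear.continuous_on[OF blA] cF2 cg)
  have cZ: "continuous_on K (\<lambda>q. 2 * (F2 q (A (DF q)) \<bullet> A (DF q)) + (DF q \<bullet> A (DF q)) * shift q)"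
    by (intro continuous_intros C1_deriv_joint[OF DF] bounded_linear.continuous_on[OF blA] cDF cS) (use K in auto)
  obtain c1 where c1: "c1 > 0" "\<And>q. q \<in> K \<Longrightarrow> 2 * (F2 q (A (DF q)) \<bullet> A (DF q)) + (DF q \<bullet> A (DF q)) * shift q \<ge> c1"
  proof (rule compact_form_bound[OF K(1) cZ continuous_on_const[of K 0]])
    show "0 < 2 * (F2 q (A (DF q)) \<bullet> A (DF q)) + (DF q \<bullet> A (DF q)) * shift q" if "q \<in> K" for q
      using that by (rule zeroth)
  qed auto
  obtain C1 where C1: "C1 \<ge> 0" "\<And>q. q \<in> K \<Longrightarrow> norm (DF q) \<le> C1" by (rule compact_bound[OF K(1) cDF]) blast
  obtain C2 where C2: "C2 \<ge> 0" "\<And>q. q \<in> K \<Longrightarrow> norm (g q) \<le> C2" by (rule compact_bound[OF K(1) cg]) blast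
  obtain C3 where C3: "C3 \<ge> 0" "\<And>q. q \<in> K \<Longrightarrow> norm (shift q) \<le> C3" by (rule compact_bound[OF K(1) cS]) blast
  obtain C4 where C4: "C4 \<ge> 0" "\<And>q v. q \<in> K \<Longrightarrow> norm (g' q v) \<le> C4 * norm v"
    by (rule C1_deriv_norm_bound[OF g K]) blast
  define C where "C = 1 + C2 + C3 + C4 + \<bar>B\<bar> * (C1 + 1)"
  have BC: "\<bar>B\<bar> * (C1 + 1) \<ge> 0" "\<bar>B\<bar> \<le> \<bar>B\<bar> * (C1 + 1)" using C1 by (auto simp: mult_le_cancel_left1)
  have C: "C \<ge> 1" "C2 \<le> C" "C3 \<le> C" "C4 \<le> C" "\<bar>B\<bar> * (C1 + 1) \<le> C" "\<bar>B\<bar> \<le> C"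
    using C1(1) C2(1) C3(1) C4(1) BC by (auto simp: C_def)
  obtain a0 where a0: "a0 \<ge> 1"
    "\<And>a w W N E y y' l d Q. \<lbrakk>a \<ge> a0; \<bar>y\<bar> \<le> C; \<bar>y'\<bar> \<le> C; \<bar>l\<bar> \<le> C * W; W \<ge> 0; N = 2 * d + y' * w;
       \<bar>E\<bar> \<le> C * (W + a * \<bar>w\<bar>); Q \<ge> c0 * W\<^sup>2 - M * d\<^sup>2\<rbrakk>
     \<Longrightarrow> N * E + a * N\<^sup>2 + a * y * w * N + Q + w * l + c1 * a\<^sup>2 * w\<^sup>2 \<ge> (c1 / 2) * a\<^sup>2 * w\<^sup>2"
    by (rule carleman_absorb[OF c0(1) c1(1) C(1) c0(2)]) blast
  show ?thesis
  proof (rule that[OF a0(1)])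
    show "c1 / 2 > 0" using c1 by simp
    fix a :: real assume a: "a \<ge> a0"
    then have a1: "a \<ge> 1" using a0(1) by simp
    define w where "w q = exp (a * F q) * z q" for q
    define W where "W q = exp (a * F q) *\<^sub>R (Dz q + (a * z q) *\<^sub>R DF q)" for q
    obtain H where H: "\<And>q. q \<in> S \<Longrightarrow> (w has_derivative (\<lambda>v. W q \<bullet> v)) (at q)" "C1_deriv S W H"
      "\<And>q. q \<in> S \<Longrightarrow> box (H q) = exp (a * F q) * box (Hz q) + 2 * a * (DF q \<bullet> A (W q))
         + (a * box (F2 q) - a\<^sup>2 * (DF q \<bullet> A (DF q))) * w q"
      using conjugate[OF S dz Dz, of a, folded w_def W_def] by blast
    obtain J' where J': "C1_deriv S (\<lambda>q. current a (w q) (W q) q) J'"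
      "\<And>q. q \<in> S \<Longrightarrow> op_trace (J' q) =
       (2 * (DF q \<bullet> A (W q)) + g q * w q) * box (H q) + 2 * (F2 q (A (W q)) \<bullet> A (W q))
       - (box (F2 q) - g q) * (W q \<bullet> A (W q)) + w q * g' q (A (W q))
       + a\<^sup>2 * (2 * (F2 q (A (DF q)) \<bullet> A (DF q)) * (w q)\<^sup>2)
       + a\<^sup>2 * ((DF q \<bullet> A (DF q)) * w q * (2 * (DF q \<bullet> A (W q)) + w q * box (F2 q)))"
      by (rule divergence_current[where a=a, OF S H(1,2)]) blast+
    have "op_trace (J' q) \<ge> c1 / 2 * a\<^sup>2 * (w q)\<^sup>2" if q: "q \<in> S" "q \<in> K" for q
    proof -
      define d where "d = DF q \<bullet> A (W q)"
      define N where "N = 2 * d + g q * w q"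
      define E where "E = exp (a * F q) * box (Hz q)"
      \<comment> \<open>The form at the raised gradient \<open>\<xi> = A (W q)\<close>. Its pairing
        with \<open>DF q\<close> is \<open>d\<close>, so the defect of tangency is the quantity that
        the multiplier sees.\<close>
      define Q where "Q = 2 * (F2 q (A (W q)) \<bullet> A (W q)) - shift q * (A (W q) \<bullet> A (A (W q)))"
      have WW: "A (W q) \<bullet> A (A (W q)) = W q \<bullet> A (W q)" by (simp add: AA inner_commute)
      have Efin: "\<bar>E\<bar> \<le> C * (norm (W q) + a * \<bar>w q\<bar>)"
      proof -
        let ?e = "exp (a * F q)"
        have "?e *\<^sub>R Dz q = W q - (a * w q) *\<^sub>R DF q" by (simp add: W_def w_def algebra_simps)
        then have "?e * norm (Dz q) = norm (W q - (a * w q) *\<^sub>R DF q)" by (metis abs_exp_cancel norm_scaleR)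
        also have "\<dots> \<le> norm (W q) + norm ((a * w q) *\<^sub>R DF q)" by (rule norm_triangle_ineq4)
        also have "norm ((a * w q) *\<^sub>R DF q) \<le> a * \<bar>w q\<bar> * C1"
          using C1(2)[OF q(2)] a1 by (simp add: abs_mult mult_left_mono)
        finally have 1: "?e * norm (Dz q) \<le> norm (W q) + a * \<bar>w q\<bar> * C1" by simp
        have 2: "?e * \<bar>z q\<bar> \<le> a * \<bar>w q\<bar>"
          using a1 mult_right_mono[of 1 a "\<bar>w q\<bar>"] by (simp add: w_def abs_mult)
        have "\<bar>E\<bar> \<le> ?e * (\<bar>B\<bar> * (norm (Dz q) + \<bar>z q\<bar>))"
          unfolding E_def abs_mult using eqn[OF q(1)]
          by (auto intro!: mult_left_mono elim!: order_trans simp: mult_right_mono)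
        also have "\<dots> = \<bar>B\<bar> * (?e * norm (Dz q) + ?e * \<bar>z q\<bar>)" by (simp add: algebra_simps)
        also have "\<dots> \<le> \<bar>B\<bar> * (norm (W q) + a * \<bar>w q\<bar> * C1 + a * \<bar>w q\<bar>)"
          using 1 2 by (intro mult_left_mono add_mono) auto
        also have "\<dots> = \<bar>B\<bar> * norm (W q) + (\<bar>B\<bar> * (C1 + 1)) * (a * \<bar>w q\<bar>)" by (simp add: algebra_simps)
        also have "\<dots> \<le> C * norm (W q) + C * (a * \<bar>w q\<bar>)"
          using C a1 by (intro add_mono mult_right_mono) auto
        finally show ?thesis by (simp add: algebra_simps)
      qed
      have lfin: "\<bar>g' q (A (W q))\<bar> \<le> C * norm (W q)"
        using C4(2)[OF q(2), of "A (W q)"] mult_right_mono[OF C(4) norm_ge_zero[of "W q"]] by (simp add: normA)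
      have gfin: "\<bar>g q\<bar> \<le> C" "\<bar>shift q\<bar> \<le> C"
        using C2(2)[OF q(2)] C3(2)[OF q(2)] C by auto
      have Qfin: "Q \<ge> c0 * (norm (W q))\<^sup>2 - M * d\<^sup>2"
        using c0(3)[OF q(2), of "A (W q)"] by (simp add: Q_def d_def normA)
      have "c1 / 2 * a\<^sup>2 * (w q)\<^sup>2 \<le> N * E + a * N\<^sup>2 + a * shift q * w q * N + Q + w q * g' q (A (W q)) + c1 * a\<^sup>2 * (w q)\<^sup>2"
        by (rule a0(2)[OF a gfin(2,1) lfin norm_ge_zero N_def Efin Qfin])
      also have "c1 * a\<^sup>2 * (w q)\<^sup>2 \<le> (2 * (F2 q (A (DF q)) \<bullet> A (DF q)) + (DF q \<bullet> A (DF q)) * shift q) * a\<^sup>2 * (w q)\<^sup>2"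
        using c1(2)[OF q(2)] by (intro mult_right_mono) auto
      also have "N * E + a * N\<^sup>2 + a * shift q * w q * N + Q + w q * g' q (A (W q))
          + (2 * (F2 q (A (DF q)) \<bullet> A (DF q)) + (DF q \<bullet> A (DF q)) * shift q) * a\<^sup>2 * (w q)\<^sup>2 = op_trace (J' q)"
        unfolding J'(2)[OF q(1)] H(3)[OF q(1)] Q_def WW d_def[symmetric] N_def E_def[symmetric] shift_def
        by (simp add: algebra_simps power2_eq_square)
      finally show ?thesis by simp
    qed
    then show "\<exists>J'. C1_deriv S (\<lambda>q. current a (exp (a * F q) * z q)
              (exp (a * F q) *\<^sub>R (Dz q + (a * z q) *\<^sub>R DF q)) q) J' \<and>
        (\<forall>q\<in>S \<inter> K. op_trace (J' q) \<ge> c1 / 2 * a\<^sup>2 * (exp (a * F q) * z q)\<^sup>2)"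
      using J'(1) unfolding w_def W_def by blast
  qed
qed

end

section \<open>The weight on the exterior of the cone\<close>

text \<open>The metric \<open>- dt\<^sup>2 + dx\<^sup>2\<close> as a Euclidean operator; being its
  own inverse, it both raises and lowers indices.\<close>

definition time_reflection :: "(real^'m) \<times> (real^'n) \<Rightarrow> (real^'m) \<times> (real^'n)" where
  "time_reflection v = (- fst v, snd v)"

definition grad_r :: "(real^'m) \<times> (real^'n) \<Rightarrow> (real^'m) \<times> (real^'n) \<Rightarrow> (real^'m) \<times> (real^'n)" where
  "grad_r p q = (0, sgn (snd q - snd p))"

definition lapse :: "real \<Rightarrow> (real^'m) \<times> (real^'n) \<Rightarrow> (real^'m) \<times> (real^'n) \<Rightarrow> real" where
  "lapse \<epsilon> p q = 1 - \<epsilon> * r_fun p q"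

definition weight :: "real \<Rightarrow> (real^'m) \<times> (real^'n) \<Rightarrow> (real^'m) \<times> (real^'n) \<Rightarrow> real" where
  "weight \<epsilon> p q = f_fun p q / lapse \<epsilon> p q"

text \<open>The relation \<open>lapse * weight = f_fun\<close> differentiated once and solved for
  the gradient; the gradient is Euclidean, with no index raised.\<close>

definition grad_weight ::
    "real \<Rightarrow> (real^'m) \<times> (real^'n) \<Rightarrow> (real^'m) \<times> (real^'n) \<Rightarrow> (real^'m) \<times> (real^'n)" where
  "grad_weight \<epsilon> p q = (1 / lapse \<epsilon> p q) *\<^sub>R
     ((1/2) *\<^sub>R time_reflection (q - p) + (\<epsilon> * weight \<epsilon> p q) *\<^sub>R grad_r p q)"

text \<open>\<open>1 / r\<close> times the projection onto the directions tangent to the spatial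
  sphere of radius \<open>r\<close>, that is, the shape operator of the spheres.\<close>

definition hess_r ::
    "(real^'m) \<times> (real^'n) \<Rightarrow> (real^'m) \<times> (real^'n) \<Rightarrow> (real^'m) \<times> (real^'n) \<Rightarrow> (real^'m) \<times> (real^'n)" where
  "hess_r p q v = (1 / r_fun p q) *\<^sub>R ((0, snd v) - (grad_r p q \<bullet> v) *\<^sub>R grad_r p q)"

text \<open>The relation \<open>lapse * weight = f_fun\<close> differentiated twice. In the
  quadratic form the two mixed terms, with both \<open>grad_r\<close> and
  \<open>grad_weight\<close>, drop out on vectors tangent to a level set of the weight.\<close>

definition hess_weight ::
    "real \<Rightarrow> (real^'m) \<times> (real^'n) \<Rightarrow> (real^'m) \<times> (real^'n) \<Rightarrow> (real^'m) \<times> (real^'n) \<Rightarrow> (real^'m) \<times> (real^'n)" where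
  "hess_weight \<epsilon> p q v = (1 / lapse \<epsilon> p q) *\<^sub>R
     ((1/2) *\<^sub>R time_reflection v + (\<epsilon> * (grad_weight \<epsilon> p q \<bullet> v)) *\<^sub>R grad_r p q
       + (\<epsilon> * weight \<epsilon> p q) *\<^sub>R hess_r p q v + (\<epsilon> * (grad_r p q \<bullet> v)) *\<^sub>R grad_weight \<epsilon> p q)"

definition weight_region :: "real \<Rightarrow> (real^'m) \<times> (real^'n) \<Rightarrow> ((real^'m) \<times> (real^'n)) set" where
  "weight_region \<epsilon> p = {q. f_fun p q > 0 \<and> lapse \<epsilon> p q > 0}"

text \<open>
  The zeroth-order part of the multiplier, chosen so that the shift of the Carleman current is
  \<open>(1 + 2\<kappa>) / lapse\<close>.
\<close>

definition multiplier ::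
    "real \<Rightarrow> real \<Rightarrow> (real^'m) \<times> (real^'n) \<Rightarrow> (real^'m) \<times> (real^'n) \<Rightarrow> real" where
  "multiplier \<kappa> \<epsilon> p q = (1 / lapse \<epsilon> p q) *
     ((1/2) * op_trace (\<lambda>v::(real^'m) \<times> (real^'n). v) + 2 * \<epsilon> * (grad_weight \<epsilon> p q \<bullet> grad_r p q)
       + \<epsilon> * weight \<epsilon> p q * (1 / r_fun p q) * (op_trace (\<lambda>v::(real^'m) \<times> (real^'n). (0, snd v)) - 1)
       - (1 + 2 * \<kappa>))"

section \<open>Regularity of the weight and of the multiplier\<close>

lemma bounded_linear_time_reflection: "bounded_linear time_reflection"
  unfolding time_reflection_def
  by (intro bounded_linear_Pair bounded_linear_minus bounded_linear_fst bounded_linear_snd)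

lemma r_fun_pos: "f_fun p q > 0 \<Longrightarrow> norm (fst q - fst p) < r_fun p q"
  unfolding f_fun_def r_fun_def by (auto intro: power2_less_imp_less)

lemma r_fun_pos': "f_fun p q > 0 \<Longrightarrow> r_fun p q > 0"
  using r_fun_pos[of p q] norm_ge_zero[of "fst q - fst p"] by linarith

lemma C1_r: "C1_deriv {q. r_fun p q > 0} (r_fun p) (\<lambda>q v. grad_r p q \<bullet> v)"
proof (rule C1_deriv_gradient)
  fix q assume "q \<in> {q. r_fun p q > 0}"
  then have "snd q - snd p \<noteq> 0" by (auto simp: r_fun_def)
  then have "((\<lambda>q. norm (snd q - snd p)) has_derivative (\<lambda>v. snd v \<bullet> sgn (snd q - snd p))) (at q)"
    by (intro has_derivative_compose[OF _ has_derivative_norm, where f="\<lambda>q. snd q - snd p"])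
      (auto intro!: derivative_eq_intros)
  then show "(r_fun p has_derivative (\<lambda>v. grad_r p q \<bullet> v)) (at q)"
    by (simp add: r_fun_def[abs_def] grad_r_def inner_prod_def inner_commute)
next
  show "continuous_on {q. r_fun p q > 0} (grad_r p)"
    unfolding grad_r_def sgn_div_norm
    by (intro continuous_intros) (auto simp: r_fun_def)
qed

lemma C1_inverse_r:
  "C1_deriv {q. r_fun p q > 0} (\<lambda>q. 1 / r_fun p q) (\<lambda>q v. - (1 / (r_fun p q)\<^sup>2) * (grad_r p q \<bullet> v))"
  by (rule C1_deriv_compose_real[where g="\<lambda>x. 1 / x" and g'="\<lambda>x. - (1 / x\<^sup>2)" and T="{0<..}", OF C1_r])
     (auto intro!: derivative_eq_intros continuous_intros simp: power2_eq_square)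

lemma C1_grad_r:
  fixes p :: "(real^'m) \<times> (real^'n)"
  shows "C1_deriv {q. r_fun p q > 0} (grad_r p) (hess_r p)"
proof -
  have lin: "bounded_linear (\<lambda>v::(real^'m) \<times> (real^'n). (0::real^'m, snd v))"
    by (intro bounded_linear_Pair bounded_linear_zero bounded_linear_snd)
  note X = C1_deriv_diff[OF C1_deriv_linear[OF lin] C1_deriv_const[of _ "(0, snd p)"]]
  have "C1_deriv {q. r_fun p q > 0} (\<lambda>q. (1 / r_fun p q) *\<^sub>R ((0::real^'m, snd q) - (0, snd p)))
    (\<lambda>q v. (1 / r_fun p q) *\<^sub>R ((0::real^'m, snd v) - 0) + (- (1 / (r_fun p q)\<^sup>2) * (grad_r p q \<bullet> v)) *\<^sub>R ((0::real^'m, snd q) - (0, snd p)))"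
    by (rule C1_deriv_scaleR[OF C1_inverse_r X])
  moreover have "(\<lambda>q. (1 / r_fun p q) *\<^sub>R ((0::real^'m, snd q) - (0, snd p))) = grad_r p"
    by (rule ext) (simp add: grad_r_def sgn_div_norm r_fun_def divide_inverse)
  ultimately have "C1_deriv {q. r_fun p q > 0} (grad_r p)
    (\<lambda>q v. (1 / r_fun p q) *\<^sub>R ((0::real^'m, snd v) - 0) + (- (1 / (r_fun p q)\<^sup>2) * (grad_r p q \<bullet> v)) *\<^sub>R ((0::real^'m, snd q) - (0, snd p)))"
    by simp
  then show ?thesis
  proof (rule C1_deriv_cong)
    fix q v :: "(real^'m) \<times> (real^'n)"
    have "(0::real^'m, snd q) - (0, snd p) = r_fun p q *\<^sub>R grad_r p q"
      by (cases "snd q = snd p") (auto simp: grad_r_def sgn_div_norm r_fun_def zero_prod_def)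
    then show "(1 / r_fun p q) *\<^sub>R ((0::real^'m, snd v) - 0) + (- (1 / (r_fun p q)\<^sup>2) * (grad_r p q \<bullet> v)) *\<^sub>R ((0::real^'m, snd q) - (0, snd p))
        = hess_r p q v"
      by (simp add: hess_r_def power2_eq_square scaleR_diff_right)
  qed
qed

lemma C1_f: "C1_deriv S (f_fun p) (\<lambda>q v. ((1/2) *\<^sub>R time_reflection (q - p)) \<bullet> v)"
proof (rule C1_deriv_gradient)
  fix q
  have "((\<lambda>q. (1/4) * ((snd q - snd p) \<bullet> (snd q - snd p) - (fst q - fst p) \<bullet> (fst q - fst p)))
      has_derivative (\<lambda>v. ((1/2) *\<^sub>R time_reflection (q - p)) \<bullet> v)) (at q)"
    by (auto intro!: derivative_eq_intros simp: time_reflection_def inner_prod_def inner_commute algebra_simps)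
  then show "(f_fun p has_derivative (\<lambda>v. ((1/2) *\<^sub>R time_reflection (q - p)) \<bullet> v)) (at q)"
    by (simp add: f_fun_def[abs_def] power2_norm_eq_inner)
next
  show "continuous_on S (\<lambda>q. (1/2) *\<^sub>R time_reflection (q - p))"
    by (intro continuous_intros bounded_linear.continuous_on[OF bounded_linear_time_reflection])
qed

lemma weight_region_subset:
  fixes p :: "(real^'m) \<times> (real^'n)"
  shows "weight_region \<epsilon> p \<subseteq> {q. r_fun p q > 0}"
proof
  fix q assume "q \<in> weight_region \<epsilon> p"
  then show "q \<in> {q. r_fun p q > 0}" using r_fun_pos'[of p q] by (simp add: weight_region_def)
qed

lemma continuous_on_r: "continuous_on S (r_fun p)"
  unfolding r_fun_def by (intro continuous_intros)

lemma continuous_on_f: "continuous_on S (f_fun p)"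
  unfolding f_fun_def by (intro continuous_intros)

lemma open_weight_region: "open (weight_region \<epsilon> p)"
  unfolding weight_region_def lapse_def
  by (intro open_Collect_conj open_Collect_less continuous_intros continuous_on_r continuous_on_f)

lemma C1_inverse_lapse:
  fixes p :: "(real^'m) \<times> (real^'n)"
  shows "C1_deriv (weight_region \<epsilon> p) (\<lambda>q. 1 / lapse \<epsilon> p q) (\<lambda>q v. \<epsilon> * (1 / lapse \<epsilon> p q)\<^sup>2 * (grad_r p q \<bullet> v))"
proof -
  have "C1_deriv (weight_region \<epsilon> p) (\<lambda>q. (\<lambda>x. 1 / (1 - \<epsilon> * x)) (r_fun p q))
      (\<lambda>q v. (\<lambda>x. \<epsilon> * (1 / (1 - \<epsilon> * x))\<^sup>2) (r_fun p q) * (grad_r p q \<bullet> v))"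
    by (rule C1_deriv_compose_real[where T="{x. 1 - \<epsilon> * x > 0}", OF C1_deriv_subset[OF C1_r weight_region_subset]])
      (auto intro!: derivative_eq_intros continuous_intros simp: power2_eq_square weight_region_def lapse_def)
  then show ?thesis by (simp add: lapse_def)
qed

lemma C1_weight:
  fixes p :: "(real^'m) \<times> (real^'n)"
  shows "C1_deriv (weight_region \<epsilon> p) (weight \<epsilon> p) (\<lambda>q v. grad_weight \<epsilon> p q \<bullet> v)"
proof -
  have "C1_deriv (weight_region \<epsilon> p) (\<lambda>q. f_fun p q * (1 / lapse \<epsilon> p q))
     (\<lambda>q v. f_fun p q * (\<epsilon> * (1 / lapse \<epsilon> p q)\<^sup>2 * (grad_r p q \<bullet> v))
       + (((1/2) *\<^sub>R time_reflection (q - p)) \<bullet> v) * (1 / lapse \<epsilon> p q))"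
    by (rule C1_deriv_mult[OF C1_f C1_inverse_lapse])
  moreover have "(\<lambda>q. f_fun p q * (1 / lapse \<epsilon> p q)) = weight \<epsilon> p"
    by (rule ext) (simp add: weight_def)
  ultimately have "C1_deriv (weight_region \<epsilon> p) (weight \<epsilon> p)
     (\<lambda>q v. f_fun p q * (\<epsilon> * (1 / lapse \<epsilon> p q)\<^sup>2 * (grad_r p q \<bullet> v))
       + (((1/2) *\<^sub>R time_reflection (q - p)) \<bullet> v) * (1 / lapse \<epsilon> p q))" by simp
  then show ?thesis
    by (rule C1_deriv_cong)
       (simp add: grad_weight_def weight_def inner_add_left power2_eq_square algebra_simps add_divide_distrib)
qed

lemma C1_grad_weight:
  fixes p :: "(real^'m) \<times> (real^'n)"
  shows "C1_deriv (weight_region \<epsilon> p) (grad_weight \<epsilon> p) (hess_weight \<epsilon> p)"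
proof -
  note r = C1_deriv_subset[OF C1_grad_r weight_region_subset[of \<epsilon> p]]
  have refl: "C1_deriv S (\<lambda>q. (1/2) *\<^sub>R time_reflection (q - p)) (\<lambda>q v. (1/2) *\<^sub>R time_reflection (v - 0))" for S
  proof -
    have "C1_deriv S (\<lambda>q. q - p) (\<lambda>q v. v - 0)"
      by (rule C1_deriv_diff[OF C1_deriv_linear[OF bounded_linear_ident] C1_deriv_const])
    from C1_deriv_compose_linear[OF this
        bounded_linear_compose[OF bounded_linear_scaleR_right bounded_linear_time_reflection]]
    show ?thesis .
  qed
  have ew: "C1_deriv (weight_region \<epsilon> p) (\<lambda>q. \<epsilon> * weight \<epsilon> p q) (\<lambda>q v. \<epsilon> * (grad_weight \<epsilon> p q \<bullet> v))"
    by (rule C1_deriv_compose_linear[OF C1_weight bounded_linear_mult_right])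
  note C = C1_deriv_scaleR[OF C1_inverse_lapse C1_deriv_add[OF refl C1_deriv_scaleR[OF ew r]]]
  have "C1_deriv (weight_region \<epsilon> p) (grad_weight \<epsilon> p)
    (\<lambda>q v. (1 / lapse \<epsilon> p q) *\<^sub>R ((1/2) *\<^sub>R time_reflection (v - 0) + ((\<epsilon> * weight \<epsilon> p q) *\<^sub>R hess_r p q v + (\<epsilon> * (grad_weight \<epsilon> p q \<bullet> v)) *\<^sub>R grad_r p q))
       + (\<epsilon> * (1 / lapse \<epsilon> p q)\<^sup>2 * (grad_r p q \<bullet> v)) *\<^sub>R ((1/2) *\<^sub>R time_reflection (q - p) + (\<epsilon> * weight \<epsilon> p q) *\<^sub>R grad_r p q))"
    unfolding grad_weight_def[abs_def] by (rule C[unfolded grad_weight_def[abs_def]])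
  then show ?thesis
  proof (rule C1_deriv_cong)
    fix q v :: "(real^'m) \<times> (real^'n)"
    have "(\<epsilon> * (1 / lapse \<epsilon> p q)\<^sup>2 * (grad_r p q \<bullet> v)) *\<^sub>R ((1/2) *\<^sub>R time_reflection (q - p) + (\<epsilon> * weight \<epsilon> p q) *\<^sub>R grad_r p q)
      = (1 / lapse \<epsilon> p q) *\<^sub>R (\<epsilon> * (grad_r p q \<bullet> v)) *\<^sub>R grad_weight \<epsilon> p q"
      unfolding grad_weight_def by (simp add: power2_eq_square)
    then show "(1 / lapse \<epsilon> p q) *\<^sub>R ((1/2) *\<^sub>R time_reflection (v - 0) + ((\<epsilon> * weight \<epsilon> p q) *\<^sub>R hess_r p q v + (\<epsilon> * (grad_weight \<epsilon> p q \<bullet> v)) *\<^sub>R grad_r p q))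
       + (\<epsilon> * (1 / lapse \<epsilon> p q)\<^sup>2 * (grad_r p q \<bullet> v)) *\<^sub>R ((1/2) *\<^sub>R time_reflection (q - p) + (\<epsilon> * weight \<epsilon> p q) *\<^sub>R grad_r p q)
       = hess_weight \<epsilon> p q v"
      unfolding hess_weight_def by (simp only: scaleR_add_right diff_0_right ac_simps)
  qed
qed

lemma C1_multiplier:
  fixes p :: "(real^'m) \<times> (real^'n)"
  shows "\<exists>g'. C1_deriv (weight_region \<epsilon> p) (multiplier \<kappa> \<epsilon> p) g'"
proof -
  note r = C1_deriv_subset[OF C1_grad_r weight_region_subset[of \<epsilon> p]]
    and ir = C1_deriv_subset[OF C1_inverse_r weight_region_subset[of \<epsilon> p]]
  show ?thesis
    unfolding multiplier_def[abs_def]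
    by (rule exI, rule C1_deriv_mult[OF C1_inverse_lapse C1_deriv_diff[OF C1_deriv_add[OF C1_deriv_add[OF C1_deriv_const
          C1_deriv_mult[OF C1_deriv_const C1_deriv_inner[OF C1_grad_weight r]]]
          C1_deriv_mult[OF C1_deriv_mult[OF C1_deriv_mult[OF C1_deriv_const C1_weight] ir] C1_deriv_const]] C1_deriv_const]])
qed

lemma carleman_weight_cone:
  fixes p :: "(real^'m) \<times> (real^'n)"
  shows "\<exists>g'. carleman_weight time_reflection (weight_region \<epsilon> p) (weight \<epsilon> p) (grad_weight \<epsilon> p) (hess_weight \<epsilon> p)
     (multiplier \<kappa> \<epsilon> p) g'"
proof -
  obtain g' where "C1_deriv (weight_region \<epsilon> p) (multiplier \<kappa> \<epsilon> p) g'" using C1_multiplier by blast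
  then have "carleman_weight time_reflection (weight_region \<epsilon> p) (weight \<epsilon> p) (grad_weight \<epsilon> p) (hess_weight \<epsilon> p)
     (multiplier \<kappa> \<epsilon> p) g'"
    by (intro carleman_weight.intro bounded_linear.linear[OF bounded_linear_time_reflection]
        open_weight_region C1_derivD(1)[OF C1_weight] C1_grad_weight)
       (auto simp: time_reflection_def inner_prod_def)
  then show ?thesis by blast
qed

section \<open>Pseudoconvexity of the weight in the exterior of the cone\<close>

lemma norm_grad_r: "r_fun p q > 0 \<Longrightarrow> grad_r p q \<bullet> grad_r p q = 1"
  by (simp add: grad_r_def inner_prod_def r_fun_def norm_sgn dot_square_norm)

text \<open>Raising an index undoes the reflection in the first term of \<open>hess_weight\<close>,
  which leaves half the dimension; \<open>hess_r\<close> contributes the dimension of the spheres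
  divided by \<open>r\<close>, and the two mixed terms contribute equally. \<open>multiplier\<close>
  is this trace minus the intended shift.\<close>

lemma cone_shift:
  fixes p :: "(real^'m) \<times> (real^'n)"
  assumes w: "carleman_weight time_reflection (weight_region \<epsilon> p) (weight \<epsilon> p) (grad_weight \<epsilon> p) (hess_weight \<epsilon> p)
     (multiplier \<kappa> \<epsilon> p) g'" and q: "q \<in> weight_region \<epsilon> p"
  shows "carleman_weight.shift time_reflection (hess_weight \<epsilon> p) (multiplier \<kappa> \<epsilon> p) q = (1 + 2 * \<kappa>) / lapse \<epsilon> p q"
proof -
  interpret carleman_weight time_reflection "weight_region \<epsilon> p" "weight \<epsilon> p" "grad_weight \<epsilon> p" "hess_weight \<epsilon> p"
     "multiplier \<kappa> \<epsilon> p" g' by (rule w)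
  have r: "r_fun p q > 0" using q weight_region_subset by blast
  have tr: "time_reflection (grad_r p q) = grad_r p q" by (simp add: time_reflection_def grad_r_def)
  have lin: "linear (\<lambda>v. c * (x \<bullet> v))" for c and x :: "(real^'m) \<times> (real^'n)"
    by (intro linearI) (auto simp: inner_add_right algebra_simps)
  have r1: "op_trace (\<lambda>v. (c * (x \<bullet> v)) *\<^sub>R u) = c * (x \<bullet> u)" for c and x u :: "(real^'m) \<times> (real^'n)"
    by (rule op_trace_rank_one[OF lin])
  have r2: "op_trace (\<lambda>v. (x \<bullet> v) *\<^sub>R u) = (x \<bullet> u)" for x u :: "(real^'m) \<times> (real^'n)"
    using r1[of 1 x u] by simp
  have A0: "time_reflection (0, x) = (0, x)" for x :: "real^'n" by (simp add: time_reflection_def)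
  have "grad_r p q \<bullet> time_reflection (grad_weight \<epsilon> p q) = grad_weight \<epsilon> p q \<bullet> grad_r p q"
    by (metis adj inner_commute tr)
  then have "box (hess_weight \<epsilon> p q) = (1 / lapse \<epsilon> p q) *
     ((1/2) * op_trace (\<lambda>v::(real^'m) \<times> (real^'n). v) + \<epsilon> * (grad_weight \<epsilon> p q \<bullet> grad_r p q)
       + \<epsilon> * weight \<epsilon> p q * ((1 / r_fun p q) * (op_trace (\<lambda>v::(real^'m) \<times> (real^'n). (0, snd v)) - 1))
       + \<epsilon> * (grad_weight \<epsilon> p q \<bullet> grad_r p q))"
    unfolding box_def hess_weight_def hess_r_def
    by (simp add: linear_add[OF linA] linear_diff[OF linA] linear_cmul[OF linA] AA tr A0
        op_trace_add op_trace_diff op_trace_scaleR r1 r2 norm_grad_r[OF r])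
  then show ?thesis
    unfolding shift_def multiplier_def by (simp add: diff_divide_distrib add_divide_distrib algebra_simps)
qed

lemma hess_weight_form:
  assumes "q \<in> weight_region \<epsilon> p"
  shows "hess_weight \<epsilon> p q v \<bullet> v = (1 / lapse \<epsilon> p q) *
     ((1/2) * (v \<bullet> time_reflection v) + 2 * \<epsilon> * (grad_weight \<epsilon> p q \<bullet> v) * (grad_r p q \<bullet> v)
       + \<epsilon> * weight \<epsilon> p q / r_fun p q * ((norm (snd v))\<^sup>2 - (grad_r p q \<bullet> v)\<^sup>2))"
proof -
  have "(0, snd v) \<bullet> v = (norm (snd v))\<^sup>2" by (simp add: inner_prod_def power2_norm_eq_inner)
  moreover have "time_reflection v \<bullet> v = v \<bullet> time_reflection v" by (rule inner_commute)
  ultimately show ?thesis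
    unfolding hess_weight_def hess_r_def
    by (simp only: inner_add_left inner_diff_left inner_scaleR_left) (simp add: power2_eq_square algebra_simps)
qed

lemma time_reflection_form: "v \<bullet> time_reflection v = (norm (snd v))\<^sup>2 - (norm (fst v))\<^sup>2"
  by (simp add: time_reflection_def inner_prod_def power2_norm_eq_inner)

lemma grad_weight_inner:
  assumes "q \<in> weight_region \<epsilon> p"
  shows "lapse \<epsilon> p q * (grad_weight \<epsilon> p q \<bullet> v)
    = (r_fun p q / 2 + \<epsilon> * weight \<epsilon> p q) * (grad_r p q \<bullet> v) - (fst q - fst p) \<bullet> fst v / 2"
proof -
  have r: "r_fun p q > 0" and h: "lapse \<epsilon> p q > 0"
    using assms weight_region_subset[of \<epsilon> p] by (auto simp: weight_region_def)
  have "snd q - snd p = r_fun p q *\<^sub>R sgn (snd q - snd p)"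
    using r by (simp add: r_fun_def sgn_div_norm)
  then have "(snd q - snd p) \<bullet> snd v = r_fun p q * (sgn (snd q - snd p) \<bullet> snd v)"
    by (metis inner_scaleR_left)
  then show ?thesis
    using h by (simp add: grad_weight_def grad_r_def time_reflection_def inner_prod_def inner_add_left algebra_simps
        inner_diff_left add_divide_distrib diff_divide_distrib)
qed

text \<open>
  The level sets of the weight are pseudoconvex: a null vector tangent to one of them cannot be
  radial in space, so it sees the curvature of the spheres \<open>r = const\<close>.
\<close>

lemma cone_form_positive:
  assumes q: "q \<in> weight_region \<epsilon> p" and \<epsilon>: "\<epsilon> > 0"
    and \<kappa>: "\<kappa> > 0" "\<kappa> < \<epsilon> * weight \<epsilon> p q / r_fun p q"
    and \<xi>: "\<xi> \<noteq> 0" "grad_weight \<epsilon> p q \<bullet> \<xi> = 0"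
  shows "2 * (hess_weight \<epsilon> p q \<xi> \<bullet> \<xi>) - (1 + 2 * \<kappa>) / lapse \<epsilon> p q * (\<xi> \<bullet> time_reflection \<xi>) > 0"
proof -
  define s where "s = grad_r p q \<bullet> \<xi>"
  define h where "h = lapse \<epsilon> p q"
  define k where "k = \<epsilon> * weight \<epsilon> p q / r_fun p q"
  have h: "h > 0" and f: "f_fun p q > 0" using q by (auto simp: weight_region_def h_def)
  have r: "r_fun p q > 0" "norm (fst q - fst p) < r_fun p q" using r_fun_pos[OF f] r_fun_pos'[OF f] by auto
  have w: "weight \<epsilon> p q > 0" using f h by (simp add: weight_def h_def)
  have sle: "s\<^sup>2 \<le> (norm (snd \<xi>))\<^sup>2"
  proof -
    have "\<bar>s\<bar> = \<bar>sgn (snd q - snd p) \<bullet> snd \<xi>\<bar>" by (simp add: s_def grad_r_def inner_prod_def)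
    also have "\<dots> \<le> norm (sgn (snd q - snd p)) * norm (snd \<xi>)" by (rule Cauchy_Schwarz_ineq2)
    also have "\<dots> \<le> norm (snd \<xi>)" by (simp add: norm_sgn)
    finally show ?thesis by (metis abs_le_square_iff abs_norm_cancel)
  qed
  have tang: "(r_fun p q / 2 + \<epsilon> * weight \<epsilon> p q) * s = (fst q - fst p) \<bullet> fst \<xi> / 2"
    using grad_weight_inner[OF q, of \<xi>] \<xi>(2) by (simp add: s_def)
  \<comment> \<open>Tangency compares the radial component \<open>s\<close> with the time component.
    As \<open>norm (fst q - fst p) < r_fun p q\<close> in the exterior, \<open>s\<close> is strictly
    shorter than \<open>fst \<xi>\<close> unless \<open>fst \<xi>\<close> vanishes.\<close>
  have "r_fun p q * \<bar>s\<bar> \<le> norm (fst q - fst p) * norm (fst \<xi>)"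
  proof -
    have "r_fun p q * \<bar>s\<bar> \<le> (r_fun p q + 2 * (\<epsilon> * weight \<epsilon> p q)) * \<bar>s\<bar>"
      using \<epsilon> w by (intro mult_right_mono) auto
    also have "\<dots> = \<bar>2 * ((r_fun p q / 2 + \<epsilon> * weight \<epsilon> p q) * s)\<bar>"
      using r \<epsilon> w by (simp add: abs_mult)
    also have "\<dots> = \<bar>(fst q - fst p) \<bullet> fst \<xi>\<bar>" by (simp add: tang)
    also have "\<dots> \<le> norm (fst q - fst p) * norm (fst \<xi>)" by (rule Cauchy_Schwarz_ineq2)
    finally show ?thesis .
  qed
  note sb = this
  \<comment> \<open>The reflection term of the Hessian cancels against the 1 in
    \<open>1 + 2 * \<kappa>\<close>. What remains of the metric, with factor
    \<open>- \<kappa>\<close>, is regrouped with the sphere term so that both brackets are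
    differences from \<open>s\<^sup>2\<close>.\<close>
  have "2 * (hess_weight \<epsilon> p q \<xi> \<bullet> \<xi>) - (1 + 2 * \<kappa>) / lapse \<epsilon> p q * (\<xi> \<bullet> time_reflection \<xi>)
    = (2 / h) * (\<kappa> * ((norm (fst \<xi>))\<^sup>2 - s\<^sup>2) + (k - \<kappa>) * ((norm (snd \<xi>))\<^sup>2 - s\<^sup>2))"
    unfolding hess_weight_form[OF q] \<xi>(2) time_reflection_form s_def[symmetric] h_def[symmetric] k_def[symmetric]
    using h by (simp add: field_simps)
  moreover have "\<kappa> * ((norm (fst \<xi>))\<^sup>2 - s\<^sup>2) + (k - \<kappa>) * ((norm (snd \<xi>))\<^sup>2 - s\<^sup>2) > 0"
  proof (cases "fst \<xi> = 0")
    case True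
    then have "s = 0" using sb r by (simp add: mult_le_0_iff)
    moreover have "snd \<xi> \<noteq> 0" using True \<xi>(1) by (simp add: prod_eq_iff)
    ultimately show ?thesis using True \<kappa> by (simp add: k_def)
  next
    case False
    then have "norm (fst q - fst p) * norm (fst \<xi>) < r_fun p q * norm (fst \<xi>)"
      using r by (intro mult_strict_right_mono) auto
    then have "\<bar>s\<bar> < norm (fst \<xi>)" using sb r by (metis le_less_trans mult_less_cancel_left_pos)
    then have "s\<^sup>2 < (norm (fst \<xi>))\<^sup>2" by (metis abs_ge_zero power2_abs power_strict_mono pos2)
    then have "\<kappa> * ((norm (fst \<xi>))\<^sup>2 - s\<^sup>2) > 0" using \<kappa> by simp
    moreover have "(k - \<kappa>) * ((norm (snd \<xi>))\<^sup>2 - s\<^sup>2) \<ge> 0" using sle \<kappa> by (simp add: k_def)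
    ultimately show ?thesis by linarith
  qed
  ultimately show ?thesis using h by simp
qed

text \<open>The gradient of the weight is spacelike in the exterior: its spatial part is radial of
  length \<open>k\<close>, and its time part is shorter. For a radial direction the sphere term of
  the Hessian vanishes, and everything else is a positive multiple of the metric square
  \<open>Q\<close>.\<close>

lemma cone_zeroth_positive:
  assumes q: "q \<in> weight_region \<epsilon> p" and \<epsilon>: "\<epsilon> > 0" and \<kappa>: "\<kappa> > 0"
  shows "2 * (hess_weight \<epsilon> p q (time_reflection (grad_weight \<epsilon> p q)) \<bullet> time_reflection (grad_weight \<epsilon> p q))
    + (grad_weight \<epsilon> p q \<bullet> time_reflection (grad_weight \<epsilon> p q)) * ((1 + 2 * \<kappa>) / lapse \<epsilon> p q) > 0"
proof -
  define u where "u = time_reflection (grad_weight \<epsilon> p q)"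
  define h where "h = lapse \<epsilon> p q"
  define k where "k = (r_fun p q / 2 + \<epsilon> * weight \<epsilon> p q) / h"
  define Q where "Q = grad_weight \<epsilon> p q \<bullet> u"
  have h: "h > 0" and f: "f_fun p q > 0" using q by (auto simp: weight_region_def h_def)
  have r: "r_fun p q > 0" "norm (fst q - fst p) < r_fun p q" using r_fun_pos[OF f] r_fun_pos'[OF f] by auto
  have w: "weight \<epsilon> p q > 0" using f h by (simp add: weight_def h_def)
  have k: "k > 0" using r \<epsilon> w h by (simp add: k_def add_pos_pos)
  have su: "snd u = k *\<^sub>R sgn (snd q - snd p)"
  proof -
    have "snd q - snd p = r_fun p q *\<^sub>R sgn (snd q - snd p)"
      using r by (simp add: r_fun_def sgn_div_norm)
    then have "snd u = (1 / h) *\<^sub>R ((1/2) *\<^sub>R (r_fun p q *\<^sub>R sgn (snd q - snd p)) + (\<epsilon> * weight \<epsilon> p q) *\<^sub>R sgn (snd q - snd p))"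
      by (simp add: u_def grad_weight_def time_reflection_def grad_r_def h_def)
    then show ?thesis by (simp add: k_def scaleR_add_left[symmetric] add_divide_distrib)
  qed
  have n1: "norm (sgn (snd q - snd p)) = 1" using r by (auto simp: norm_sgn r_fun_def)
  have gu: "grad_r p q \<bullet> u = k" using n1 by (simp add: grad_r_def inner_prod_def su dot_square_norm)
  have nsu: "norm (snd u) = k" using k n1 by (simp add: su)
  have fu: "norm (fst u) = norm (fst q - fst p) / (2 * h)"
    using h by (simp add: u_def grad_weight_def time_reflection_def grad_r_def h_def norm_minus_commute mult.commute)
  have uu: "u \<bullet> time_reflection u = Q"
    by (simp add: Q_def u_def time_reflection_def inner_prod_def)
  have "Q = k\<^sup>2 - (norm (fst q - fst p) / (2 * h))\<^sup>2"
    unfolding uu[symmetric] time_reflection_form nsu fu ..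
  moreover have "norm (fst q - fst p) / (2 * h) < k"
  proof -
    have "norm (fst q - fst p) < r_fun p q + 2 * (\<epsilon> * weight \<epsilon> p q)"
      using r mult_pos_pos[OF \<epsilon> w] by linarith
    then show ?thesis unfolding k_def using h by (simp add: divide_simps)
  qed
  ultimately have Q: "Q > 0" using h by (simp add: power_strict_mono)
  have "2 * (hess_weight \<epsilon> p q u \<bullet> u) + Q * ((1 + 2 * \<kappa>) / h) = Q / h * (2 + 2 * \<kappa> + 4 * \<epsilon> * k)"
    unfolding hess_weight_form[OF q] uu gu nsu Q_def[symmetric] h_def[symmetric]
    using h by (simp add: field_simps)
  also have "\<dots> > 0" using Q h \<epsilon> k \<kappa> by (intro mult_pos_pos divide_pos_pos add_pos_pos) auto
  finally show ?thesis by (simp add: u_def Q_def h_def)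
qed

section \<open>Smooth boundaries\<close>

lemma gradient_has_derivative:
  assumes "f differentiable (at q)"
  shows "(f has_derivative (\<lambda>v. gradient f q \<bullet> v)) (at q)"
proof -
  have d: "(f has_derivative frechet_derivative f (at q)) (at q)"
    using assms by (simp add: frechet_derivative_works)
  then interpret bounded_linear "frechet_derivative f (at q)"
    by (rule has_derivative_bounded_linear)
  have "frechet_derivative f (at q) v = gradient f q \<bullet> v" for v
  proof -
    have "frechet_derivative f (at q) v = frechet_derivative f (at q) (\<Sum>b\<in>Basis. (v \<bullet> b) *\<^sub>R b)"
      by (simp add: euclidean_representation)
    also have "\<dots> = (\<Sum>b\<in>Basis. (v \<bullet> b) * frechet_derivative f (at q) b)"
      by (simp add: sum scaleR)
    also have "\<dots> = gradient f q \<bullet> v"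
      by (simp add: gradient_def partial_deriv_def inner_sum_left inner_commute[of v] mult.commute)
    finally show ?thesis .
  qed
  then have "frechet_derivative f (at q) = (\<lambda>v. gradient f q \<bullet> v)" by blast
  with d show ?thesis by simp
qed

lemma Ck_on_differentiable:
  assumes "Ck_on k S f" "k \<ge> 1" "q \<in> S"
  shows "f differentiable (at q)"
proof -
  have "iter_partial [] f differentiable (at q)"
    using assms unfolding Ck_on_def by (auto elim!: allE[of _ "[]"])
  then show ?thesis by (simp add: iter_partial_def)
qed

lemma Ck_on_continuous_gradient:
  assumes "Ck_on k S f" "k \<ge> 1"
  shows "continuous_on S (gradient f)"
proof -
  have "continuous_on S (partial_deriv b f)" if "b \<in> Basis" for b
  proof -
    have "set [b] \<subseteq> Basis \<and> length [b] \<le> k" using that assms(2) by simp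
    then have "continuous_on S (iter_partial [b] f)" using assms(1) unfolding Ck_on_def by blast
    then show ?thesis by (simp add: iter_partial_def)
  qed
  then show ?thesis unfolding gradient_def by (intro continuous_on_sum continuous_on_scaleR continuous_on_const)
qed

lemma Ck_on_C1_deriv:
  assumes "Ck_on k S f" "k \<ge> 1"
  shows "C1_deriv S f (\<lambda>q v. gradient f q \<bullet> v)"
  by (intro C1_deriv_gradient gradient_has_derivative Ck_on_differentiable[OF assms] Ck_on_continuous_gradient[OF assms])

lemma Ck_on_partial_deriv:
  assumes "Ck_on (Suc k) S f" "b \<in> Basis"
  shows "Ck_on k S (partial_deriv b f)"
  unfolding Ck_on_def
proof (intro conjI allI impI ballI)
  have it: "iter_partial bs (partial_deriv b f) = iter_partial (bs @ [b]) f" for bs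
    by (simp add: iter_partial_def)
  show "iter_partial bs (partial_deriv b f) differentiable (at q)"
    if "set bs \<subseteq> Basis \<and> length bs < k" "q \<in> S" for bs q
  proof -
    have "set (bs @ [b]) \<subseteq> Basis \<and> length (bs @ [b]) < Suc k" using that assms(2) by auto
    then show ?thesis using assms(1) that(2) unfolding Ck_on_def it by blast
  qed
  show "continuous_on S (iter_partial bs (partial_deriv b f))"
    if "set bs \<subseteq> Basis \<and> length bs \<le> k" for bs
  proof -
    have "set (bs @ [b]) \<subseteq> Basis \<and> length (bs @ [b]) \<le> Suc k" using that assms(2) by auto
    then show ?thesis using assms(1) unfolding Ck_on_def it by blast
  qed
qed

lemma Ck_on_2_hessian:
  assumes "Ck_on 2 S f"
  shows "C1_deriv S (gradient f) (\<lambda>q v. \<Sum>b\<in>Basis. (gradient (partial_deriv b f) q \<bullet> v) *\<^sub>R b)"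
  unfolding gradient_def[of f, abs_def]
proof (rule C1_deriv_sum)
  fix b :: 'a assume b: "b \<in> Basis"
  have "Ck_on 1 S (partial_deriv b f)"
    using assms b by (intro Ck_on_partial_deriv) (simp_all add: numeral_2_eq_2)
  then have "C1_deriv S (partial_deriv b f) (\<lambda>q v. gradient (partial_deriv b f) q \<bullet> v)"
    by (rule Ck_on_C1_deriv) simp
  from C1_deriv_compose_linear[OF this bounded_linear_scaleR_left[of b]]
  show "C1_deriv S (\<lambda>q. partial_deriv b f q *\<^sub>R b) (\<lambda>q v. (gradient (partial_deriv b f) q \<bullet> v) *\<^sub>R b)" .
qed

lemma Ck_on_subset:
  assumes "Ck_on k S f" "T \<subseteq> S"
  shows "Ck_on k T f"
  unfolding Ck_on_def
proof (intro conjI allI impI ballI)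
  show "iter_partial bs f differentiable (at q)" if "set bs \<subseteq> Basis \<and> length bs < k" "q \<in> T" for bs q
    using assms(1) that(1) subsetD[OF assms(2) that(2)] unfolding Ck_on_def by blast
  show "continuous_on T (iter_partial bs f)" if "set bs \<subseteq> Basis \<and> length bs \<le> k" for bs
    by (rule continuous_on_subset[OF _ assms(2)]) (use assms(1) that in \<open>unfold Ck_on_def, blast\<close>)
qed

lemma smooth_on_subset: "smooth_on S f \<Longrightarrow> T \<subseteq> S \<Longrightarrow> smooth_on T f"
  unfolding smooth_on_def using Ck_on_subset by blast

text \<open>\<open>outward_normal\<close> refers to defining functions centred at the point itself,
  so one function has to serve at all nearby boundary points. It vanishes there: it is nonnegative
  off the open set, and a positive value would give a neighbourhood disjoint from it.\<close>

lemma local_defining_function_recenter: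
  assumes l: "local_defining_function \<Omega> y r \<phi>" and x: "x \<in> ball y r" and "open \<Omega>" "x \<in> frontier \<Omega>"
  obtains r' where "local_defining_function \<Omega> x r' \<phi>"
proof -
  obtain r' where r': "r' > 0" "ball x r' \<subseteq> ball y r" using x by (meson openE open_ball)
  have C: "C1_deriv (ball y r) \<phi> (\<lambda>q v. gradient \<phi> q \<bullet> v)"
    using l by (intro Ck_on_C1_deriv[of 1]) (auto simp: local_defining_function_def smooth_on_def)
  have eq: "\<Omega> \<inter> ball y r = {w \<in> ball y r. \<phi> w < 0}" using l by (simp add: local_defining_function_def)
  have "x \<notin> \<Omega>" using assms(3,4) by (simp add: frontier_def interior_open)
  then have "x \<notin> {w \<in> ball y r. \<phi> w < 0}" using eq by blast
  then have ge: "\<phi> x \<ge> 0" using x by simp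
  have "\<phi> x \<le> 0"
  proof (rule ccontr)
    assume "\<not> \<phi> x \<le> 0"
    have "open (ball y r \<inter> \<phi> -` {0<..})"
      by (rule continuous_open_preimage[OF C1_derivD(3)[OF C]]) auto
    moreover have "x \<in> ball y r \<inter> \<phi> -` {0<..}" using x \<open>\<not> \<phi> x \<le> 0\<close> by auto
    moreover have "x \<in> closure \<Omega>" using assms(4) by (simp add: frontier_def)
    ultimately obtain w where "w \<in> \<Omega>" "w \<in> ball y r" "\<phi> w > 0"
      using open_Int_closure_eq_empty[of "ball y r \<inter> \<phi> -` {0<..}" \<Omega>] by auto
    then have "w \<in> {w \<in> ball y r. \<phi> w < 0}" using eq by blast
    then show False using \<open>\<phi> w > 0\<close> by simp
  qed
  with ge have "\<phi> x = 0" by simp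
  moreover have "smooth_on (ball x r') \<phi>"
    by (rule smooth_on_subset[OF _ r'(2)]) (use l in \<open>simp add: local_defining_function_def\<close>)
  moreover have "\<Omega> \<inter> ball x r' = {w \<in> ball x r'. \<phi> w < 0}" 
  proof -
    have "\<Omega> \<inter> ball x r' = (\<Omega> \<inter> ball y r) \<inter> ball x r'" using r'(2) by blast
    then show ?thesis unfolding eq using r'(2) by blast
  qed
  moreover have "\<forall>w\<in>ball x r'. gradient \<phi> w \<noteq> 0"
    using l subsetD[OF r'(2)] unfolding local_defining_function_def by simp
  ultimately have "local_defining_function \<Omega> x r' \<phi>"
    using r'(1) unfolding local_defining_function_def by simp
  then show ?thesis by (rule that)
qed

text \<open>The one C1 building block for every bump and cutoff function below.\<close>

lemma DERIV_square_pos: "DERIV (\<lambda>u::real. (max 0 u)\<^sup>2) u :> 2 * max 0 u"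
proof -
  consider "u < 0" | "u = 0" | "u > 0" by linarith
  then show ?thesis
  proof cases
    case 1
    have "DERIV (\<lambda>u::real. 0) u :> 2 * max 0 u" using 1 by simp
    then show ?thesis
      by (rule DERIV_cong_ev[THEN iffD1, rotated -1])
         (use 1 in \<open>auto intro!: eventually_mono[OF order_tendstoD(2)[OF tendsto_ident_at]] simp: eventually_nhds intro!: exI[of _ "{..<0}"]\<close>)
  next
    case 3
    have "DERIV (\<lambda>u::real. u\<^sup>2) u :> 2 * max 0 u" using 3 by (auto intro!: derivative_eq_intros)
    then show ?thesis
      by (rule DERIV_cong_ev[THEN iffD1, rotated -1])
         (use 3 in \<open>auto simp: eventually_nhds intro!: exI[of _ "{0<..}"]\<close>)
  next
    case 2
    have "((\<lambda>h::real. (max 0 h)\<^sup>2 / h) \<longlongrightarrow> 0) (at 0)"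
    proof (rule Lim_null_comparison)
      show "\<forall>\<^sub>F h in at 0. norm ((max 0 h)\<^sup>2 / h) \<le> \<bar>h\<bar>"
        by (rule always_eventually) (auto simp: max_def power2_eq_square)
      show "((\<lambda>h::real. \<bar>h\<bar>) \<longlongrightarrow> 0) (at 0)"
        using tendsto_rabs[OF tendsto_ident_at[of "0::real" UNIV]] by simp
    qed
    then show ?thesis by (simp add: 2 DERIV_def)
  qed
qed

lemma C1_deriv_square_pos:
  fixes f :: "'a::euclidean_space \<Rightarrow> real"
  assumes "C1_deriv S f f'"
  shows "C1_deriv S (\<lambda>q. (max 0 (f q))\<^sup>2) (\<lambda>q v. 2 * max 0 (f q) * f' q v)"
  by (rule C1_deriv_compose_real[where T=UNIV and g="\<lambda>u. (max 0 u)\<^sup>2" and g'="\<lambda>u. 2 * max 0 u", OF assms])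
     (auto intro!: continuous_intros DERIV_square_pos)

text \<open>
  A piece of a defining function near a boundary point \<open>y\<close>: \<open>k\<close> is a local defining function times
  the bump function \<open>\<rho>\<close>, and \<open>n\<close> is a constant vector transversal to the boundary where \<open>\<rho> > 0\<close>.
\<close>

definition defining_piece ::
    "'a::euclidean_space set \<Rightarrow> 'a \<Rightarrow> ('a \<Rightarrow> real) \<Rightarrow> ('a \<Rightarrow> 'a \<Rightarrow> real) \<Rightarrow> ('a \<Rightarrow> real) \<Rightarrow>
     ('a \<Rightarrow> 'a \<Rightarrow> real) \<Rightarrow> 'a \<Rightarrow> bool" where
  "defining_piece \<Omega> y \<rho> \<rho>' k k' n \<longleftrightarrow>
    C1_deriv UNIV \<rho> \<rho>' \<and> (\<forall>x. \<rho> x \<ge> 0) \<and> \<rho> y > 0 \<and> C1_deriv UNIV k k' \<and>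
    (\<forall>x\<in>\<Omega>. k x \<le> 0 \<and> (\<rho> x > 0 \<longrightarrow> k x < 0)) \<and>
    (\<forall>x\<in>frontier \<Omega>. k x = 0 \<and> (\<rho> x > 0 \<longrightarrow> n \<bullet> outward_normal \<Omega> x > 0) \<and>
      (\<exists>l\<ge>0. (\<rho> x > 0 \<longrightarrow> l > 0) \<and> (\<forall>v. k' x v = l * (outward_normal \<Omega> x \<bullet> v))))"

lemma defining_piece_exists:
  fixes \<Omega> :: "'a::euclidean_space set"
  assumes \<Omega>: "open \<Omega>" "has_smooth_boundary \<Omega>" and y: "y \<in> frontier \<Omega>"
  shows "\<exists>\<rho> \<rho>' k k' n. defining_piece \<Omega> y \<rho> \<rho>' k k' n"
proof -
  obtain r \<phi> where l: "local_defining_function \<Omega> y r \<phi>" using \<Omega>(2) y by (auto simp: has_smooth_boundary_def)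
  have r: "r > 0" using l by (simp add: local_defining_function_def)
  have Ck: "Ck_on 1 (ball y r) \<phi>" using l by (simp add: local_defining_function_def smooth_on_def)
  have C: "C1_deriv (ball y r) \<phi> (\<lambda>q v. gradient \<phi> q \<bullet> v)" by (rule Ck_on_C1_deriv[OF Ck]) simp
  define n where "n = gradient \<phi> y"
  have n0: "n \<noteq> 0" using l r by (auto simp: n_def local_defining_function_def)
  have "continuous_on (ball y r) (\<lambda>x. n \<bullet> gradient \<phi> x)"
    using Ck_on_continuous_gradient[OF Ck] by (intro continuous_intros) auto
  then have "open (ball y r \<inter> (\<lambda>x. n \<bullet> gradient \<phi> x) -` {0<..})"
    by (rule continuous_open_preimage) auto
  moreover have "y \<in> ball y r \<inter> (\<lambda>x. n \<bullet> gradient \<phi> x) -` {0<..}" using r n0 by (simp add: n_def)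
  ultimately obtain s where s: "s > 0" "ball y s \<subseteq> ball y r \<inter> (\<lambda>x. n \<bullet> gradient \<phi> x) -` {0<..}"
    by (meson openE)
  \<comment> \<open>Half the radius, so that \<open>\<rho>\<close> vanishes before the edge of
    \<open>ball y s\<close>; the open sets \<open>ball y r\<close> and
    \<open>{x. dist y x > a}\<close> then cover the space, and extension of \<open>k\<close> by zero
    is C1.\<close>
  define a where "a = s / 2"
  have a: "0 < a" "a < s" using s by (auto simp: a_def)
  define \<rho> where "\<rho> x = (max 0 (a\<^sup>2 - (x - y) \<bullet> (x - y)))\<^sup>2" for x
  have id: "C1_deriv S (\<lambda>x. x - y) (\<lambda>x v. v - 0)" for S
    by (rule C1_deriv_diff[OF C1_deriv_linear[OF bounded_linear_ident] C1_deriv_const])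
  obtain \<rho>' where \<rho>': "C1_deriv UNIV \<rho> \<rho>'"
    unfolding \<rho>_def[abs_def]
    using C1_deriv_square_pos[OF C1_deriv_diff[OF C1_deriv_const C1_deriv_inner[OF id id]]] by blast
  have \<rho>0: "\<rho> x = 0" if "dist y x \<ge> a" for x
  proof -
    have "a\<^sup>2 \<le> (norm (x - y))\<^sup>2" using that a by (intro power_mono) (auto simp: dist_norm norm_minus_commute)
    then show ?thesis by (simp add: \<rho>_def power2_norm_eq_inner)
  qed
  have \<rho>pos: "\<rho> x > 0 \<Longrightarrow> x \<in> ball y s" for x
    using \<rho>0[of x] a by (cases "dist y x \<ge> a") auto
  have ab: "open {x. dist y x > a}" by (intro open_Collect_less continuous_intros)
  have cover: "ball y r \<union> {x. dist y x > a} = UNIV"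
  proof -
    have "x \<in> ball y r" if "\<not> dist y x > a" for x
    proof -
      have "x \<in> ball y s" using that a by simp
      then show ?thesis using s by blast
    qed
    then show ?thesis by blast
  qed
  define k where "k x = (if x \<in> ball y r then \<rho> x * \<phi> x else 0)" for x
  define k' where "k' x = (if x \<in> ball y r then (\<lambda>v. \<rho> x * (gradient \<phi> x \<bullet> v) + \<rho>' x v * \<phi> x) else (\<lambda>v. 0))" for x
  have k: "C1_deriv UNIV k k'"
    using C1_deriv_extend_zero[OF open_ball ab C1_deriv_mult[OF C1_deriv_subset[OF \<rho>' subset_UNIV] C]] \<rho>0
    unfolding cover k_def[abs_def] k'_def[abs_def] by (simp add: less_imp_le)
  show ?thesis
  proof (rule exI[of _ \<rho>], rule exI[of _ \<rho>'], rule exI[of _ k], rule exI[of _ k'], rule exI[of _ n],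
      unfold defining_piece_def, intro conjI ballI impI allI)
    show "C1_deriv UNIV \<rho> \<rho>'" "C1_deriv UNIV k k'" by fact+
    show "\<rho> x \<ge> 0" for x by (simp add: \<rho>_def)
    show "\<rho> y > 0" using a by (simp add: \<rho>_def)
  next
    fix x assume x: "x \<in> \<Omega>"
    have neg: "\<phi> x < 0" if "x \<in> ball y r"
      using that x l unfolding local_defining_function_def by blast
    have "\<rho> x \<ge> 0" by (simp add: \<rho>_def)
    then show "k x \<le> 0" using neg by (auto simp: k_def mult_nonneg_nonpos less_imp_le)
    show "k x < 0" if "\<rho> x > 0"
    proof -
      have "x \<in> ball y r" using \<rho>pos[OF that] s by blast
      then show ?thesis using neg that by (simp add: k_def mult_pos_neg)
    qed
  next
    fix x assume x: "x \<in> frontier \<Omega>"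
    have \<phi>x: "\<phi> x = 0 \<and> outward_normal \<Omega> x = sgn (gradient \<phi> x) \<and> gradient \<phi> x \<noteq> 0" if xb: "x \<in> ball y r"
    proof -
      obtain r' where l': "local_defining_function \<Omega> x r' \<phi>"
        by (rule local_defining_function_recenter[OF l xb \<Omega>(1) x])
      then show ?thesis using outward_normal_eq[OF l'] by (auto simp: local_defining_function_def)
    qed
    show "k x = 0" using \<phi>x by (auto simp: k_def)
    show "n \<bullet> outward_normal \<Omega> x > 0" if "\<rho> x > 0"
    proof -
      have "x \<in> ball y r" "n \<bullet> gradient \<phi> x > 0" using \<rho>pos[OF that] s by auto
      then show ?thesis using \<phi>x by (simp add: sgn_div_norm)
    qed
    show "\<exists>l\<ge>0. (\<rho> x > 0 \<longrightarrow> l > 0) \<and> (\<forall>v. k' x v = l * (outward_normal \<Omega> x \<bullet> v))"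
    proof (cases "x \<in> ball y r")
      case True
      then have "k' x v = (\<rho> x * norm (gradient \<phi> x)) * (outward_normal \<Omega> x \<bullet> v)" for v
        using \<phi>x by (simp add: k'_def sgn_div_norm)
      moreover have "\<rho> x * norm (gradient \<phi> x) \<ge> 0" by (simp add: \<rho>_def)
      ultimately show ?thesis using \<phi>x[OF True] by (intro exI[of _ "\<rho> x * norm (gradient \<phi> x)"]) auto
    next
      case False
      then have "\<not> \<rho> x > 0" using \<rho>pos[of x] s by blast
      then show ?thesis using False by (intro exI[of _ 0]) (auto simp: k'_def)
    qed
  qed
qed

text \<open>Finitely many pieces cover the compact boundary, and their defining functions can be
  added because all their derivatives there are nonnegative multiples of one normal.
  \<open>Z\<close> combines constant vectors with C1 coefficients: the gradient of
  \<open>\<psi>\<close> would be transversal as well, but it is only known to be continuous, whereas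
  the divergence of \<open>Z\<close> will be taken.\<close>

lemma boundary_function:
  fixes \<Omega> :: "'a::euclidean_space set"
  assumes \<Omega>: "open \<Omega>" "bounded \<Omega>" "has_smooth_boundary \<Omega>"
  obtains \<psi> :: "'a \<Rightarrow> real" and \<psi>' Z Z' where "C1_deriv UNIV \<psi> \<psi>'" "C1_deriv UNIV Z Z'"
    "\<And>x. x \<in> \<Omega> \<Longrightarrow> \<psi> x < 0" "\<And>x. x \<in> frontier \<Omega> \<Longrightarrow> \<psi> x = 0"
    "\<And>x. x \<in> frontier \<Omega> \<Longrightarrow> \<psi>' x (Z x) > 0"
    "\<And>x. x \<in> frontier \<Omega> \<Longrightarrow> \<exists>l>0. \<forall>v. \<psi>' x v = l * (outward_normal \<Omega> x \<bullet> v)"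
proof -
  let ?fr = "frontier \<Omega>"
  have "\<forall>y\<in>?fr. \<exists>\<rho> \<rho>' k k' n. defining_piece \<Omega> y \<rho> \<rho>' k k' n"
    using defining_piece_exists[OF \<Omega>(1,3)] by blast
  then obtain \<rho> \<rho>' k k' n
    where pc: "\<And>y. y \<in> ?fr \<Longrightarrow> defining_piece \<Omega> y (\<rho> y) (\<rho>' y) (k y) (k' y) (n y)"
    unfolding bchoice_iff by blast
  note P = pc[unfolded defining_piece_def]
  have cfr: "compact ?fr" using \<Omega>(2) by (rule compact_frontier_bounded)
  have contr: "continuous_on UNIV (\<rho> y)" if "y \<in> ?fr" for y
    by (rule C1_derivD(3)[of _ _ "\<rho>' y"]) (use P[OF that] in simp)
  have "\<And>y. y \<in> ?fr \<Longrightarrow> open {x. 0 < \<rho> y x}"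
    using contr by (intro open_Collect_less continuous_on_const)
  moreover have "?fr \<subseteq> (\<Union>y\<in>?fr. {x. 0 < \<rho> y x})"
  proof
    fix x assume "x \<in> ?fr"
    then have "\<rho> x x > 0" using P[of x] by simp
    then show "x \<in> (\<Union>y\<in>?fr. {x. 0 < \<rho> y x})" using \<open>x \<in> ?fr\<close> by auto
  qed
  ultimately obtain I where I: "I \<subseteq> ?fr" "finite I" "?fr \<subseteq> (\<Union>y\<in>I. {x. 0 < \<rho> y x})"
    by (rule compactE_image[OF cfr])
  define \<theta> where "\<theta> x = (\<Sum>y\<in>I. \<rho> y x)" for x
  have \<rho>0: "\<rho> y x \<ge> 0" if "y \<in> I" for x y using P[OF subsetD[OF I(1) that]] by simp
  have \<theta>pos: "\<theta> x > 0" if x: "x \<in> ?fr" for x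
  proof -
    obtain y where "y \<in> I" "\<rho> y x > 0" using I(3) x by blast
    then show ?thesis unfolding \<theta>_def using \<rho>0 I(2) by (intro sum_pos2[of I y]) auto
  qed
  have c\<theta>: "continuous_on UNIV \<theta>" unfolding \<theta>_def using contr I(1) by (intro continuous_on_sum) auto
  obtain c where c: "c > 0" "\<And>x. x \<in> ?fr \<Longrightarrow> c \<le> \<theta> x"
  proof (cases "?fr = {}")
    case True then show ?thesis using that[of 1] by auto
  next
    case False
    obtain x where "x \<in> ?fr" "\<And>y. y \<in> ?fr \<Longrightarrow> \<theta> x \<le> \<theta> y"
      using continuous_attains_inf[OF cfr False continuous_on_subset[OF c\<theta> subset_UNIV]] by blast
    then show ?thesis using that[of "\<theta> x"] \<theta>pos by blast
  qed
  \<comment> \<open>Away from the boundary all pieces may vanish, and the square makes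
    \<open>\<psi>\<close> negative there. Since \<open>c\<close> bounds \<open>\<theta>\<close> from
    below on the boundary, the square affects neither the value nor the first derivative at boundary
    points.\<close>
  define \<psi> where "\<psi> x = (\<Sum>y\<in>I. k y x) - (max 0 (c - \<theta> x))\<^sup>2" for x
  define \<psi>' where "\<psi>' x v = (\<Sum>y\<in>I. k' y x v) - 2 * max 0 (c - \<theta> x) * (0 - (\<Sum>y\<in>I. \<rho>' y x v))" for x v
  have rI: "C1_deriv UNIV (\<rho> y) (\<rho>' y)" and kI: "C1_deriv UNIV (k y) (k' y)" if "y \<in> I" for y
    using P[OF subsetD[OF I(1) that]] by simp_all
  define Z where "Z x = (\<Sum>y\<in>I. \<rho> y x *\<^sub>R n y)" for x
  have k_le: "k y x \<le> 0" and k_less: "\<rho> y x > 0 \<Longrightarrow> k y x < 0" if "y \<in> I" "x \<in> \<Omega>" for x y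
    using P[OF subsetD[OF I(1) that(1)]] that(2) by simp_all
  have k_0: "k y x = 0" and n_pos: "\<rho> y x > 0 \<Longrightarrow> n y \<bullet> outward_normal \<Omega> x > 0"
    and k'_ex: "\<exists>l\<ge>0. (\<rho> y x > 0 \<longrightarrow> l > 0) \<and> (\<forall>v. k' y x v = l * (outward_normal \<Omega> x \<bullet> v))"
    if "y \<in> I" "x \<in> ?fr" for x y
    using P[OF subsetD[OF I(1) that(1)]] that(2) by simp_all
  have lsum: "\<exists>l>0. \<forall>v. \<psi>' x v = l * (outward_normal \<Omega> x \<bullet> v)" if x: "x \<in> ?fr" for x
  proof -
    have "\<forall>y\<in>I. \<exists>l\<ge>0. (\<rho> y x > 0 \<longrightarrow> l > 0) \<and> (\<forall>v. k' y x v = l * (outward_normal \<Omega> x \<bullet> v))"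
      using k'_ex x by blast
    then obtain l where l: "\<And>y. y \<in> I \<Longrightarrow> l y \<ge> 0 \<and> (\<rho> y x > 0 \<longrightarrow> l y > 0) \<and> (\<forall>v. k' y x v = l y * (outward_normal \<Omega> x \<bullet> v))"
      unfolding bchoice_iff by blast
    obtain y where y: "y \<in> I" "\<rho> y x > 0" using I(3) x by blast
    have "(\<Sum>y\<in>I. l y) > 0" using l y I(2) by (intro sum_pos2[of I y]) auto
    moreover have "\<psi>' x v = (\<Sum>y\<in>I. l y) * (outward_normal \<Omega> x \<bullet> v)" for v
      using l c(2)[OF x] by (simp add: \<psi>'_def sum_distrib_right)
    ultimately show ?thesis by blast
  qed
  show ?thesis
  proof (rule that)
    show "C1_deriv UNIV \<psi> \<psi>'"
      unfolding \<psi>_def[abs_def] \<psi>'_def[abs_def] \<theta>_def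
      by (intro C1_deriv_diff C1_deriv_square_pos C1_deriv_sum C1_deriv_const kI rI)
    show "C1_deriv UNIV Z (\<lambda>x v. \<Sum>y\<in>I. \<rho>' y x v *\<^sub>R n y)"
      unfolding Z_def[abs_def]
      by (intro C1_deriv_sum C1_deriv_compose_linear[OF rI bounded_linear_scaleR_left])
    show "\<psi> x < 0" if x: "x \<in> \<Omega>" for x
    proof (cases "\<exists>y\<in>I. \<rho> y x > 0")
      case True
      then obtain y where y: "y \<in> I" "\<rho> y x > 0" by blast
      have "(\<Sum>y\<in>I. k y x) < (\<Sum>y\<in>I. 0)"
        using I(2) k_le[OF _ x] k_less[OF y(1) x y(2)] y(1) by (intro sum_strict_mono_ex1) auto
      moreover have "0 \<le> (max 0 (c - \<theta> x))\<^sup>2" by simp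
      ultimately show ?thesis unfolding \<psi>_def sum.neutral_const by linarith
    next
      case False
      have "\<rho> y x = 0" if "y \<in> I" for y 
      proof -
        have "\<not> \<rho> y x > 0" using False that by blast
        then show ?thesis using \<rho>0[OF that, of x] by linarith
      qed
      then have "\<theta> x = 0" by (simp add: \<theta>_def)
      then have "(max 0 (c - \<theta> x))\<^sup>2 > 0" using c(1) by simp
      moreover have "(\<Sum>y\<in>I. k y x) \<le> 0" using k_le[OF _ x] by (intro sum_nonpos) auto
      ultimately show ?thesis unfolding \<psi>_def by linarith
    qed
    show "\<psi> x = 0" if x: "x \<in> ?fr" for x
    proof -
      have "(\<Sum>y\<in>I. k y x) = 0" using k_0[OF _ x] by (intro sum.neutral) auto
      then show ?thesis using c(2)[OF x] by (simp add: \<psi>_def)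
    qed
    show "\<psi>' x (Z x) > 0" if x: "x \<in> ?fr" for x
    proof -
      obtain l where l: "l > 0" "\<And>v. \<psi>' x v = l * (outward_normal \<Omega> x \<bullet> v)" using lsum[OF x] by blast
      obtain y where y: "y \<in> I" "\<rho> y x > 0" using I(3) x by blast
      have nn: "n y \<bullet> outward_normal \<Omega> x > 0" if "y \<in> I" "\<rho> y x > 0" for y using n_pos[OF that(1) x that(2)] .
      have "(\<Sum>y\<in>I. \<rho> y x * (n y \<bullet> outward_normal \<Omega> x)) > 0"
      proof (rule sum_pos2[OF I(2) y(1)])
        show "0 < \<rho> y x * (n y \<bullet> outward_normal \<Omega> x)" using y nn by simp
        show "0 \<le> \<rho> y x * (n y \<bullet> outward_normal \<Omega> x)" if "y \<in> I" for y
        proof (cases "\<rho> y x = 0")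
          case False
          then have "\<rho> y x > 0" using \<rho>0[OF that, of x] by linarith
          then show ?thesis using nn[OF that] by simp
        qed simp
      qed
      also have "(\<Sum>y\<in>I. \<rho> y x * (n y \<bullet> outward_normal \<Omega> x)) = outward_normal \<Omega> x \<bullet> Z x"
        by (simp add: Z_def inner_sum_right inner_commute)
      finally show ?thesis using l by simp
    qed
    show "\<exists>l>0. \<forall>v. \<psi>' x v = l * (outward_normal \<Omega> x \<bullet> v)" if "x \<in> ?fr" for x by (rule lsum[OF that])
  qed
qed

section \<open>Unique continuation\<close>

text \<open>A cutoff rising from 0 at \<open>s \<le> 0\<close> to 1 at \<open>s \<ge> 1\<close>,
  nested from \<open>(max 0 u)\<^sup>2\<close>. C1 is enough, as only first derivatives of a cutoff
  enter a divergence.\<close>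

definition step :: "real \<Rightarrow> real" where
  "step s = 1 - (max 0 (1 - (max 0 s)\<^sup>2))\<^sup>2"

definition step' :: "real \<Rightarrow> real" where
  "step' s = 2 * max 0 (1 - (max 0 s)\<^sup>2) * (2 * max 0 s)"

lemma DERIV_step: "DERIV step s :> step' s"
proof -
  have "DERIV (\<lambda>s::real. 1 - (max 0 s)\<^sup>2) s :> - (2 * max 0 s)"
    using DERIV_diff[OF DERIV_const[of 1] DERIV_square_pos[of s]] by simp
  from DERIV_chain2[OF DERIV_square_pos this]
  have "DERIV (\<lambda>s::real. (max 0 (1 - (max 0 s)\<^sup>2))\<^sup>2) s :> 2 * max 0 (1 - (max 0 s)\<^sup>2) * (- (2 * max 0 s))" .
  from DERIV_diff[OF DERIV_const[of 1] this]
  show ?thesis unfolding step_def[abs_def] step'_def by simp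
qed

lemma continuous_step': "continuous_on S step'"
  unfolding step'_def by (intro continuous_intros)

lemma step_bounds: "0 \<le> step s" "step s \<le> 1"
proof -
  have "(max 0 (1 - (max 0 s)\<^sup>2)) \<le> 1" by simp
  then have "(max 0 (1 - (max 0 s)\<^sup>2))\<^sup>2 \<le> 1\<^sup>2" by (intro power_mono) auto
  then show "0 \<le> step s" "step s \<le> 1" by (auto simp: step_def)
qed

lemma step_eq_0: "s \<le> 0 \<Longrightarrow> step s = 0"
  and step_eq_1: "s \<ge> 1 \<Longrightarrow> step s = 1"
  and step'_nonneg: "step' s \<ge> 0"
  and step'_eq_0: "s \<le> 0 \<or> s \<ge> 1 \<Longrightarrow> step' s = 0"
proof -
  have *: "s \<ge> 1 \<Longrightarrow> max 0 (1 - (max 0 s)\<^sup>2) = 0" using one_le_power[of s 2] by simp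
  show "s \<le> 0 \<Longrightarrow> step s = 0" by (simp add: step_def)
  show "s \<ge> 1 \<Longrightarrow> step s = 1" using * by (simp add: step_def)
  show "step' s \<ge> 0" unfolding step'_def by (intro mult_nonneg_nonneg) auto
  show "s \<le> 0 \<or> s \<ge> 1 \<Longrightarrow> step' s = 0" using * by (auto simp: step'_def)
qed

lemma step'_bound: obtains C where "C \<ge> 0" "\<And>s. \<bar>step' s\<bar> \<le> C"
proof -
  obtain C where C: "C \<ge> 0" "\<And>s. s \<in> {0..1} \<Longrightarrow> norm (step' s) \<le> C"
    by (rule compact_bound[OF compact_Icc continuous_step', of 0 1]) blast
  have "\<bar>step' s\<bar> \<le> C" for s using C step'_eq_0[of s] by (cases "s \<in> {0..1}") auto
  then show ?thesis using that C(1) by blast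
qed

lemma C1_deriv_step:
  fixes f :: "'a::euclidean_space \<Rightarrow> real"
  assumes "C1_deriv S f f'"
  shows "C1_deriv S (\<lambda>q. step (f q)) (\<lambda>q v. step' (f q) * f' q v)"
  by (rule C1_deriv_compose_real[where T=UNIV and g=step and g'=step', OF assms])
     (auto intro: DERIV_step continuous_step')

text \<open>The points of \<open>K\<close> with \<open>E \<ge> 0\<close> form a compact set on which
  \<open>\<Psi>\<close> is negative, hence bounded away from zero.\<close>

lemma negative_near_boundary:
  fixes E \<Psi> :: "'a::metric_space \<Rightarrow> real"
  assumes K: "compact K" and E: "continuous_on K E" and \<Psi>: "continuous_on K \<Psi>"
    and le: "\<And>q. q \<in> K \<Longrightarrow> \<Psi> q \<le> 0" and neg: "\<And>q. q \<in> K \<Longrightarrow> \<Psi> q = 0 \<Longrightarrow> E q < 0"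
  obtains \<eta> where "\<eta> > 0" "\<And>q. q \<in> K \<Longrightarrow> \<Psi> q > - \<eta> \<Longrightarrow> E q < 0"
proof -
  define L where "L = {q \<in> K. E q \<ge> 0}"
  have L: "compact L"
  proof -
    have "closedin (top_of_set K) (K \<inter> E -` {0..})"
      by (rule continuous_closedin_preimage[OF E]) auto
    moreover have "K \<inter> E -` {0..} = L" by (auto simp: L_def)
    ultimately show ?thesis using K closedin_compact by metis
  qed
  show ?thesis
  proof (cases "L = {}")
    case True then show ?thesis using that[of 1] by (force simp: L_def)
  next
    case False
    have "continuous_on L \<Psi>" using \<Psi> by (rule continuous_on_subset) (auto simp: L_def)
    then obtain q where q: "q \<in> L" "\<And>q'. q' \<in> L \<Longrightarrow> \<Psi> q' \<le> \<Psi> q"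
      using continuous_attains_sup[OF L False] by blast
    have "\<Psi> q \<noteq> 0" using neg[of q] q(1) by (auto simp: L_def)
    then have "- \<Psi> q > 0" using le[of q] q(1) by (auto simp: L_def)
    moreover have "E q' < 0" if "q' \<in> K" "\<Psi> q' > - (- \<Psi> q)" for q'
      using q(2)[of q'] that by (force simp: L_def)
    ultimately show ?thesis by (rule that)
  qed
qed

lemma exp_beats_bound:
  fixes k d B a0 :: real
  assumes "k > 0" "d > 0" and "\<And>a. a \<ge> a0 \<Longrightarrow> k * exp (a * d) \<le> B"
  shows False
proof -
  define a where "a = max a0 (\<bar>B\<bar> / (k * d))"
  have "\<bar>B\<bar> / (k * d) * (k * d) \<le> a * (k * d)"
    using assms(1,2) by (intro mult_right_mono) (auto simp: a_def)
  then have "\<bar>B\<bar> \<le> k * (a * d)" using assms(1,2) by (simp add: field_simps)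
  also have "\<dots> < k * exp (a * d)"
    using assms(1) exp_ge_add_one_self[of "a * d"] by (intro mult_strict_left_mono) linarith+
  also have "\<dots> \<le> B" by (rule assms(3)) (simp add: a_def)
  finally show False by simp
qed

context carleman_weight
begin

text \<open>The current is quadratic in \<open>w\<close> and \<open>W\<close>, which are of size
  \<open>e\<close> and \<open>e * a\<close>. The resulting power \<open>a\<^sup>2\<close> is the one
  in the lower bound for the divergence, so that the exponentials alone decide the comparison for
  large \<open>a\<close>.\<close>

lemma current_bound:
  assumes D: "norm (DF q) \<le> C1" and g: "\<bar>g q\<bar> \<le> C2" and w: "\<bar>w\<bar> \<le> e * M" and W: "norm W \<le> e * a * L"
    and pos: "a \<ge> 1" "e > 0" "M \<ge> 0" "L \<ge> 0" "C1 \<ge> 0" "C2 \<ge> 0"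
  shows "norm (current a w W q) \<le> (3 * C1 * L\<^sup>2 + C2 * M * L + C1 ^ 3 * M\<^sup>2) * (a\<^sup>2 * e\<^sup>2)"
proof -
  have W2: "norm W * norm W \<le> (e * a * L) * (e * a * L)" using W pos by (intro mult_mono) auto
  have 1: "norm ((2 * (DF q \<bullet> A W)) *\<^sub>R A W) \<le> 2 * (C1 * ((e * a * L) * (e * a * L)))"
  proof -
    have "\<bar>DF q \<bullet> A W\<bar> * norm W \<le> (norm (DF q) * norm W) * norm W"
      using Cauchy_Schwarz_ineq2[of "DF q" "A W"] by (intro mult_right_mono) (auto simp: normA)
    also have "\<dots> = norm (DF q) * (norm W * norm W)" by simp
    also have "\<dots> \<le> C1 * ((e * a * L) * (e * a * L))" by (rule mult_mono[OF D W2]) (use pos in auto)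
    finally show ?thesis by (simp add: abs_mult normA)
  qed
  have 2: "norm ((W \<bullet> A W) *\<^sub>R A (DF q)) \<le> C1 * ((e * a * L) * (e * a * L))"
  proof -
    have "\<bar>W \<bullet> A W\<bar> * norm (DF q) \<le> (norm W * norm W) * norm (DF q)"
      using Cauchy_Schwarz_ineq2[of W "A W"] by (intro mult_right_mono) (auto simp: normA)
    also have "\<dots> \<le> ((e * a * L) * (e * a * L)) * C1" by (rule mult_mono[OF W2 D]) (use pos in auto)
    finally show ?thesis by (simp add: normA mult.commute)
  qed
  have 3: "norm ((g q * w) *\<^sub>R A W) \<le> C2 * (e * M) * (a * (e * a * L))"
  proof -
    have "\<bar>g q\<bar> * \<bar>w\<bar> * norm W \<le> C2 * (e * M) * (a * (e * a * L))"
    proof (intro mult_mono)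
      \<comment> \<open>The term with \<open>g\<close> is only of first order in \<open>a\<close>;
        the extra factor \<open>a \<ge> 1\<close> brings it to the common order
        \<open>a\<^sup>2\<close>.\<close>
      have "1 * (e * a * L) \<le> a * (e * a * L)" using pos by (intro mult_right_mono) auto
      then show "norm W \<le> a * (e * a * L)" using W by simp
    qed (use g w pos in auto)
    then show ?thesis by (simp add: abs_mult normA)
  qed
  have 4: "norm ((a\<^sup>2 * ((DF q \<bullet> A (DF q)) * (w * w))) *\<^sub>R A (DF q)) \<le> a\<^sup>2 * (C1 * C1 * ((e * M) * (e * M))) * C1"
  proof -
    have "\<bar>DF q \<bullet> A (DF q)\<bar> \<le> norm (DF q) * norm (DF q)"
      using Cauchy_Schwarz_ineq2[of "DF q" "A (DF q)"] by (simp add: normA)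
    also have "\<dots> \<le> C1 * C1" using D pos by (intro mult_mono) auto
    finally have a: "\<bar>DF q \<bullet> A (DF q)\<bar> \<le> C1 * C1" .
    have b: "\<bar>w\<bar> * \<bar>w\<bar> \<le> (e * M) * (e * M)" using w pos by (intro mult_mono) auto
    have "a\<^sup>2 * (\<bar>DF q \<bullet> A (DF q)\<bar> * (\<bar>w\<bar> * \<bar>w\<bar>)) * norm (DF q) \<le> a\<^sup>2 * (C1 * C1 * ((e * M) * (e * M))) * C1"
      using a b D w pos by (intro mult_mono) auto
    then show ?thesis by (simp add: abs_mult normA)
  qed
  have "norm (current a w W q) \<le> 2 * (C1 * ((e * a * L) * (e * a * L))) + C1 * ((e * a * L) * (e * a * L))
     + C2 * (e * M) * (a * (e * a * L)) + a\<^sup>2 * (C1 * C1 * ((e * M) * (e * M))) * C1"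
    unfolding current_def
    by (intro order_trans[OF norm_triangle_ineq] add_mono order_trans[OF norm_triangle_ineq4] 1 2 3 4)
  also have "\<dots> = 3 * C1 * L\<^sup>2 * (a\<^sup>2 * e\<^sup>2) + C2 * M * L * (a\<^sup>2 * e\<^sup>2) + C1 ^ 3 * M\<^sup>2 * (a\<^sup>2 * e\<^sup>2)"
    by (simp add: power2_eq_square power3_eq_cube algebra_simps)
  also have "\<dots> = (3 * C1 * L\<^sup>2 + C2 * M * L + C1 ^ 3 * M\<^sup>2) * (a\<^sup>2 * e\<^sup>2)"
    by (simp add: algebra_simps)
  finally show ?thesis .
qed

text \<open>
  The current is cut off by \<open>step ((F - c) / (m - c))\<close> away from the sublevel \<open>F \<le> c\<close> and by
  \<open>step (- \<Psi> / \<eta> - 1)\<close> near the boundary \<open>\<Psi> = 0\<close>. Subtracting \<open>e Z\<close> makes the boundary flux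
  strictly negative, so that the second cutoff contributes with a favourable sign.
\<close>

theorem unique_continuation:
  assumes K: "compact K" "K \<subseteq> R"
    and form: "\<And>q \<xi>. q \<in> K \<Longrightarrow> \<xi> \<noteq> 0 \<Longrightarrow> DF q \<bullet> \<xi> = 0 \<Longrightarrow> 2 * (F2 q \<xi> \<bullet> \<xi>) - shift q * (\<xi> \<bullet> A \<xi>) > 0"
    and zeroth: "\<And>q. q \<in> K \<Longrightarrow> 2 * (F2 q (A (DF q)) \<bullet> A (DF q)) + (DF q \<bullet> A (DF q)) * shift q > 0"
    and S: "open S" "bounded S" "S \<subseteq> R"
    and dz: "\<And>q. q \<in> S \<Longrightarrow> (z has_derivative (\<lambda>v. Dz q \<bullet> v)) (at q)"
    and Dz: "C1_deriv S Dz Hz"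
    and eqn: "\<And>q. q \<in> S \<Longrightarrow> \<bar>box (Hz q)\<bar> \<le> B * (norm (Dz q) + \<bar>z q\<bar>)"
    and SK: "\<And>q. q \<in> S \<Longrightarrow> F q \<ge> c \<Longrightarrow> q \<in> K"
    and zK: "continuous_on K z" "continuous_on K Dz"
    and \<Psi>: "C1_deriv UNIV \<Psi> \<Psi>'" and Z: "C1_deriv UNIV Z Z'"
    and \<Psi>S: "\<And>q. q \<in> S \<Longrightarrow> \<Psi> q < 0" and \<Psi>K: "\<And>q. q \<in> K \<Longrightarrow> \<Psi> q \<le> 0"
    and KS: "\<And>q. q \<in> K \<Longrightarrow> \<Psi> q < 0 \<Longrightarrow> q \<in> S"
    and z0: "\<And>q. q \<in> K \<Longrightarrow> \<Psi> q = 0 \<Longrightarrow> z q = 0"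
    and flux: "\<And>q. q \<in> K \<Longrightarrow> \<Psi> q = 0 \<Longrightarrow>
      2 * (DF q \<bullet> A (Dz q)) * \<Psi>' q (A (Dz q)) - (Dz q \<bullet> A (Dz q)) * \<Psi>' q (A (DF q)) \<le> 0"
    and transv: "\<And>q. q \<in> K \<Longrightarrow> \<Psi> q = 0 \<Longrightarrow> \<Psi>' q (Z q) > 0"
    and q0: "q0 \<in> S" "F q0 > c"
  shows "z q0 = 0"
proof (rule ccontr)
  assume nz: "z q0 \<noteq> 0"
  \<comment> \<open>Two levels at one third and two thirds of the way from \<open>c\<close> to
    \<open>F q0\<close>. The weight cutoff varies only between \<open>c\<close> and
    \<open>m\<close>, while the test ball lies above \<open>m2\<close>; the gap yields the factor
    \<open>exp (2 * a * (m2 - m))\<close> that wins in the end.\<close>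
  define m where "m = (2 * c + F q0) / 3"
  define m2 where "m2 = (c + 2 * F q0) / 3"
  have m: "c < m" "m < m2" "m2 < F q0" using q0(2) by (auto simp: m_def m2_def)
  obtain a0 k0 where a0: "a0 \<ge> 1" and k0: "k0 > 0"
    and carl: "\<And>a. a \<ge> a0 \<Longrightarrow>
      \<exists>J'. C1_deriv S (\<lambda>q. current a (exp (a * F q) * z q)
              (exp (a * F q) *\<^sub>R (Dz q + (a * z q) *\<^sub>R DF q)) q) J' \<and>
        (\<forall>q\<in>S \<inter> K. op_trace (J' q) \<ge> k0 * a\<^sup>2 * (exp (a * F q) * z q)\<^sup>2)"
  proof (rule carleman_divergence[OF K, of S z Dz Hz B])
    show "2 * (F2 q \<xi> \<bullet> \<xi>) - shift q * (\<xi> \<bullet> A \<xi>) > 0" if "q \<in> K" "\<xi> \<noteq> 0" "DF q \<bullet> \<xi> = 0" for q \<xi>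
      using that by (rule form)
  qed (use zeroth S dz Dz eqn in auto)
  note FS = C1_deriv_subset[OF C1_F S(3)]
  have cDF: "continuous_on K DF" and cg: "continuous_on K g" and cF: "continuous_on K F"
    using C1_derivD(3)[OF DF] C1_derivD(3)[OF g] C1_derivD(3)[OF C1_F] K(2) by (auto intro: continuous_on_subset)
  obtain C1 where C1: "C1 \<ge> 0" "\<And>q. q \<in> K \<Longrightarrow> norm (DF q) \<le> C1" by (rule compact_bound[OF K(1) cDF]) blast
  obtain C2 where C2: "C2 \<ge> 0" "\<And>q. q \<in> K \<Longrightarrow> norm (g q) \<le> C2" by (rule compact_bound[OF K(1) cg]) blast
  obtain M1 where M1: "M1 \<ge> 0" "\<And>q. q \<in> K \<Longrightarrow> norm (z q) \<le> M1" by (rule compact_bound[OF K(1) zK(1)]) blast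
  obtain M2 where M2: "M2 \<ge> 0" "\<And>q. q \<in> K \<Longrightarrow> norm (Dz q) \<le> M2" by (rule compact_bound[OF K(1) zK(2)]) blast
  obtain C3 where C3: "C3 \<ge> 0" "\<And>s. \<bar>step' s\<bar> \<le> C3" by (rule step'_bound) blast
  have cZ: "continuous_on K Z" using C1_derivD(3)[OF Z] by (rule continuous_on_subset) auto
  obtain C4 where C4: "C4 \<ge> 0" "\<And>q. q \<in> K \<Longrightarrow> norm (Z q) \<le> C4" by (rule compact_bound[OF K(1) cZ]) blast
  have ctZ: "continuous_on K (\<lambda>q. op_trace (Z' q))"
    unfolding op_trace_def
    by (intro continuous_intros continuous_on_subset[OF C1_derivD(2)[OF Z]]) auto
  obtain C5 where C5: "C5 \<ge> 0" "\<And>q. q \<in> K \<Longrightarrow> norm (op_trace (Z' q)) \<le> C5" by (rule compact_bound[OF K(1) ctZ]) blast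
  define L where "L = M2 + M1 * C1"
  have L0: "L \<ge> 0" using M1 M2 C1 by (simp add: L_def)
  define CJ where "CJ = 3 * C1 * L\<^sup>2 + C2 * M1 * L + C1 ^ 3 * M1\<^sup>2"
  have CJ0: "CJ \<ge> 0" using C1 C2 M1 L0 by (simp add: CJ_def)
  define \<theta>' where "\<theta>' q = step' ((F q - c) / (m - c)) / (m - c)" for q
  define \<Theta> where "\<Theta> q = step ((F q - c) / (m - c))" for q
  define Q where "Q = C3 / (m - c) * C1"
  have Q0: "Q \<ge> 0" using C3 C1 m by (simp add: Q_def)
  have \<Theta>: "C1_deriv S \<Theta> (\<lambda>q v. \<theta>' q * (DF q \<bullet> v))"
  proof -
    have "C1_deriv S (\<lambda>q. (F q - c) * (1 / (m - c))) (\<lambda>q v. (DF q \<bullet> v - 0) * (1 / (m - c)))"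
      by (rule C1_deriv_compose_linear[OF C1_deriv_diff[OF FS C1_deriv_const] bounded_linear_mult_left])
    from C1_deriv_step[OF this] show ?thesis
      by (simp add: \<Theta>_def[abs_def] \<theta>'_def divide_inverse mult_ac)
  qed
  have \<Theta>_low: "\<Theta> q = 0" "\<theta>' q = 0" if "F q \<le> c" for q
  proof -
    have "(F q - c) / (m - c) \<le> 0" using that m by (simp add: divide_nonpos_pos)
    then show "\<Theta> q = 0" "\<theta>' q = 0" by (simp_all add: \<Theta>_def \<theta>'_def step_eq_0 step'_eq_0)
  qed
  have \<Theta>_high: "\<Theta> q = 1" "\<theta>' q = 0" if "F q \<ge> m" for q
  proof -
    have "(F q - c) / (m - c) \<ge> 1" using that m by (simp add: le_divide_eq)
    then show "\<Theta> q = 1" "\<theta>' q = 0" by (simp_all add: \<Theta>_def \<theta>'_def step_eq_1 step'_eq_0)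
  qed
  have \<theta>'_DF: "\<bar>\<theta>' q * (DF q \<bullet> v)\<bar> \<le> Q * norm v" if "q \<in> K" for q v
  proof -
    have "\<bar>\<theta>' q\<bar> \<le> C3 / (m - c)" using C3 m by (simp add: \<theta>'_def divide_right_mono)
    moreover have "\<bar>DF q \<bullet> v\<bar> \<le> C1 * norm v"
      using Cauchy_Schwarz_ineq2[of "DF q" v] C1(2)[OF that] by (meson mult_right_mono norm_ge_zero order_trans)
    ultimately have "\<bar>\<theta>' q\<bar> * \<bar>DF q \<bullet> v\<bar> \<le> C3 / (m - c) * (C1 * norm v)"
      using C3 m by (intro mult_mono) auto
    then show ?thesis by (simp add: abs_mult Q_def)
  qed
  define \<eta>0 where "\<eta>0 = - \<Psi> q0 / 2"
  have \<eta>0: "\<eta>0 > 0" using \<Psi>S[OF q0(1)] by (simp add: \<eta>0_def)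
  obtain \<rho> where \<rho>: "\<rho> > 0" "\<And>q. q \<in> ball q0 \<rho> \<Longrightarrow> q \<in> S \<and> F q > m2 \<and> \<Psi> q < - \<eta>0 \<and> \<bar>z q\<bar> > \<bar>z q0\<bar> / 2"
  proof -
    have zS: "continuous_on S z"
      by (intro continuous_at_imp_continuous_on ballI has_derivative_continuous[OF dz])
    have o1: "open (S \<inter> (\<lambda>q. (F q - m2)) -` {0<..})"
      by (intro continuous_open_preimage S(1) continuous_intros C1_derivD(3)[OF FS])
    have o2: "open (S \<inter> (\<lambda>q. - \<eta>0 - \<Psi> q) -` {0<..})"
      by (intro continuous_open_preimage S(1) continuous_intros continuous_on_subset[OF C1_derivD(3)[OF \<Psi>]]) auto
    have o3: "open (S \<inter> (\<lambda>q. \<bar>z q\<bar> - \<bar>z q0\<bar> / 2) -` {0<..})"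
      by (intro continuous_open_preimage S(1) continuous_intros zS) auto
    define O0 where "O0 = (S \<inter> (\<lambda>q. (F q - m2)) -` {0<..})
      \<inter> (S \<inter> (\<lambda>q. - \<eta>0 - \<Psi> q) -` {0<..})
      \<inter> (S \<inter> (\<lambda>q. \<bar>z q\<bar> - \<bar>z q0\<bar> / 2) -` {0<..})"
    have "open O0"
      unfolding O0_def by (rule open_Int[OF open_Int[OF o1 o2] o3])
    moreover have "q0 \<in> O0"
      using q0 m nz \<eta>0 by (simp add: O0_def \<eta>0_def)
    ultimately obtain \<rho> where "\<rho> > 0" "ball q0 \<rho> \<subseteq> O0"
      by (meson openE)
    then show ?thesis using that[of \<rho>] by (auto simp: O0_def subset_iff)
  qed
  define Bq where "Bq = ball q0 \<rho>"
  define z1 where "z1 = \<bar>z q0\<bar> / 2"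
  have z1: "z1 > 0" using nz by (simp add: z1_def)
  have BS: "Bq \<subseteq> S" using \<rho>(2) by (auto simp: Bq_def)
  have Bm: "measure lborel Bq > 0"
    unfolding Bq_def using \<rho>(1) by (rule content_ball_pos)
  \<comment> \<open>There are two parameters: for fixed \<open>a\<close> the perturbation size
    \<open>e\<close> is sent to zero, and afterwards \<open>a\<close> to infinity. The width
    \<open>\<eta>\<close> of the boundary cutoff depends on both, which is harmless because it does
    not occur in this inequality.\<close>
  have main: "k0 * z1\<^sup>2 * (a\<^sup>2 * exp (2 * a * m2)) * measure lborel Bq
      \<le> (Q * CJ * (a\<^sup>2 * exp (2 * a * m)) + e * (C5 + Q * C4)) * measure lborel S"
    if a: "a \<ge> a0" and e: "e > 0" for a e
  proof -
    have a1: "a \<ge> 1" using a a0 by simp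
    define w where "w q = exp (a * F q) * z q" for q
    define W where "W q = exp (a * F q) *\<^sub>R (Dz q + (a * z q) *\<^sub>R DF q)" for q
    define J where "J q = current a (w q) (W q) q" for q
    obtain J' where J': "C1_deriv S J J'" "\<And>q. q \<in> S \<Longrightarrow> q \<in> K \<Longrightarrow> op_trace (J' q) \<ge> k0 * a\<^sup>2 * (w q)\<^sup>2"
      using carl[OF a] unfolding J_def[abs_def] w_def W_def by blast
    have JK: "continuous_on K J"
      unfolding J_def current_def w_def W_def
      by (intro continuous_intros bounded_linear.continuous_on[OF blA] cDF cg cF zK)
    have Jb: "norm (J q) \<le> CJ * (a\<^sup>2 * (exp (a * F q))\<^sup>2)" if q: "q \<in> K" for q
      unfolding J_def CJ_def
    proof (rule current_bound)
      show "norm (DF q) \<le> C1" "\<bar>g q\<bar> \<le> C2" using C1 C2 q by auto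
      show "\<bar>w q\<bar> \<le> exp (a * F q) * M1" using M1(2)[OF q] by (simp add: w_def abs_mult)
      have "norm (Dz q + (a * z q) *\<^sub>R DF q) \<le> norm (Dz q) + norm ((a * z q) *\<^sub>R DF q)"
        by (rule norm_triangle_ineq)
      also have "\<dots> \<le> a * M2 + a * (M1 * C1)"
      proof (rule add_mono)
        have "1 * norm (Dz q) \<le> a * M2" using a1 M2(2)[OF q] by (intro mult_mono) auto
        then show "norm (Dz q) \<le> a * M2" by simp
        have "\<bar>z q\<bar> * norm (DF q) \<le> M1 * C1" using M1 C1 q by (intro mult_mono) auto
        then show "norm ((a * z q) *\<^sub>R DF q) \<le> a * (M1 * C1)" using a1 by (simp add: abs_mult mult.assoc)
      qed
      finally have "norm (Dz q + (a * z q) *\<^sub>R DF q) \<le> a * L" by (simp add: L_def algebra_simps)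
      then show "norm (W q) \<le> exp (a * F q) * a * L" by (simp add: W_def mult.assoc)
    qed (use a1 M1 L0 C1 C2 in auto)
    define Y where "Y q = J q - e *\<^sub>R Z q" for q
    have Yc: "continuous_on K (\<lambda>q. \<Psi>' q (Y q))"
      unfolding Y_def by (intro C1_deriv_joint[OF \<Psi>] continuous_intros JK cZ) auto
    have lin\<Psi>: "linear (\<Psi>' q)" for q
      by (intro bounded_linear.linear C1_derivD(4)[OF \<Psi>]) auto
    have Yneg: "\<Psi>' q (Y q) < 0" if q: "q \<in> K" "\<Psi> q = 0" for q
    proof -
      define ee where "ee = exp (a * F q)"
      \<comment> \<open>Where \<open>z\<close> vanishes, \<open>w\<close> is zero and
        \<open>W\<close> is a multiple of \<open>Dz\<close>; only the stress-energy part of the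
        current is left, and its flux is the expression in \<open>flux\<close>.\<close>
      have J_eq: "J q = (ee\<^sup>2) *\<^sub>R ((2 * (DF q \<bullet> A (Dz q))) *\<^sub>R A (Dz q) - (Dz q \<bullet> A (Dz q)) *\<^sub>R A (DF q))"
        unfolding J_def current_def w_def W_def z0[OF q] ee_def[symmetric]
        by (simp add: linear_cmul[OF linA] power2_eq_square algebra_simps)
      have "\<Psi>' q (J q) = ee\<^sup>2 * (2 * (DF q \<bullet> A (Dz q)) * \<Psi>' q (A (Dz q)) - (Dz q \<bullet> A (Dz q)) * \<Psi>' q (A (DF q)))"
        unfolding J_eq by (simp add: linear_cmul[OF lin\<Psi>] linear_diff[OF lin\<Psi>])
      also have "\<dots> \<le> 0" using flux[OF q] by (simp add: mult_nonneg_nonpos)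
      finally have "\<Psi>' q (J q) \<le> 0" .
      moreover have "e * \<Psi>' q (Z q) > 0" using e transv[OF q] by simp
      ultimately show ?thesis by (simp add: Y_def linear_cmul[OF lin\<Psi>] linear_diff[OF lin\<Psi>])
    qed
    obtain \<eta>1 where \<eta>1: "\<eta>1 > 0" "\<And>q. q \<in> K \<Longrightarrow> \<Psi> q > - \<eta>1 \<Longrightarrow> \<Psi>' q (Y q) < 0"
    proof (rule negative_near_boundary[OF K(1) Yc continuous_on_subset[OF C1_derivD(3)[OF \<Psi>] subset_UNIV]])
      show "\<Psi> q \<le> 0" if "q \<in> K" for q using that by (rule \<Psi>K)
      show "\<Psi>' q (Y q) < 0" if "q \<in> K" "\<Psi> q = 0" for q using that by (rule Yneg)
    qed blast
    \<comment> \<open>The boundary cutoff varies where \<open>\<Psi>\<close> is between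
      \<open>- 2 * \<eta>\<close> and \<open>- \<eta>\<close>. The bound
      \<open>2 * \<eta> \<le> \<eta>1\<close> keeps this layer where the flux is negative, and
      \<open>2 * \<eta> \<le> \<eta>0\<close> keeps the cutoff equal to 1 on the test ball.\<close>
    define \<eta> where "\<eta> = min \<eta>0 \<eta>1 / 2"
    have \<eta>: "\<eta> > 0" "2 * \<eta> \<le> \<eta>0" "2 * \<eta> \<le> \<eta>1" using \<eta>0 \<eta>1 by (auto simp: \<eta>_def)
    define x where "x q = - (\<Psi> q / \<eta>) - 1" for q
    define cut where "cut q = step (x q)" for q
    have x_C1: "C1_deriv S x (\<lambda>q v. - (\<Psi>' q v / \<eta>) - 0)"
      unfolding x_def[abs_def]
      by (intro C1_deriv_diff C1_deriv_const C1_deriv_compose_linear[OF C1_deriv_subset[OF \<Psi> subset_UNIV]]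
          bounded_linear_minus bounded_linear_divide)
    have cut: "C1_deriv S cut (\<lambda>q v. step' (x q) * (- (\<Psi>' q v / \<eta>) - 0))"
      unfolding cut_def[abs_def] by (rule C1_deriv_step[OF x_C1])
    have x_bd: "x q \<le> 0" if "\<Psi> q \<ge> - \<eta>" for q
      using that \<eta>(1) by (simp add: x_def field_simps)
    have x_in: "x q \<ge> 1" if "\<Psi> q \<le> - 2 * \<eta>" for q
      using that \<eta>(1) by (simp add: x_def field_simps)
    have YS: "C1_deriv S Y (\<lambda>q v. J' q v - e *\<^sub>R Z' q v)"
      unfolding Y_def[abs_def]
      by (intro C1_deriv_diff J'(1) C1_deriv_compose_linear[OF C1_deriv_subset[OF Z subset_UNIV]] bounded_linear_scaleR_right)
    obtain P where P: "C1_deriv S (\<lambda>q. (cut q * \<Theta> q) *\<^sub>R Y q) P"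
      "\<And>q. q \<in> S \<Longrightarrow> op_trace (P q) = (cut q * \<Theta> q) * (op_trace (J' q) - e * op_trace (Z' q))
         + (cut q * (\<theta>' q * (DF q \<bullet> Y q)) + step' (x q) * (- (\<Psi>' q (Y q) / \<eta>) - 0) * \<Theta> q)"
      using C1_deriv_scaleR_trace[OF C1_deriv_mult[OF cut \<Theta>] YS] by (auto simp: op_trace_diff op_trace_scaleR)
    define KK where "KK = {q \<in> K. \<Psi> q \<le> - \<eta>}"
    have KK: "compact KK"
    proof -
      have "closed {q. \<Psi> q \<le> - \<eta>}"
        by (intro closed_Collect_le continuous_on_const C1_derivD(3)[OF \<Psi>])
      then have "compact (K \<inter> {q. \<Psi> q \<le> - \<eta>})" by (rule compact_Int_closed[OF K(1)])
      then show ?thesis by (simp add: KK_def Collect_conj_eq)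
    qed
    define \<alpha> where "\<alpha> = k0 * z1\<^sup>2 * (a\<^sup>2 * exp (2 * a * m2))"
    define \<beta> where "\<beta> = Q * CJ * (a\<^sup>2 * exp (2 * a * m)) + e * (C5 + Q * C4)"
    have \<beta>0: "\<beta> \<ge> 0" using Q0 CJ0 C5 C4 e by (simp add: \<beta>_def)
    have "\<alpha> * measure lborel Bq \<le> \<beta> * measure lborel S"
    proof (rule divergence_compact_support_le[OF S(1,2) KK _ P(1) _ _ BS])
      show "KK \<subseteq> S" using KS \<eta>(1) by (auto simp: KK_def)
      show "(cut q * \<Theta> q) *\<^sub>R Y q = 0" if q: "q \<in> S" "q \<notin> KK" for q
      proof (cases "q \<in> K")
        case True
        then have "\<Psi> q \<ge> - \<eta>" using q by (simp add: KK_def)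
        then show ?thesis using x_bd[of q] by (simp add: cut_def step_eq_0)
      next
        case False
        then have "F q \<le> c" using SK[OF q(1)] by force
        then show ?thesis by (simp add: \<Theta>_low)
      qed
      show "Bq \<in> sets lborel" by (simp add: Bq_def)
      fix q assume q: "q \<in> S"
      \<comment> \<open>The divergence of the cut-off field has four contributions: the Carleman
        term (\<open>t1\<close>), the perturbation (\<open>t2\<close>), the weight cutoff
        (\<open>t3\<close>) and the boundary cutoff (\<open>t4\<close>).\<close>
      show "\<alpha> * indicator Bq q - \<beta> \<le> op_trace (P q)"
      proof (cases "F q \<ge> c")
        case False
        then have "F q \<le> c" by simp
        then have "op_trace (P q) = 0" using P(2)[OF q] \<Theta>_low[of q] by simp
        moreover have "q \<notin> Bq" using False \<rho>(2)[of q] m by (auto simp: Bq_def)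
        ultimately show ?thesis using \<beta>0 by simp
      next
        case True
        then have qK: "q \<in> K" by (rule SK[OF q])
        have cut01: "0 \<le> cut q" "cut q \<le> 1" and \<Theta>01: "0 \<le> \<Theta> q" "\<Theta> q \<le> 1"
          by (simp_all add: cut_def \<Theta>_def step_bounds)
        have p01: "0 \<le> cut q * \<Theta> q" "cut q * \<Theta> q \<le> 1" using cut01 \<Theta>01 by (auto intro: mult_le_one)
        have tJ: "op_trace (J' q) \<ge> k0 * a\<^sup>2 * (w q)\<^sup>2" using J'(2)[OF q qK] .
        have t1: "(cut q * \<Theta> q) * op_trace (J' q) \<ge> \<alpha> * indicator Bq q"
        proof (cases "q \<in> Bq")
          case True
          then have b: "F q > m2" "\<Psi> q < - \<eta>0" "\<bar>z q\<bar> > z1" using \<rho>(2)[of q] by (auto simp: Bq_def z1_def)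
          have "\<Psi> q \<le> - 2 * \<eta>" using b(2) \<eta>(2) by linarith
          then have "cut q = 1" using x_in[of q] by (simp add: cut_def step_eq_1)
          moreover have "\<Theta> q = 1" using b(1) m by (intro \<Theta>_high) linarith
          moreover have "\<alpha> \<le> k0 * a\<^sup>2 * (w q)\<^sup>2"
          proof -
            have "z1\<^sup>2 \<le> \<bar>z q\<bar>\<^sup>2" using b(3) z1 by (intro power_mono) auto
            moreover have "exp (2 * a * m2) \<le> exp (2 * a * F q)" using b(1) a1 by simp
            ultimately have "z1\<^sup>2 * exp (2 * a * m2) \<le> (z q)\<^sup>2 * exp (2 * a * F q)"
              by (intro mult_mono) auto
            also have "\<dots> = (w q)\<^sup>2" by (simp add: w_def power_mult_distrib exp_double[symmetric] mult.assoc)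
            finally have "k0 * a\<^sup>2 * (z1\<^sup>2 * exp (2 * a * m2)) \<le> k0 * a\<^sup>2 * (w q)\<^sup>2"
              using k0 by (intro mult_left_mono) auto
            then show ?thesis by (simp add: \<alpha>_def mult_ac)
          qed
          ultimately show ?thesis using tJ True by simp
        next
          case False
          have "0 \<le> k0 * a\<^sup>2 * (w q)\<^sup>2" using k0 by simp
          then have "0 \<le> op_trace (J' q)" using tJ by linarith
          then show ?thesis using False p01 by simp
        qed
        have t2: "(cut q * \<Theta> q) * (e * op_trace (Z' q)) \<le> e * C5"
        proof -
          have "(cut q * \<Theta> q) * (e * op_trace (Z' q)) \<le> (cut q * \<Theta> q) * (e * C5)"
            using C5(2)[OF qK] e p01 by (intro mult_left_mono) auto
          also have "\<dots> \<le> 1 * (e * C5)" using p01 e C5 by (intro mult_right_mono) auto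
          finally show ?thesis by simp
        qed
        \<comment> \<open>The derivative of the weight cutoff vanishes for
          \<open>F q \<ge> m\<close>, so the exponential in the current is at most
          \<open>exp (2 * a * m)\<close> wherever this term is present.\<close>
        have t3: "cut q * (\<theta>' q * (DF q \<bullet> Y q)) \<ge> - (Q * CJ * (a\<^sup>2 * exp (2 * a * m)) + e * (Q * C4))"
        proof (cases "F q \<ge> m")
          case True
          have "0 \<le> Q * CJ * (a\<^sup>2 * exp (2 * a * m)) + e * (Q * C4)" using Q0 CJ0 C4(1) e by simp
          then show ?thesis using True by (simp add: \<Theta>_high)
        next
          case False
          have "norm (Y q) \<le> norm (J q) + norm (e *\<^sub>R Z q)" unfolding Y_def by (rule norm_triangle_ineq4)
          also have "norm (e *\<^sub>R Z q) \<le> e * C4" using C4(2)[OF qK] e by simp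
          also have "norm (J q) \<le> CJ * (a\<^sup>2 * exp (2 * a * m))"
          proof (rule order_trans[OF Jb[OF qK]])
            have "(exp (a * F q))\<^sup>2 = exp (2 * a * F q)" by (simp add: exp_double[symmetric] mult.assoc)
            also have "\<dots> \<le> exp (2 * a * m)" using False a1 by simp
            finally show "CJ * (a\<^sup>2 * (exp (a * F q))\<^sup>2) \<le> CJ * (a\<^sup>2 * exp (2 * a * m))"
              using CJ0 by (intro mult_left_mono) auto
          qed
          finally have "norm (Y q) \<le> CJ * (a\<^sup>2 * exp (2 * a * m)) + e * C4" by simp
          then have "Q * norm (Y q) \<le> Q * (CJ * (a\<^sup>2 * exp (2 * a * m)) + e * C4)"
            using Q0 by (rule mult_left_mono)
          then have b: "\<bar>\<theta>' q * (DF q \<bullet> Y q)\<bar> \<le> Q * (CJ * (a\<^sup>2 * exp (2 * a * m)) + e * C4)"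
            using \<theta>'_DF[OF qK, of "Y q"] by linarith
          have "cut q * \<bar>\<theta>' q * (DF q \<bullet> Y q)\<bar> \<le> 1 * \<bar>\<theta>' q * (DF q \<bullet> Y q)\<bar>"
            using cut01 by (intro mult_right_mono) auto
          moreover have "- (cut q * \<bar>\<theta>' q * (DF q \<bullet> Y q)\<bar>) \<le> cut q * (\<theta>' q * (DF q \<bullet> Y q))"
            using cut01 abs_ge_minus_self[of "cut q * (\<theta>' q * (DF q \<bullet> Y q))"] by (simp add: abs_mult)
          ultimately show ?thesis using b by (simp add: algebra_simps)
        qed
        \<comment> \<open>The factor \<open>1 / \<eta>\<close> may be huge, so this term is not
          estimated: in the layer where \<open>step'\<close> is nonzero the strict sign of the flux
          makes it nonnegative.\<close>
        have t4: "step' (x q) * (- (\<Psi>' q (Y q) / \<eta>) - 0) * \<Theta> q \<ge> 0"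
        proof (cases "x q \<ge> 1")
          case True then show ?thesis by (simp add: step'_eq_0)
        next
          case False
          then have "\<Psi> q > - \<eta>1" using x_in[of q] \<eta>(3) by linarith
          then have "\<Psi>' q (Y q) \<le> 0" using \<eta>1(2)[OF qK] by simp
          then have "0 \<le> - (\<Psi>' q (Y q) / \<eta>) - 0" using \<eta>(1) by (simp add: divide_nonpos_pos)
          then show ?thesis using step'_nonneg \<Theta>01 by (intro mult_nonneg_nonneg) auto
        qed
        have "op_trace (P q) = (cut q * \<Theta> q) * op_trace (J' q) - (cut q * \<Theta> q) * (e * op_trace (Z' q))
          + cut q * (\<theta>' q * (DF q \<bullet> Y q)) + step' (x q) * (- (\<Psi>' q (Y q) / \<eta>) - 0) * \<Theta> q"
          unfolding P(2)[OF q] by (simp add: algebra_simps)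
        then show ?thesis using t1 t2 t3 t4 unfolding \<beta>_def by (simp add: distrib_left)
      qed
    qed
    then show ?thesis by (simp add: \<alpha>_def \<beta>_def)
  qed
  have bound: "k0 * z1\<^sup>2 * measure lborel Bq * exp (a * (2 * (m2 - m))) \<le> Q * CJ * measure lborel S"
    if a: "a \<ge> a0" for a
  proof -
    have a1: "a \<ge> 1" using a a0 by simp
    let ?l = "k0 * z1\<^sup>2 * (a\<^sup>2 * exp (2 * a * m2)) * measure lborel Bq"
    let ?r = "Q * CJ * (a\<^sup>2 * exp (2 * a * m)) * measure lborel S"
    let ?s = "(C5 + Q * C4) * measure lborel S"
    have s0: "?s \<ge> 0" using C5 C4 Q0 by simp
    have "?l \<le> ?r"
    proof (rule field_le_epsilon)
      fix e :: real assume e: "e > 0"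
      \<comment> \<open>The perturbation parameter is divided by \<open>?s + 1\<close> so that its
        total contribution stays below \<open>e\<close> even if \<open>?s\<close> is zero.\<close>
      have "?l \<le> ?r + e / (?s + 1) * ?s"
        using main[OF a, of "e / (?s + 1)"] e s0 by (simp add: algebra_simps)
      also have "e / (?s + 1) * ?s \<le> e" using e s0 by (simp add: field_simps)
      finally show "?l \<le> ?r + e" by simp
    qed
    then have "a\<^sup>2 * exp (2 * a * m) * (k0 * z1\<^sup>2 * measure lborel Bq * exp (a * (2 * (m2 - m))))
      \<le> a\<^sup>2 * exp (2 * a * m) * (Q * CJ * measure lborel S)"
    proof -
      have "exp (2 * a * m2) = exp (2 * a * m) * exp (a * (2 * (m2 - m)))"
        by (simp add: exp_add[symmetric] algebra_simps)
      then show ?thesis using \<open>?l \<le> ?r\<close> by (simp add: mult_ac)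
    qed
    then show ?thesis using a1 by simp
  qed
  show False
    by (rule exp_beats_bound[OF _ _ bound]) (use k0 z1 Bm m in auto)
qed

end

section \<open>The ultrahyperbolic problem\<close>

lemma Basis_real_vec: "(Basis :: (real^'k) set) = range (\<lambda>i. axis i 1)"
  by (auto simp: Basis_vec_def)

lemma sum_Basis_spacetime:
  fixes \<phi> :: "(real^'m) \<times> (real^'n) \<Rightarrow> real"
  shows "sum \<phi> Basis = (\<Sum>i\<in>UNIV. \<phi> (axis i 1, 0)) + (\<Sum>j\<in>UNIV. \<phi> (0, axis j 1))"
proof -
  have 1: "inj_on (\<lambda>u. (u::real^'m, 0::real^'n)) Basis" "inj_on (\<lambda>u. (0::real^'m, u::real^'n)) Basis"
    by (auto intro!: inj_onI)
  have "sum \<phi> Basis = (\<Sum>u\<in>Basis. \<phi> (u, 0)) + (\<Sum>u\<in>Basis. \<phi> (0, u))"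
    unfolding Basis_prod_def
    by (subst sum.union_disjoint) (auto simp: sum.reindex 1)
  moreover have "inj (\<lambda>i. axis i (1::real))" by (auto intro!: injI simp: axis_eq_axis)
  ultimately show ?thesis
    unfolding Basis_real_vec by (simp add: sum.reindex axis_eq_axis inj_on_def)
qed

lemma gradient_inner_Basis: "b \<in> Basis \<Longrightarrow> gradient f q \<bullet> b = partial_deriv b f q"
  unfolding gradient_def by simp

lemma gradient_unique:
  assumes "(f has_derivative (\<lambda>v. D \<bullet> v)) (at q)"
  shows "gradient f q = D"
proof (rule euclidean_eqI)
  fix b :: 'a assume b: "b \<in> Basis"
  have "frechet_derivative f (at q) = (\<lambda>v. D \<bullet> v)" using frechet_derivative_at[OF assms] by simp
  then show "gradient f q \<bullet> b = D \<bullet> b" by (simp add: gradient_inner_Basis[OF b] partial_deriv_def)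
qed

lemma spacetime_Basis: "(axis i 1, 0) \<in> (Basis :: ((real^'m) \<times> (real^'n)) set)"
  "(0, axis j 1) \<in> (Basis :: ((real^'m) \<times> (real^'n)) set)"
  by (auto simp: Basis_prod_def Basis_real_vec)

lemma d_t_gradient: "d_t i z q = gradient z q \<bullet> (axis i 1, 0)"
  and d_x_gradient: "d_x j z q = gradient z q \<bullet> (0, axis j 1)"
  by (simp_all add: d_t_def d_x_def gradient_inner_Basis spacetime_Basis)

lemma nabla_vec_gradient: "nabla_vec X z q = X q \<bullet> gradient z q"
proof -
  have "X q \<bullet> gradient z q = (\<Sum>b\<in>Basis. (X q \<bullet> b) * (gradient z q \<bullet> b))" by (rule euclidean_inner)
  also have "\<dots> = nabla_vec X z q"
    unfolding sum_Basis_spacetime nabla_vec_def d_t_gradient d_x_gradient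
    by (simp add: inner_prod_def inner_axis)
  finally show ?thesis by simp
qed

lemma normal_deriv_gradient: "normal_deriv \<Omega> g q = gradient g q \<bullet> (0, outward_normal \<Omega> (snd q))"
proof -
  have "(0, outward_normal \<Omega> (snd q)) \<bullet> gradient g q
      = (\<Sum>b\<in>Basis. ((0, outward_normal \<Omega> (snd q)) \<bullet> b) * (gradient g q \<bullet> b))" by (rule euclidean_inner)
  also have "\<dots> = normal_deriv \<Omega> g q"
    unfolding sum_Basis_spacetime normal_deriv_def d_x_gradient by (simp add: inner_prod_def inner_axis)
  finally show ?thesis by (simp add: inner_commute)
qed

definition hessian :: "('a::euclidean_space \<Rightarrow> real) \<Rightarrow> 'a \<Rightarrow> 'a \<Rightarrow> 'a" where
  "hessian z q v = (\<Sum>b\<in>Basis. (gradient (partial_deriv b z) q \<bullet> v) *\<^sub>R b)"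

lemma wave_op_trace: "wave_op z q = op_trace (\<lambda>v. time_reflection (hessian z q v))"
proof -
  have h: "hessian z q c \<bullet> b = partial_deriv c (partial_deriv b z) q" if "b \<in> Basis" "c \<in> Basis" for b c
    using that by (simp add: hessian_def gradient_inner_Basis)
  have "op_trace (\<lambda>v. time_reflection (hessian z q v)) = (\<Sum>b\<in>Basis. hessian z q b \<bullet> time_reflection b)"
    unfolding op_trace_def by (simp add: time_reflection_def inner_prod_def)
  also have "\<dots> = wave_op z q"
    unfolding sum_Basis_spacetime wave_op_def d_t_def d_x_def
    by (simp add: h[OF spacetime_Basis(1) spacetime_Basis(1), symmetric] h[OF spacetime_Basis(2) spacetime_Basis(2), symmetric]
        time_reflection_def inner_prod_def sum_negf)
  finally show ?thesis by simp
qed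

text \<open>The partial derivatives extend to the closure one at a time; assembled into one
  continuous field they serve as the gradient at boundary points, where \<open>gradient\<close>
  itself is not evaluated.\<close>

lemma Ck_closure_gradient:
  assumes "Ck_closure k S f" "k \<ge> 1"
  obtains G where "continuous_on (closure S) G" "\<And>q. q \<in> S \<Longrightarrow> G q = gradient f q"
proof -
  have "\<exists>g. continuous_on (closure S) g \<and> (\<forall>q\<in>S. g q = partial_deriv b f q)" if "b \<in> Basis" for b
  proof -
    have "set [b] \<subseteq> Basis \<and> length [b] \<le> k" using that assms(2) by simp
    then have "\<exists>g. continuous_on (closure S) g \<and> (\<forall>q\<in>S. g q = iter_partial [b] f q)"
      using assms(1) unfolding Ck_closure_def by blast
    then show ?thesis by (simp add: iter_partial_def)
  qed
  then obtain g where g: "\<And>b. b \<in> Basis \<Longrightarrow> continuous_on (closure S) (g b) \<and> (\<forall>q\<in>S. g b q = partial_deriv b f q)"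
    by metis
  show ?thesis
  proof (rule that)
    show "continuous_on (closure S) (\<lambda>q. \<Sum>b\<in>Basis. g b q *\<^sub>R b)"
      using g by (intro continuous_on_sum continuous_on_scaleR continuous_on_const) auto
    show "(\<Sum>b\<in>Basis. g b q *\<^sub>R b) = gradient f q" if "q \<in> S" for q
      unfolding gradient_def using g that by (intro sum.cong) auto
  qed
qed

section \<open>The cylinder and its lateral boundary\<close>

lemma time_box_eq: "time_box T = (\<Inter>i. {t. - T < t $ i} \<inter> {t. t $ i < T})"
  by (auto simp: time_box_def)

lemma open_time_box: "open (time_box T :: (real^'m) set)"
  unfolding time_box_eq
  by (intro open_INT finite ballI open_Int open_Collect_less continuous_intros)

lemma bounded_time_box: "bounded (time_box T :: (real^'m) set)"
proof (rule bounded_subset[OF bounded_cbox])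
  show "time_box T \<subseteq> cbox (vec (- T)) (vec T)"
    by (auto simp: time_box_def mem_box_cart less_imp_le)
qed

lemma open_cone_exterior: "open (cone_exterior p)"
  unfolding cone_exterior_def by (intro open_Collect_less continuous_intros continuous_on_f)

text \<open>A local defining function of the spatial domain, read as a function of
  \<open>(t, x)\<close>, defines the cylinder near a lateral boundary point. Its gradient has no
  time component, and \<open>tangential_derivative_zero\<close> kills every component of
  \<open>G\<close> orthogonal to it.\<close>

lemma boundary_gradient_normal:
  fixes \<Omega> :: "(real^'n) set" and G :: "(real^'m) \<times> (real^'n) \<Rightarrow> (real^'m) \<times> (real^'n)"
  assumes \<Omega>: "open \<Omega>" "has_smooth_boundary \<Omega>" and q: "q \<in> lateral_boundary T \<Omega>"
    and z: "continuous_on (closure (cylinder T \<Omega>)) z" "\<And>q. q \<in> lateral_boundary T \<Omega> \<Longrightarrow> z q = 0"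
    and dz: "\<And>q. q \<in> cylinder T \<Omega> \<Longrightarrow> (z has_derivative (\<lambda>v. G q \<bullet> v)) (at q)"
    and G: "continuous_on (closure (cylinder T \<Omega>)) G"
  obtains k where "G q = k *\<^sub>R (0, outward_normal \<Omega> (snd q))"
proof -
  have q': "fst q \<in> time_box T" "snd q \<in> frontier \<Omega>" using q by (auto simp: lateral_boundary_def)
  obtain r0 \<phi> where l: "local_defining_function \<Omega> (snd q) r0 \<phi>"
    using \<Omega>(2) q'(2) by (auto simp: has_smooth_boundary_def)
  have r0: "r0 > 0" "gradient \<phi> (snd q) \<noteq> 0" "\<phi> (snd q) = 0" "\<Omega> \<inter> ball (snd q) r0 = {w \<in> ball (snd q) r0. \<phi> w < 0}"
    using l by (auto simp: local_defining_function_def)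
  have "open ((time_box T :: (real^'m) set) \<times> ball (snd q) r0)" by (intro open_Times open_time_box open_ball)
  moreover have "q \<in> time_box T \<times> ball (snd q) r0" using q' r0 by (simp add: mem_Times_iff)
  \<comment> \<open>The ball stays inside the open time box, so a point of it in the closure but
    outside the cylinder can only belong to the lateral boundary.\<close>
  ultimately obtain r where r: "r > 0" "ball q r \<subseteq> time_box T \<times> ball (snd q) r0" by (meson openE)
  define n :: "(real^'m) \<times> (real^'n)" where "n = (0, gradient \<phi> (snd q))"
  have n: "n \<noteq> 0" using r0 by (simp add: n_def zero_prod_def)
  have cyl: "closure (cylinder T \<Omega>) = closure (time_box T) \<times> closure \<Omega>"
    unfolding cylinder_def by (rule closure_Times)
  have "G q \<bullet> \<xi> = 0" if "n \<bullet> \<xi> = 0" for \<xi>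
  proof (rule tangential_derivative_zero[OF _ r(1) n _ _ _ z(1) _ dz G _ that])
    show "open (cylinder T \<Omega>)" unfolding cylinder_def by (intro open_Times open_time_box \<Omega>(1))
    show "((\<lambda>q. \<phi> (snd q)) has_derivative (\<lambda>v. n \<bullet> v)) (at q)"
      using has_derivative_compose[OF has_derivative_snd[OF has_derivative_ident] local_defining_function_has_derivative[OF l]]
      by (simp add: n_def inner_prod_def)
    show "\<phi> (snd q) = 0" by (rule r0(3))
    show "cylinder T \<Omega> \<inter> ball q r = {x \<in> ball q r. \<phi> (snd x) < 0}"
    proof (intro set_eqI iffI)
      fix x assume "x \<in> cylinder T \<Omega> \<inter> ball q r"
      then have x: "x \<in> ball q r" "snd x \<in> \<Omega>" by (auto simp: cylinder_def)
      then have "x \<in> time_box T \<times> ball (snd q) r0" using r(2) by blast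
      then have "snd x \<in> ball (snd q) r0" by (simp add: mem_Times_iff)
      then have "snd x \<in> {w \<in> ball (snd q) r0. \<phi> w < 0}" using r0(4) x(2) by blast
      then show "x \<in> {x \<in> ball q r. \<phi> (snd x) < 0}" using x(1) by simp
    next
      fix x assume x: "x \<in> {x \<in> ball q r. \<phi> (snd x) < 0}"
      then have b: "x \<in> time_box T \<times> ball (snd q) r0" using r(2) by blast
      then have "snd x \<in> {w \<in> ball (snd q) r0. \<phi> w < 0}" using x by (auto simp: mem_Times_iff)
      then have "snd x \<in> \<Omega>" using r0(4) by blast
      then show "x \<in> cylinder T \<Omega> \<inter> ball q r" using b x by (auto simp: cylinder_def mem_Times_iff)
    qed
    show "z x = 0" if "x \<in> closure (cylinder T \<Omega>)" "x \<in> ball q r" "x \<notin> cylinder T \<Omega>" for x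
    proof (rule z(2))
      have "fst x \<in> time_box T" using r(2) that(2) by (auto simp: mem_Times_iff)
      moreover have "snd x \<in> closure \<Omega>" using that(1) unfolding cyl by (simp add: mem_Times_iff)
      moreover from this have "snd x \<notin> \<Omega>"
        using that(3) \<open>fst x \<in> time_box T\<close> by (simp add: cylinder_def mem_Times_iff)
      ultimately show "x \<in> lateral_boundary T \<Omega>"
        using \<Omega>(1) by (simp add: lateral_boundary_def frontier_def mem_Times_iff interior_open)
    qed
    show "q \<in> closure (cylinder T \<Omega>)"
      unfolding cyl using q' closure_subset by (auto simp: mem_Times_iff frontier_def)
  qed auto
  then have "G q = (G q \<bullet> n / (n \<bullet> n)) *\<^sub>R n" by (rule gradient_parallel_normal[OF n])
  then obtain k where k: "G q = k *\<^sub>R n" by blast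
  have "n = norm (gradient \<phi> (snd q)) *\<^sub>R (0, outward_normal \<Omega> (snd q))"
    using r0(2) by (simp add: n_def outward_normal_eq[OF l] sgn_div_norm)
  with k have "G q = (k * norm (gradient \<phi> (snd q))) *\<^sub>R (0, outward_normal \<Omega> (snd q))"
    by (metis scaleR_scaleR)
  then show ?thesis by (rule that)
qed

text \<open>By the quotient rule, the expression whose sign defines \<open>\<Gamma>\<close> is
  \<open>(lapse \<epsilon> p q)\<^sup>2\<close> times the normal derivative of the weight.\<close>

lemma Gamma_obs_iff:
  assumes q: "q \<in> weight_region \<epsilon> p" "q \<in> lateral_boundary T \<Omega>"
  shows "q \<in> Gamma_obs p T \<Omega> \<epsilon> \<longleftrightarrow> grad_weight \<epsilon> p q \<bullet> (0, outward_normal \<Omega> (snd q)) > 0"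
proof -
  let ?n = "(0, outward_normal \<Omega> (snd q))"
  have h: "lapse \<epsilon> p q > 0" and f: "f_fun p q > 0" using q by (auto simp: weight_region_def)
  have r: "r_fun p q > 0" by (rule r_fun_pos'[OF f])
  have gf: "gradient (f_fun p) q = (1/2) *\<^sub>R time_reflection (q - p)"
    by (rule gradient_unique[OF C1_derivD(1)[OF C1_f UNIV_I]])
  have gr: "gradient (r_fun p) q = grad_r p q"
    by (rule gradient_unique[OF C1_derivD(1)[OF C1_r]]) (simp add: r)
  have "(1 - \<epsilon> * r_fun p q) * normal_deriv \<Omega> (f_fun p) q + \<epsilon> * f_fun p q * normal_deriv \<Omega> (r_fun p) q
    = (lapse \<epsilon> p q)\<^sup>2 * (grad_weight \<epsilon> p q \<bullet> ?n)"
    unfolding normal_deriv_gradient gf gr lapse_def[symmetric] grad_weight_def weight_def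
    using h by (simp add: inner_add_left field_simps power2_eq_square)
  then show ?thesis
    unfolding Gamma_obs_def cone_exterior_def using q(2) f h by (simp add: zero_less_mult_iff)
qed

section \<open>Consequences of the standing assumption on \<open>T\<close>\<close>

context
  fixes p :: "(real^'m) \<times> (real^'n)" and \<Omega> :: "(real^'n) set" and T :: real
  assumes \<Omega>: "open \<Omega>" "bounded \<Omega>"
    and T: "closure (cylinder T \<Omega> \<inter> cone_exterior p) \<inter> (frontier (time_box T) \<times> closure \<Omega>) = {}"
    and ne: "cylinder T \<Omega> \<inter> cone_exterior p \<noteq> {}"
begin

lemma closure_cylinder: "closure (cylinder T \<Omega>) = closure (time_box T) \<times> closure \<Omega>"
  unfolding cylinder_def by (rule closure_Times)

text \<open>The exterior of the cone is open, so points of it in the closure of the cylinder already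
  lie in the closure of the intersection, to which the assumption on \<open>T\<close>
  refers.\<close>

lemma time_box_if_exterior:
  assumes "(t, x) \<in> closure (cylinder T \<Omega>)" "(t, x) \<in> cone_exterior p"
  shows "t \<in> time_box T"
proof (rule ccontr)
  assume "t \<notin> time_box T"
  moreover have t: "t \<in> closure (time_box T)" "x \<in> closure \<Omega>"
    using assms(1) by (auto simp: closure_cylinder)
  ultimately have "t \<in> frontier (time_box T)" by (simp add: frontier_def interior_open[OF open_time_box])
  moreover have "(t, x) \<in> closure (cylinder T \<Omega> \<inter> cone_exterior p)"
    using open_Int_closure_subset[OF open_cone_exterior[of p], of "cylinder T \<Omega>"] assms by (auto simp: Int_commute)
  ultimately show False using T t(2) by blast
qed

text \<open>Moving the time of an exterior point towards \<open>fst p\<close> with \<open>x\<close>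
  fixed does not decrease \<open>f\<close>, so the path stays in the exterior. Were
  \<open>fst p\<close> outside the time box, the path would leave the box at a point that
  \<open>time_box_if_exterior\<close> excludes.\<close>

lemma apex_time: "fst p \<in> time_box T"
proof (rule ccontr)
  assume out: "fst p \<notin> time_box T"
  obtain t x where q: "(t, x) \<in> cylinder T \<Omega>" "(t, x) \<in> cone_exterior p" using ne by fastforce
  have tx: "t \<in> time_box T" "x \<in> \<Omega>" using q by (auto simp: cylinder_def)
  have "t + (fst p - t) \<notin> time_box T" using out by simp
  then obtain r where r: "0 < r" "r \<le> 1" "t + r *\<^sub>R (fst p - t) \<in> closure (time_box T)" "t + r *\<^sub>R (fst p - t) \<notin> time_box T"
    using first_exit[OF open_time_box tx(1), of "fst p - t"] by metis
  have "t + r *\<^sub>R (fst p - t) - fst p = (1 - r) *\<^sub>R (t - fst p)" by (simp add: algebra_simps)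
  then have "norm (t + r *\<^sub>R (fst p - t) - fst p) \<le> norm (t - fst p)"
    using r by (simp add: mult_left_le_one_le)
  then have "(norm (t + r *\<^sub>R (fst p - t) - fst p))\<^sup>2 \<le> (norm (t - fst p))\<^sup>2" by (intro power_mono) auto
  also have "(norm (t - fst p))\<^sup>2 < (norm (x - snd p))\<^sup>2"
    using q(2) by (simp add: cone_exterior_def f_fun_def)
  finally have "(t + r *\<^sub>R (fst p - t), x) \<in> cone_exterior p"
    by (simp add: cone_exterior_def f_fun_def)
  moreover have "(t + r *\<^sub>R (fst p - t), x) \<in> closure (cylinder T \<Omega>)"
    using r(3) tx(2) closure_subset[of \<Omega>] by (auto simp: closure_cylinder)
  ultimately show False using time_box_if_exterior r(4) by blast
qed

text \<open>At the time of the apex every \<open>x\<close> other than \<open>snd p\<close> is in the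
  exterior, so the supremum defining \<open>R_plus\<close> sees the whole spatial domain; the bound
  passes to the closure.\<close>

lemma r_fun_le_R_plus:
  assumes "snd q \<in> closure \<Omega>"
  shows "r_fun p q \<le> R_plus p T \<Omega>" and "R_plus p T \<Omega> > 0"
proof -
  obtain M where M: "\<And>x. x \<in> \<Omega> \<Longrightarrow> norm x \<le> M" using \<Omega>(2) by (auto simp: bounded_iff)
  have bdd: "bdd_above (r_fun p ` (cylinder T \<Omega> \<inter> cone_exterior p))"
  proof (rule bdd_aboveI2)
    fix q assume "q \<in> cylinder T \<Omega> \<inter> cone_exterior p"
    then have "norm (snd q) \<le> M" using M by (auto simp: cylinder_def)
    then show "r_fun p q \<le> M + norm (snd p)"
      using norm_triangle_ineq4[of "snd q" "snd p"] by (simp add: r_fun_def)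
  qed
  have le: "r_fun p q \<le> R_plus p T \<Omega>" if "q \<in> cylinder T \<Omega> \<inter> cone_exterior p" for q
    unfolding R_plus_def by (rule cSUP_upper[OF that bdd])
  obtain q1 where q1: "q1 \<in> cylinder T \<Omega> \<inter> cone_exterior p" using ne by blast
  then have "r_fun p q1 > 0" using r_fun_pos'[of p q1] by (simp add: cone_exterior_def)
  then show pos: "R_plus p T \<Omega> > 0" using le[OF q1] by linarith
  have "\<Omega> \<subseteq> {x. norm (x - snd p) \<le> R_plus p T \<Omega>}"
  proof
    fix x assume x: "x \<in> \<Omega>"
    show "x \<in> {x. norm (x - snd p) \<le> R_plus p T \<Omega>}"
    proof (cases "x = snd p")
      case True then show ?thesis using pos by simp
    next
      case False
      have "(fst p, x) \<in> cylinder T \<Omega> \<inter> cone_exterior p"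
        using x apex_time False by (auto simp: cylinder_def cone_exterior_def f_fun_def)
      then show ?thesis using le by (force simp: r_fun_def)
    qed
  qed
  then have "closure \<Omega> \<subseteq> {x. norm (x - snd p) \<le> R_plus p T \<Omega>}"
    by (rule closure_minimal) (intro closed_Collect_le continuous_intros)
  then show "r_fun p q \<le> R_plus p T \<Omega>" using assms by (auto simp: r_fun_def)
qed

end

text \<open>The observation region contains, at the fixed time of a point of
  \<open>\<Gamma>\<close>, a full one-sided spatial neighbourhood of that point. On this slice
  \<open>z\<close> and hence its spatial gradient vanish, and continuity carries the latter to the
  boundary.\<close>

lemma spatial_gradient_zero:
  fixes z :: "(real^'m) \<times> (real^'n) \<Rightarrow> real"
  assumes q: "q \<in> Gamma_obs p T \<Omega> \<epsilon>" and \<Omega>: "open \<Omega>" and \<sigma>: "\<sigma> > 0"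
    and z: "\<And>q. q \<in> W_obs p T \<Omega> \<sigma> \<epsilon> \<Longrightarrow> z q = 0"
    and dz: "\<And>q. q \<in> cylinder T \<Omega> \<Longrightarrow> (z has_derivative (\<lambda>v. G q \<bullet> v)) (at q)"
    and G: "continuous_on (closure (cylinder T \<Omega>)) G"
  shows "snd (G q) = 0"
proof -
  define t where "t = fst q"
  define y where "y = snd q"
  have q': "t \<in> time_box T" "y \<in> frontier \<Omega>" "(t, y) \<in> cone_exterior p" "(t, y) \<in> Gamma_obs p T \<Omega> \<epsilon>"
    using q by (auto simp: Gamma_obs_def lateral_boundary_def t_def y_def)
  have "open ((\<lambda>x. (t, x)) -` cone_exterior p)"
    by (intro open_vimage open_cone_exterior continuous_intros)
  moreover have "y \<in> (\<lambda>x. (t, x)) -` cone_exterior p" using q'(3) by simp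
  ultimately obtain s where s: "s > 0" "ball y s \<subseteq> (\<lambda>x. (t, x)) -` cone_exterior p" by (rule openE)
  \<comment> \<open>The radius \<open>\<sigma>\<close> keeps the slice in the neighbourhood of
    \<open>\<Gamma>\<close>, and \<open>s\<close> keeps it in the exterior of the cone.\<close>
  define N where "N = \<Omega> \<inter> ball y (min s \<sigma>)"
  have oN: "open N" using \<Omega> by (simp add: N_def open_Int)
  have zN: "z (t, x) = 0" if "x \<in> N" for x
  proof (rule z)
    have "(t, x) \<in> cone_exterior p" using that s by (auto simp: N_def)
    moreover have "(t, x) \<in> spatial_nbhd \<sigma> (Gamma_obs p T \<Omega> \<epsilon>)"
      unfolding spatial_nbhd_def using that by (intro UN_I[OF q'(4)]) (simp add: N_def)
    ultimately show "(t, x) \<in> W_obs p T \<Omega> \<sigma> \<epsilon>"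
      using that q'(1) by (auto simp: W_obs_def cylinder_def N_def)
  qed
  have GN: "snd (G (t, x)) = 0" if x: "x \<in> N" for x
  proof -
    have cyl: "(t, x) \<in> cylinder T \<Omega>" using x q'(1) by (simp add: cylinder_def N_def)
    have 1: "((\<lambda>x. (t, x)) has_derivative (\<lambda>v. (0, v))) (at x)"
      by (auto intro!: derivative_eq_intros)
    have "((\<lambda>x. z (t, x)) has_derivative (\<lambda>v. G (t, x) \<bullet> (0, v))) (at x)"
      by (rule has_derivative_compose[OF 1 dz[OF cyl]])
    moreover have "((\<lambda>x. z (t, x)) has_derivative (\<lambda>v. 0)) (at x)"
      by (rule has_derivative_transform_within_open[OF has_derivative_const[of 0] oN x]) (simp add: zN)
    ultimately have "(\<lambda>v. G (t, x) \<bullet> (0, v)) = (\<lambda>v. 0)" by (rule has_derivative_unique)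
    then have "snd (G (t, x)) \<bullet> snd (G (t, x)) = 0" by (auto simp: inner_prod_def dest: fun_cong)
    then show ?thesis by simp
  qed
  have yN: "y \<in> closure N"
  proof -
    have "y \<in> ball y (min s \<sigma>) \<inter> closure \<Omega>" using q'(2) s \<sigma> by (simp add: frontier_def)
    then show ?thesis
      using open_Int_closure_subset[OF open_ball[of y "min s \<sigma>"], of \<Omega>] by (auto simp: N_def Int_commute)
  qed
  have cont: "continuous_on (closure N) (\<lambda>x. snd (G (t, x)))"
  proof (intro continuous_on_snd continuous_on_compose2[OF G])
    show "continuous_on (closure N) (\<lambda>x. (t, x))" by (intro continuous_intros)
    have "closure N \<subseteq> closure \<Omega>" by (intro closure_mono) (auto simp: N_def)
    moreover have "t \<in> closure (time_box T)" using q'(1) closure_subset by blast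
    ultimately show "(\<lambda>x. (t, x)) ` closure N \<subseteq> closure (cylinder T \<Omega>)"
      unfolding cylinder_def closure_Times by auto
  qed
  have "snd (G (t, y)) = 0"
    by (rule continuous_constant_on_closure[OF cont _ yN]) (rule GN)
  then show ?thesis by (simp add: t_def y_def)
qed

text \<open>The point \<open>q0\<close> is fixed before \<open>c\<close>, the compact set and
  \<open>\<kappa>\<close> are chosen; the Carleman constants may thus degenerate as
  \<open>q0\<close> approaches the cone.\<close>

theorem unique_on_exterior:
  fixes p :: "(real^'m) \<times> (real^'n)" and \<Omega> :: "(real^'n) set"
  assumes \<Omega>: "open \<Omega>" "bounded \<Omega>" "has_smooth_boundary \<Omega>"
    and T: "closure (cylinder T \<Omega> \<inter> cone_exterior p) \<inter> (frontier (time_box T) \<times> closure \<Omega>) = {}"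
    and X: "continuous_on (closure (cylinder T \<Omega>)) X" and V: "continuous_on (closure (cylinder T \<Omega>)) V"
    and \<sigma>: "\<sigma> > 0" and \<delta>: "0 < \<delta>" "\<delta> < 1" and \<epsilon>: "\<epsilon> = \<delta>\<^sup>2 / R_plus p T \<Omega>"
    and sol: "is_solution T \<Omega> X V F H z1" "is_solution T \<Omega> X V F H z2"
    and W: "\<And>q. q \<in> W_obs p T \<Omega> \<sigma> \<epsilon> \<Longrightarrow> z1 q = z2 q"
    and q0: "q0 \<in> cylinder T \<Omega> \<inter> cone_exterior p"
  shows "z1 q0 = z2 q0"
proof -
  define U where "U = (cylinder T \<Omega> :: ((real^'m) \<times> (real^'n)) set)"
  define R where "R = R_plus p T \<Omega>"
  have oU: "open U" unfolding U_def cylinder_def by (intro open_Times open_time_box \<Omega>(1))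
  have bU: "bounded U" unfolding U_def cylinder_def by (intro bounded_Times bounded_time_box \<Omega>(2))
  have cU: "compact (closure U)" using bU by simp
  have clU: "closure U = closure (time_box T) \<times> closure \<Omega>" unfolding U_def cylinder_def by (rule closure_Times)
  have ne: "cylinder T \<Omega> \<inter> cone_exterior p \<noteq> {}" using q0 by blast
  note box_ext = time_box_if_exterior[OF \<Omega>(1,2) T ne]
  have q0\<Omega>: "snd q0 \<in> closure \<Omega>" using q0 closure_subset[of \<Omega>] by (auto simp: cylinder_def)
  have R0: "R > 0" unfolding R_def by (rule r_fun_le_R_plus(2)[OF \<Omega>(1,2) T ne q0\<Omega>])
  have rR: "r_fun p q \<le> R" if "snd q \<in> closure \<Omega>" for q
    unfolding R_def by (rule r_fun_le_R_plus(1)[OF \<Omega>(1,2) T ne that])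
  have \<epsilon>0: "\<epsilon> > 0" using \<delta> R0 by (simp add: \<epsilon> R_def)
  have h0: "lapse \<epsilon> p q > 0" if "snd q \<in> closure \<Omega>" for q
  proof -
    have "\<epsilon> * r_fun p q \<le> \<epsilon> * R" using rR[OF that] \<epsilon>0 by simp
    \<comment> \<open>This is where the size of \<open>\<delta>\<close> enters: on the closed
      spatial domain \<open>\<epsilon> * r\<close> is at most \<open>\<delta>\<^sup>2 < 1\<close>,
      so the weight has no pole.\<close>
    also have "\<dots> = \<delta>\<^sup>2" using R0 by (simp add: \<epsilon> R_def)
    also have "\<dots> < 1" using \<delta> by (simp add: power_less_one_iff)
    finally show ?thesis by (simp add: lapse_def)
  qed
  \<comment> \<open>Any level strictly between 0 and the weight of \<open>q0\<close> would serve: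
    positive to stay off the cone, smaller to reach \<open>q0\<close>.\<close>
  define c where "c = weight \<epsilon> p q0 / 2"
  have w0: "weight \<epsilon> p q0 > 0" using q0 h0[OF q0\<Omega>] by (simp add: weight_def cone_exterior_def)
  then have c0: "c > 0" by (simp add: c_def)
  \<comment> \<open>The superlevel set of the weight with the denominator multiplied out, which
    makes closedness immediate.\<close>
  define K where "K = {q \<in> closure U. f_fun p q \<ge> c * lapse \<epsilon> p q}"
  have cK: "compact K"
  proof -
    have "closed {q. c * lapse \<epsilon> p q \<le> f_fun p q}"
      unfolding lapse_def by (intro closed_Collect_le continuous_intros continuous_on_f continuous_on_r)
    then have "compact (closure U \<inter> {q. c * lapse \<epsilon> p q \<le> f_fun p q})" by (rule compact_Int_closed[OF cU])
    then show ?thesis by (simp add: K_def Collect_conj_eq)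
  qed
  have Kh: "lapse \<epsilon> p q > 0" if "q \<in> closure U" for q
    using that h0 by (auto simp: clU)
  have KR: "q \<in> weight_region \<epsilon> p" if "q \<in> K" for q
  proof -
    have "lapse \<epsilon> p q > 0" using that Kh by (simp add: K_def)
    moreover from this have "c * lapse \<epsilon> p q > 0" using c0 by simp
    ultimately show ?thesis using that by (simp add: K_def weight_region_def)
  qed
  have Kw: "weight \<epsilon> p q \<ge> c" if "q \<in> K" for q
    using that Kh[of q] by (simp add: K_def weight_def pos_le_divide_eq)
  have K_time: "fst q \<in> time_box T" if "q \<in> K" for q
    using box_ext[of "fst q" "snd q"] that KR[OF that]
    by (simp add: K_def U_def cone_exterior_def weight_region_def)
  \<comment> \<open>On \<open>K\<close> the weight is at least \<open>c\<close> and \<open>r\<close>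
    at most \<open>R\<close>, so the curvature coefficient \<open>\<epsilon> * weight / r\<close> is
    at least \<open>\<epsilon> * c / R = 2 * \<kappa>\<close>, twice what
    \<open>cone_form_positive\<close> has to exceed.\<close>
  define \<kappa> where "\<kappa> = \<epsilon> * c / (2 * R)"
  have \<kappa>0: "\<kappa> > 0" using \<epsilon>0 c0 R0 by (simp add: \<kappa>_def)
  have \<kappa>K: "\<kappa> < \<epsilon> * weight \<epsilon> p q / r_fun p q" if q: "q \<in> K" for q
  proof -
    have r: "r_fun p q > 0" using KR[OF q] weight_region_subset[of \<epsilon> p] by blast
    have "r_fun p q \<le> R" using q rR by (auto simp: K_def clU)
    have "\<kappa> < \<epsilon> * c / R" using \<epsilon>0 c0 R0 by (simp add: \<kappa>_def field_simps)
    also have "\<dots> \<le> \<epsilon> * weight \<epsilon> p q / r_fun p q"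
      using \<epsilon>0 c0 r Kw[OF q] \<open>r_fun p q \<le> R\<close> by (intro frac_le mult_left_mono mult_nonneg_nonneg) auto
    finally show ?thesis .
  qed
  obtain g' where cw: "carleman_weight time_reflection (weight_region \<epsilon> p) (weight \<epsilon> p) (grad_weight \<epsilon> p) (hess_weight \<epsilon> p)
     (multiplier \<kappa> \<epsilon> p) g'" using carleman_weight_cone by blast
  interpret carleman_weight time_reflection "weight_region \<epsilon> p" "weight \<epsilon> p" "grad_weight \<epsilon> p" "hess_weight \<epsilon> p"
     "multiplier \<kappa> \<epsilon> p" g' by (rule cw)
  note sh = cone_shift[OF cw]
  obtain \<psi> \<psi>' N N' where \<psi>: "C1_deriv UNIV \<psi> \<psi>'" "C1_deriv UNIV N N'"
    "\<And>x. x \<in> \<Omega> \<Longrightarrow> \<psi> x < 0" "\<And>x. x \<in> frontier \<Omega> \<Longrightarrow> \<psi> x = 0"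
    "\<And>x. x \<in> frontier \<Omega> \<Longrightarrow> \<psi>' x (N x) > 0"
    "\<And>x. x \<in> frontier \<Omega> \<Longrightarrow> \<exists>l>0. \<forall>v. \<psi>' x v = l * (outward_normal \<Omega> x \<bullet> v)"
    by (rule boundary_function[OF \<Omega>]) blast
  \<comment> \<open>The open region where the equation holds; \<open>K\<close> exceeds it only by
    points of the lateral boundary, as \<open>K_time\<close> excludes the temporal ends.\<close>
  define S where "S = U \<inter> weight_region \<epsilon> p"
  have Ck: "Ck_on 2 U z1" "Ck_on 2 U z2" "Ck_closure 1 U z1" "Ck_closure 1 U z2"
    using sol by (auto simp: is_solution_def U_def)
  obtain G1 where G1: "continuous_on (closure U) G1" "\<And>q. q \<in> U \<Longrightarrow> G1 q = gradient z1 q"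
    using Ck_closure_gradient[OF Ck(3)] by auto
  obtain G2 where G2: "continuous_on (closure U) G2" "\<And>q. q \<in> U \<Longrightarrow> G2 q = gradient z2 q"
    using Ck_closure_gradient[OF Ck(4)] by auto
  define z where "z q = z1 q - z2 q" for q
  define G where "G q = G1 q - G2 q" for q
  define Hz where "Hz q v = hessian z1 q v - hessian z2 q v" for q v
  have zU: "continuous_on (closure U) z"
    using Ck(3,4) unfolding z_def Ck_closure_def by (intro continuous_intros) auto
  have GU: "continuous_on (closure U) G" unfolding G_def by (intro continuous_intros G1 G2)
  have dz: "(z has_derivative (\<lambda>v. G q \<bullet> v)) (at q)" if q: "q \<in> U" for q
    unfolding z_def G_def G1(2)[OF q] G2(2)[OF q] inner_diff_left
    by (intro has_derivative_diff C1_derivD(1)[OF Ck_on_C1_deriv[OF Ck(1)]] C1_derivD(1)[OF Ck_on_C1_deriv[OF Ck(2)]] q) auto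
  have dG: "C1_deriv U G Hz"
  proof (rule C1_derivI)
    have D: "C1_deriv U (\<lambda>q. gradient z1 q - gradient z2 q) Hz"
      unfolding Hz_def[abs_def] hessian_def[abs_def]
      by (intro C1_deriv_diff Ck_on_2_hessian Ck(1,2))
    show "(G has_derivative Hz q) (at q)" if q: "q \<in> U" for q
      by (rule has_derivative_transform_within_open[OF C1_derivD(1)[OF D q] oU q]) (simp add: G_def G1 G2)
    show "continuous_on U (\<lambda>q. Hz q v)" for v by (rule C1_derivD(2)[OF D])
  qed
  obtain BX where BX: "BX \<ge> 0" "\<And>q. q \<in> closure U \<Longrightarrow> norm (X q) \<le> BX"
    by (rule compact_bound[OF cU X[folded U_def]]) blast
  obtain BV where BV: "BV \<ge> 0" "\<And>q. q \<in> closure U \<Longrightarrow> norm (V q) \<le> BV"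
    by (rule compact_bound[OF cU V[folded U_def]]) blast
  have eqn: "\<bar>box (Hz q)\<bar> \<le> (BX + BV) * (norm (G q) + \<bar>z q\<bar>)" if q: "q \<in> U" for q
  proof -
    have "box (Hz q) = wave_op z1 q - wave_op z2 q"
      unfolding box_def Hz_def wave_op_trace op_trace_diff[symmetric] by (simp add: linear_diff[OF linA])
    also have "wave_op z1 q + nabla_vec X z1 q + V q * z1 q = F q" "wave_op z2 q + nabla_vec X z2 q + V q * z2 q = F q"
      using sol q by (auto simp: is_solution_def U_def)
    then have "wave_op z1 q - wave_op z2 q = - (X q \<bullet> G q) - V q * z q"
      by (simp add: nabla_vec_gradient G_def G1(2)[OF q] G2(2)[OF q] z_def inner_diff_right algebra_simps)
    finally have "\<bar>box (Hz q)\<bar> \<le> \<bar>X q \<bullet> G q\<bar> + \<bar>V q\<bar> * \<bar>z q\<bar>" by (simp add: abs_mult[symmetric])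
    also have "\<bar>X q \<bullet> G q\<bar> \<le> norm (X q) * norm (G q)" by (rule Cauchy_Schwarz_ineq2)
    also have "\<dots> \<le> (BX + BV) * norm (G q)"
      using BX(2)[of q] BV(1) q closure_subset[of U] by (intro mult_right_mono) auto
    also have "\<bar>V q\<bar> * \<bar>z q\<bar> \<le> (BX + BV) * \<bar>z q\<bar>"
      using BV(2)[of q] BX(1) q closure_subset[of U] by (intro mult_right_mono) auto
    finally show ?thesis by (simp add: distrib_left)
  qed
  have lat0: "z q = 0" if "q \<in> lateral_boundary T \<Omega>" for q
    using sol that unfolding is_solution_def z_def by (cases q) fastforce
  have bd: "q \<in> lateral_boundary T \<Omega>" "snd q \<in> frontier \<Omega>" if q: "q \<in> K" "\<psi> (snd q) = 0" for q
  proof -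
    have "snd q \<notin> \<Omega>" using \<psi>(3) q(2) by force
    then show "snd q \<in> frontier \<Omega>" using q(1) \<Omega>(1) by (auto simp: K_def clU frontier_def interior_open)
    then show "q \<in> lateral_boundary T \<Omega>" using K_time[OF q(1)] by (auto simp: lateral_boundary_def mem_Times_iff)
  qed
  have flux: "2 * (grad_weight \<epsilon> p q \<bullet> time_reflection (G q)) * \<psi>' (snd q) (snd (time_reflection (G q)))
      - (G q \<bullet> time_reflection (G q)) * \<psi>' (snd q) (snd (time_reflection (grad_weight \<epsilon> p q))) \<le> 0"
    if q: "q \<in> K" "\<psi> (snd q) = 0" for q
  proof -
    let ?\<nu> = "outward_normal \<Omega> (snd q)"
    obtain k where k: "G q = k *\<^sub>R (0, ?\<nu>)"
      using boundary_gradient_normal[OF \<Omega>(1,3) bd(1)[OF q], of z G] zU lat0 dz GU by (auto simp: U_def)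
    obtain l where l: "l > 0" "\<And>v. \<psi>' (snd q) v = l * (?\<nu> \<bullet> v)" using \<psi>(6)[OF bd(2)[OF q]] by blast
    have tr: "time_reflection (k *\<^sub>R (0, ?\<nu>)) = k *\<^sub>R (0, ?\<nu>)" by (simp add: time_reflection_def)
    have sn: "?\<nu> \<bullet> snd (time_reflection (grad_weight \<epsilon> p q)) = grad_weight \<epsilon> p q \<bullet> (0, ?\<nu>)"
      by (simp add: time_reflection_def inner_prod_def inner_commute)
    \<comment> \<open>With a normal gradient both flux terms are multiples of the normal derivative
      of the weight, with factors 2 and -1, so the sum carries the sign of that derivative. On
      \<open>\<Gamma>\<close> the product vanishes since \<open>k = 0\<close> or the normal is zero;
      elsewhere the derivative is at most 0.\<close>
    have "2 * (grad_weight \<epsilon> p q \<bullet> time_reflection (G q)) * \<psi>' (snd q) (snd (time_reflection (G q)))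
      - (G q \<bullet> time_reflection (G q)) * \<psi>' (snd q) (snd (time_reflection (grad_weight \<epsilon> p q)))
      = (k\<^sup>2 * l * (?\<nu> \<bullet> ?\<nu>)) * (grad_weight \<epsilon> p q \<bullet> (0, ?\<nu>))"
      unfolding k tr l(2) sn by (simp add: inner_prod_def power2_eq_square algebra_simps)
    also have "\<dots> \<le> 0"
    proof (cases "q \<in> Gamma_obs p T \<Omega> \<epsilon>")
      case True
      have "snd (G q) = 0"
        by (rule spatial_gradient_zero[OF True \<Omega>(1) \<sigma>, of z]) (use W dz GU in \<open>auto simp: z_def U_def\<close>)
      then have "k = 0 \<or> ?\<nu> = 0" by (simp add: k)
      then show ?thesis by auto
    next
      case False
      then have "grad_weight \<epsilon> p q \<bullet> (0, ?\<nu>) \<le> 0"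
        using Gamma_obs_iff[OF KR[OF q(1)] bd(1)[OF q]] by simp
      moreover have "k\<^sup>2 * l * (?\<nu> \<bullet> ?\<nu>) \<ge> 0" using l(1) by simp
      ultimately show ?thesis by (rule mult_nonneg_nonpos[rotated])
    qed
    finally show ?thesis .
  qed
  have "z q0 = 0"
  proof (rule unique_continuation[of K S z G Hz "BX + BV" c "\<lambda>q. \<psi> (snd q)" "\<lambda>q v. \<psi>' (snd q) (snd v)"
        "\<lambda>q. (0, N (snd q))" "\<lambda>q v. (0, N' (snd q) (snd v))"])
    show "compact K" "K \<subseteq> weight_region \<epsilon> p" using cK KR by auto
    show "0 < 2 * (hess_weight \<epsilon> p q \<xi> \<bullet> \<xi>) - shift q * (\<xi> \<bullet> time_reflection \<xi>)"
      if "q \<in> K" "\<xi> \<noteq> 0" "grad_weight \<epsilon> p q \<bullet> \<xi> = 0" for q \<xi>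
      unfolding sh[OF KR[OF that(1)]]
      by (rule cone_form_positive[OF KR[OF that(1)] \<epsilon>0 \<kappa>0 \<kappa>K[OF that(1)] that(2,3)])
    show "0 < 2 * (hess_weight \<epsilon> p q (time_reflection (grad_weight \<epsilon> p q)) \<bullet> time_reflection (grad_weight \<epsilon> p q))
        + grad_weight \<epsilon> p q \<bullet> time_reflection (grad_weight \<epsilon> p q) * shift q" if "q \<in> K" for q
      unfolding sh[OF KR[OF that]] by (rule cone_zeroth_positive[OF KR[OF that] \<epsilon>0 \<kappa>0])
    show "open S" unfolding S_def by (rule open_Int[OF oU open_weight_region])
    show "bounded S" by (rule bounded_subset[OF bU]) (simp add: S_def)
    show "S \<subseteq> weight_region \<epsilon> p" by (simp add: S_def)
    show "(z has_derivative (\<lambda>v. G q \<bullet> v)) (at q)" if "q \<in> S" for q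
      using that by (intro dz) (simp add: S_def)
    show "C1_deriv S G Hz" by (rule C1_deriv_subset[OF dG]) (simp add: S_def)
    show "\<bar>box (Hz q)\<bar> \<le> (BX + BV) * (norm (G q) + \<bar>z q\<bar>)" if "q \<in> S" for q
      using that by (intro eqn) (simp add: S_def)
    show "q \<in> K" if "q \<in> S" "c \<le> weight \<epsilon> p q" for q
      using that closure_subset[of U] by (auto simp: S_def K_def weight_region_def weight_def pos_le_divide_eq)
    show "continuous_on K z" "continuous_on K G"
      using zU GU by (auto intro: continuous_on_subset simp: K_def)
    show "C1_deriv UNIV (\<lambda>q. \<psi> (snd q)) (\<lambda>q v. \<psi>' (snd q) (snd v))"
      by (rule C1_deriv_compose[OF \<psi>(1) bounded_linear_snd]) simp
    have N: "C1_deriv UNIV (\<lambda>q. N (snd q)) (\<lambda>q v. N' (snd q) (snd v))"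
      by (rule C1_deriv_compose[OF \<psi>(2) bounded_linear_snd]) simp
    show "C1_deriv UNIV (\<lambda>q. (0, N (snd q))) (\<lambda>q v. (0, N' (snd q) (snd v)))"
      by (rule C1_deriv_compose_linear[OF N]) (intro bounded_linear_Pair bounded_linear_zero bounded_linear_ident)
    show "\<psi> (snd q) < 0" if "q \<in> S" for q
      using that by (intro \<psi>(3)) (auto simp: S_def U_def cylinder_def)
    show "\<psi> (snd q) \<le> 0" if "q \<in> K" for q
    proof (cases "snd q \<in> \<Omega>")
      case True then show ?thesis using \<psi>(3) by (simp add: less_imp_le)
    next
      case False
      then have "snd q \<in> frontier \<Omega>" using that \<Omega>(1) by (auto simp: K_def clU frontier_def interior_open)
      then show ?thesis using \<psi>(4) by simp
    qed
    show "q \<in> S" if q: "q \<in> K" "\<psi> (snd q) < 0" for q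
    proof -
      have "snd q \<notin> frontier \<Omega>" using \<psi>(4)[of "snd q"] q(2) by auto
      then have "snd q \<in> \<Omega>" using q(1) \<Omega>(1) by (auto simp: K_def clU frontier_def interior_open)
      then show ?thesis using K_time[OF q(1)] KR[OF q(1)] by (auto simp: S_def U_def cylinder_def mem_Times_iff)
    qed
    show "z q = 0" if "q \<in> K" "\<psi> (snd q) = 0" for q by (rule lat0[OF bd(1)[OF that]])
    show "2 * (grad_weight \<epsilon> p q \<bullet> time_reflection (G q)) * \<psi>' (snd q) (snd (time_reflection (G q)))
      - G q \<bullet> time_reflection (G q) * \<psi>' (snd q) (snd (time_reflection (grad_weight \<epsilon> p q))) \<le> 0"
      if "q \<in> K" "\<psi> (snd q) = 0" for q by (rule flux[OF that])
    show "0 < \<psi>' (snd q) (snd (0, N (snd q)))" if "q \<in> K" "\<psi> (snd q) = 0" for q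
      using \<psi>(5)[OF bd(2)[OF that]] by simp
    show "q0 \<in> S" using q0 h0[OF q0\<Omega>] by (simp add: S_def U_def weight_region_def cone_exterior_def)
    show "c < weight \<epsilon> p q0" using w0 by (simp add: c_def)
  qed
  then show ?thesis by (simp add: z_def)
qed

theorem theorem4p2:
  shows "\<exists>\<delta>0>0.
    \<forall>(p :: (real^'m) \<times> (real^'n)) (\<Omega> :: (real^'n) set) (T :: real)
     (X :: (real^'m) \<times> (real^'n) \<Rightarrow> (real^'m) \<times> (real^'n))
     (V :: (real^'m) \<times> (real^'n) \<Rightarrow> real) (F :: (real^'m) \<times> (real^'n) \<Rightarrow> real)
     (H :: real^'m \<Rightarrow> real) (\<sigma> :: real) (\<delta> :: real) (\<epsilon> :: real)
     (z1 :: (real^'m) \<times> (real^'n) \<Rightarrow> real) (z2 :: (real^'m) \<times> (real^'n) \<Rightarrow> real).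
      \<Omega> \<noteq> {} \<and> open \<Omega> \<and> bounded \<Omega> \<and> has_smooth_boundary \<Omega> \<and>
      T > R_plus p T \<Omega> \<and>
      closure (cylinder T \<Omega> \<inter> cone_exterior p) \<inter> (frontier (time_box T) \<times> closure \<Omega>) = {} \<and>
      smooth_closure (cylinder T \<Omega>) X \<and>
      (\<forall>q \<in> cylinder T \<Omega> \<inter> frontier (cone_exterior p). X q = 0) \<and>
      smooth_closure (cylinder T \<Omega>) V \<and> smooth_closure (cylinder T \<Omega>) F \<and>
      smooth_closure (time_box T) H \<and>
      \<sigma> > 0 \<and> 0 < \<delta> \<and> \<delta> < \<delta>0 \<and> \<epsilon> = \<delta>\<^sup>2 / R_plus p T \<Omega> \<and>
      is_solution T \<Omega> X V F H z1 \<and> is_solution T \<Omega> X V F H z2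
      \<longrightarrow>
      ((\<forall>q \<in> W_obs p T \<Omega> \<sigma> \<epsilon>. (z1 q, grad_t z1 q) = (z2 q, grad_t z2 q)) \<longrightarrow>
         (\<forall>q \<in> cylinder T \<Omega> \<inter> cone_exterior p. z1 q = z2 q)) \<and>
      ((\<forall>q \<in> W_obs p T \<Omega> \<sigma> \<epsilon>. (z1 q, grad_x z1 q) = (z2 q, grad_x z2 q)) \<longrightarrow>
         (\<forall>q \<in> cylinder T \<Omega> \<inter> cone_exterior p. z1 q = z2 q))"
\<comment> \<open>The threshold 1 works in every dimension, because smallness of
  \<open>\<delta>\<close> serves only to keep \<open>1 - \<epsilon> r\<close> positive.\<close>
proof (rule exI[of _ 1], rule conjI[OF zero_less_one], intro allI impI, elim conjE)
  fix p :: "(real^'m) \<times> (real^'n)" and \<Omega> :: "(real^'n) set" and T :: real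
    and X :: "(real^'m) \<times> (real^'n) \<Rightarrow> (real^'m) \<times> (real^'n)"
    and V F :: "(real^'m) \<times> (real^'n) \<Rightarrow> real" and H :: "real^'m \<Rightarrow> real" and \<sigma> \<delta> \<epsilon> :: real
    and z1 z2 :: "(real^'m) \<times> (real^'n) \<Rightarrow> real"
  assume *: "open \<Omega>" "bounded \<Omega>" "has_smooth_boundary \<Omega>"
    "closure (cylinder T \<Omega> \<inter> cone_exterior p) \<inter> (frontier (time_box T) \<times> closure \<Omega>) = {}"
    and X: "smooth_closure (cylinder T \<Omega>) X" and V: "smooth_closure (cylinder T \<Omega>) V"
    and **: "\<sigma> > 0" "0 < \<delta>" "\<delta> < 1" "\<epsilon> = \<delta>\<^sup>2 / R_plus p T \<Omega>"
      "is_solution T \<Omega> X V F H z1" "is_solution T \<Omega> X V F H z2"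
  have c: "continuous_on (closure (cylinder T \<Omega>)) X" "continuous_on (closure (cylinder T \<Omega>)) V"
    using X V by (auto simp: smooth_closure_def Ck_closure_def)
  \<comment> \<open>Each of the two observations includes the values of the solutions; the gradient
    information at the boundary is recovered from them by
    \<open>spatial_gradient_zero\<close>.\<close>
  have "\<forall>q \<in> cylinder T \<Omega> \<inter> cone_exterior p. z1 q = z2 q"
    if "\<forall>q \<in> W_obs p T \<Omega> \<sigma> \<epsilon>. z1 q = z2 q"
  proof
    fix q assume q: "q \<in> cylinder T \<Omega> \<inter> cone_exterior p"
    show "z1 q = z2 q" by (rule unique_on_exterior[OF * c ** _ q]) (use that in simp)
  qed
  then show "((\<forall>q \<in> W_obs p T \<Omega> \<sigma> \<epsilon>. (z1 q, grad_t z1 q) = (z2 q, grad_t z2 q)) \<longrightarrow>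
         (\<forall>q \<in> cylinder T \<Omega> \<inter> cone_exterior p. z1 q = z2 q)) \<and>
      ((\<forall>q \<in> W_obs p T \<Omega> \<sigma> \<epsilon>. (z1 q, grad_x z1 q) = (z2 q, grad_x z2 q)) \<longrightarrow>
         (\<forall>q \<in> cylinder T \<Omega> \<inter> cone_exterior p. z1 q = z2 q))"
    by simp
qed

end
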